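(* For each $n\ge 2$ let $M_n$ be the minimum spanning arborescence, with boundary vertex $\partial$, of the fully oriented complete graph $\vec K_n$ on $\mathsf V_n=\{1,\dots,n\}$ with i.i.d. Exponential$(1)$ weights on its oriented edges, where $\partial=\partial_n\in\mathsf V_n\setminus\{1\}$ is a fixed vertex. Let $(\vec{\mathsf T},1)$ be the critical Poisson$(1)$ Galton--Watson tree conditioned to survive, with all edges oriented towards infinity. Then the sequence of rooted oriented graphs $((\mathsf V_n,M_n),1)$ converges locally weakly to $(\vec{\mathsf T},1)$ as $n\to\infty$. That is, for every $r\ge 0$ and every finite rooted oriented graph $(H,u)$, $$\mathbb P\big(B_{((\mathsf V_n,M_n),1)}(r)\simeq (H,u)\big)\longrightarrow \mathbb P\big(B_{(\vec{\mathsf T},1)}(r)\simeq (H,u)\big).$$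
   Context: $\vec K_n=(\mathsf V_n,\vec{\mathsf E}_n)$ has vertex set $\{1,\dots,n\}$ and, for each pair of distinct vertices $u,v$, both oriented edges $u\to v$ and $v\to u$. The weights $W(\vec e)$, $\vec e\in\vec{\mathsf E}_n$, are i.i.d. Exponential$(1)$. A spanning arborescence of $(\vec K_n,\partial)$ is a subset of $\vec{\mathsf E}_n$ in which every vertex of $\mathsf V_n\setminus\{\partial\}$ has exactly one outgoing edge, $\partial$ has no outgoing edge, and there are no cycles (even ignoring orientations); equivalently, a spanning tree with all edges oriented towards $\partial$. $M_n$ is the almost surely unique spanning arborescence of $(\vec K_n,\partial)$ minimizing $\sum_{\vec e}W(\vec e)$ over its edges. $\vec{\mathsf T}$: take a one-sided infinite path $P$ whose first vertex is called $1$; to each vertex of $P$ attach (rooted at that vertex) an independent Galton--Watson tree with Poisson$(1)$ offspring distribution; orient $P$ from $1$ towards infinity, and orient each attached tree towards $P$ (every edge from child to parent). For a rooted oriented graph $(G,o)$, $B_{(G,o)}(r)$ is the ball of radius $r$ around $o$ for the graph distance of the underlying unoriented graph, as a rooted oriented graph; $\simeq$ denotes graph isomorphism preserving the root and the orientations. *)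

theory Defs
  imports
    "Graph_Theory.Digraph_Isomorphism"
    "Graph_Theory.Shortest_Path"
    "HOL-Probability.Probability"
begin

section \<open>Rooted oriented graphs\<close>

text \<open>Distance in the underlying unoriented graph; it is infinite between different components.\<close>

definition unoriented_dist :: "('a, 'b) pre_digraph \<Rightarrow> 'a \<Rightarrow> 'a \<Rightarrow> ereal" where
  "unoriented_dist G = wf_digraph.\<mu> (with_proj (mk_symmetric G)) (\<lambda>_. 1)"

definition rooted_ball :: "('a, 'b) pre_digraph \<Rightarrow> 'a \<Rightarrow> real \<Rightarrow> ('a, 'b) pre_digraph" where
  "rooted_ball G v r = G \<restriction> {w \<in> verts G. unoriented_dist G v w \<le> ereal r}"

text \<open>This is \<^const>\<open>digraph_iso\<close> with the additional requirement that the root is preserved.\<close>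

definition rooted_iso :: "('a, 'b) pre_digraph \<times> 'a \<Rightarrow> ('c, 'd) pre_digraph \<times> 'c \<Rightarrow> bool"
    (infix \<open>\<simeq>\<^sub>r\<close> 50) where
  "Gv \<simeq>\<^sub>r Hu \<longleftrightarrow> (case (Gv, Hu) of ((G, v), (H, u)) \<Rightarrow>
     \<exists>f. pre_digraph.digraph_isomorphism G f \<and> H = app_iso f G \<and> iso_verts f v = u)"

section \<open>The minimum spanning arborescence\<close>

definition complete_oriented :: "nat \<Rightarrow> nat pair_pre_digraph" where
  "complete_oriented n =
     \<lparr> pverts = {1..n}, parcs = {(u, v). u \<in> {1..n} \<and> v \<in> {1..n} \<and> u \<noteq> v} \<rparr>"

text \<open>
  Absence of cycles even after forgetting orientations. In the symmetrization
  \<^const>\<open>mk_symmetric\<close> every arc gives rise to a spurious closed walk of length 2, so only cycles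
  of length at least 3 count there. Loops and genuine 2-cycles (two opposite arcs) are directed
  cycles, which \<^const>\<open>forest\<close> excludes.
\<close>

definition unoriented_acyclic :: "('a, 'b) pre_digraph \<Rightarrow> bool" where
  "unoriented_acyclic G \<longleftrightarrow>
     forest G \<and> \<not> (\<exists>p. pre_digraph.cycle (with_proj (mk_symmetric G)) p \<and> 3 \<le> length p)"

definition spanning_arborescence :: "'a pair_pre_digraph \<Rightarrow> 'a \<Rightarrow> 'a rel \<Rightarrow> bool" where
  "spanning_arborescence K d A \<longleftrightarrow>
     A \<subseteq> parcs K \<and>
     (let G = with_proj \<lparr> pverts = pverts K, parcs = A \<rparr> in
        (\<forall>v \<in> pverts K - {d}. \<exists>!e. e \<in> out_arcs G v) \<and>
        out_arcs G d = {} \<and>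
        unoriented_acyclic G)"

text \<open>
  On the null event where several arborescences attain the minimal weight, \<^const>\<open>arg_min\<close>
  picks one of them.
\<close>

definition min_arborescence :: "nat \<Rightarrow> nat \<Rightarrow> (nat \<times> nat \<Rightarrow> real) \<Rightarrow> nat pair_pre_digraph" where
  "min_arborescence n d w =
     \<lparr> pverts = {1..n},
       parcs = (ARG_MIN (\<lambda>A. \<Sum>e\<in>A. w e) A. spanning_arborescence (complete_oriented n) d A) \<rparr>"

section \<open>The limiting tree\<close>

text \<open>
  Ulam--Harris encoding: the individual \<open>xs\<close> has \<open>c xs\<close> children, namely \<open>xs @ [j]\<close> for
  \<open>j < c xs\<close>, and the root is \<open>[]\<close>.
\<close>

definition gw_tree :: "(nat list \<Rightarrow> nat) \<Rightarrow> nat list set" where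
  "gw_tree c = {xs. \<forall>ys j zs. xs = ys @ j # zs \<longrightarrow> j < c ys}"

text \<open>
  The vertices of the infinite path are \<open>(i, [])\<close> for \<open>i = 0, 1, 2, \<dots>\<close>, and \<open>(i, xs)\<close> is the
  individual \<open>xs\<close> of the tree attached to \<open>(i, [])\<close>, with offspring numbers \<open>c i\<close>. The first
  vertex of the path, the root of the whole tree, is \<open>(0, [])\<close>.
\<close>

definition spine_tree :: "(nat \<Rightarrow> nat list \<Rightarrow> nat) \<Rightarrow> (nat \<times> nat list) pair_pre_digraph" where
  "spine_tree c =
     \<lparr> pverts = {(i, xs). xs \<in> gw_tree (c i)},
       parcs = {((i, []), (Suc i, [])) | i. True} \<union>
               {((i, xs @ [j]), (i, xs)) | i xs j. xs @ [j] \<in> gw_tree (c i)} \<rparr>"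

end

(*
Let R be the set of cheapest out-edges of the vertices other than d. By symmetry R is the graph of
a uniformly random map, so its local limit at 1 can be computed by counting: a finite piece of the
limiting tree is described by its offspring numbers (its code), and a code occurs in R with
asymptotic probability prod exp(-1)/c!, which is its probability in the Poisson tree.

The minimum arborescence M differs from R at o(n) vertices in expectation. Indeed R becomes an
arborescence if the largest vertex z of each cycle is redirected along z -> u -> d with two edges of
weight at most s = n^(-1/4); there are O(log n) cycles on average, so the cost of M exceeds that of
R by O(s log n). On the other hand, at each vertex where M and R differ, M pays at least
t = n^(-17/16) more than R, except at the expected O(n^2 t) = o(n) vertices where the two cheapest
out-edges are closer than t. Since the law of (R, M) is invariant under relabelling the vertices
other than d, the ball of bounded size around 1 is unlikely to meet the difference of R and M.

Only lower bounds for the probabilities of codes are needed, as the limits sum to 1.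
*)
theory Submission
  imports Defs "HOL-Real_Asymp.Real_Asymp"
begin

section \<open>Balls in rooted oriented graphs\<close>

text \<open>The minimum arborescence M is a global minimizer without a local description; only its
  total cost can be compared with that of R. So M is never analysed near a vertex: the cost
  comparison bounds the number of rows where M leaves R, and each such row can affect only boundedly
  many roots as long as balls have bounded size. This is why a size bound m accompanies the
  comparison of balls. Ties are a separate obstacle, since row minima and arborescences are selected
  by \<open>SOME\<close> and \<open>arg_min\<close>: everything is made to depend on the finite
  comparison pattern of the weights alone, and symmetries are used off the null set of ties. Balls
  are iterated neighbourhoods of a relation, so that an isomorphism of balls reduces to matching in-
  and out-neighbours of their vertices.\<close>

primrec nbhd :: "'a rel \<Rightarrow> 'a \<Rightarrow> nat \<Rightarrow> 'a set" where
  "nbhd A v 0 = {v}"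
| "nbhd A v (Suc k) = nbhd A v k \<union> (A \<union> A\<inverse>) `` nbhd A v k"

lemma nbhd_mono: "i \<le> j \<Longrightarrow> nbhd A v i \<subseteq> nbhd A v j"
  by (rule lift_Suc_mono_le[of "nbhd A v"]) auto

lemma nbhd_self: "v \<in> nbhd A v k"
  by (induction k) auto

lemma nbhd_trans: "w \<in> nbhd A v i \<Longrightarrow> x \<in> nbhd A w j \<Longrightarrow> x \<in> nbhd A v (i + j)"
  by (induction j arbitrary: x) auto

lemma nbhd_sym: "w \<in> nbhd A v k \<Longrightarrow> v \<in> nbhd A w k"
proof (induction k arbitrary: w)
  case (Suc k)
  show ?case
  proof (cases "w \<in> nbhd A v k")
    case True
    then show ?thesis using Suc.IH by auto
  next
    case False
    then obtain x where x: "x \<in> nbhd A v k" "(x, w) \<in> A \<union> A\<inverse>"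
      using Suc.prems by auto
    then have "x \<in> nbhd A w 1" by auto
    from nbhd_trans[OF this Suc.IH[OF x(1)]] show ?thesis by simp
  qed
qed auto

lemma finite_nbhd:
  assumes "finite A"
  shows "finite (nbhd A v k)"
  using assms by (induction k) (auto intro: finite_Image)

lemma nbhd_subset: "A \<subseteq> V \<times> V \<Longrightarrow> v \<in> V \<Longrightarrow> nbhd A v k \<subseteq> V"
  by (induction k) auto

lemma nbhd_map_prod:
  assumes "inj \<pi>"
  shows "nbhd (map_prod \<pi> \<pi> ` A) (\<pi> v) k = \<pi> ` nbhd A v k"
proof (induction k)
  case (Suc k)
  have "(map_prod \<pi> \<pi> ` A \<union> (map_prod \<pi> \<pi> ` A)\<inverse>) `` (\<pi> ` S) = \<pi> ` ((A \<union> A\<inverse>) `` S)" for S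
    using assms by (fastforce simp: image_iff Image_iff inj_eq)
  with Suc show ?case by (simp add: image_Un)
qed simp

lemma awalk_imp_nbhd:
  assumes "pair_wf_digraph G"
    and "pre_digraph.awalk (with_proj (mk_symmetric (with_proj G))) v p w"
  shows "w \<in> nbhd (parcs G) v (length p)"
proof -
  interpret pair_wf_digraph G by fact
  interpret S: pair_wf_digraph "mk_symmetric (with_proj G)" by (rule wellformed_mk_symmetric)
  show ?thesis using assms(2)
  proof (induction p arbitrary: v)
    case Nil
    then show ?case by (simp add: S.awalk_def)
  next
    case (Cons e p)
    then have e: "e \<in> parcs (mk_symmetric (with_proj G))" "fst e = v"
      and p: "S.awalk (snd e) p w"
      using S.awalk_Cons_iff by auto
    have "snd e \<in> nbhd (parcs G) v 1"
      using e by (auto simp: parcs_mk_symmetric)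
    from nbhd_trans[OF this Cons.IH[OF p]] show ?case by simp
  qed
qed

lemma nbhd_imp_awalk:
  assumes "pair_wf_digraph G" "v \<in> pverts G" "w \<in> nbhd (parcs G) v k"
  shows "\<exists>p. pre_digraph.awalk (with_proj (mk_symmetric (with_proj G))) v p w \<and> length p \<le> k"
proof -
  interpret pair_wf_digraph G by fact
  interpret S: pair_wf_digraph "mk_symmetric (with_proj G)" by (rule wellformed_mk_symmetric)
  show ?thesis using assms(3)
  proof (induction k arbitrary: w)
    case 0
    then show ?case using assms(2) by (auto intro!: exI[of _ "[]"] simp: S.awalk_def)
  next
    case (Suc k)
    show ?case
    proof (cases "w \<in> nbhd (parcs G) v k")
      case True
      then show ?thesis using Suc.IH le_SucI by blast
    next
      case False
      then obtain x where x: "x \<in> nbhd (parcs G) v k" "(x, w) \<in> parcs G \<union> (parcs G)\<inverse>"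
        using Suc.prems by auto
      then obtain p where p: "S.awalk v p x" "length p \<le> k" using Suc.IH by blast
      have e: "(x, w) \<in> parcs (mk_symmetric (with_proj G))"
        using x(2) by (auto simp: parcs_mk_symmetric intro: bexI[rotated])
      then have "S.awalk x [(x, w)] w"
        using S.in_arcsD1 S.in_arcsD2 by (auto simp: S.awalk_def)
      with p(1) have "S.awalk v (p @ [(x, w)]) w" by (rule S.awalk_appendI)
      with p(2) show ?thesis by (intro exI[of _ "p @ [(x, w)]"]) simp
    qed
  qed
qed

text \<open>Walk lengths are integers, so the real radius may be replaced by its floor; a vertex in
  another component is reached by no walk and lies at infinite distance.\<close>

lemma unoriented_dist_le_iff:
  assumes "pair_wf_digraph G" "v \<in> pverts G" "0 \<le> r"
  shows "unoriented_dist (with_proj G) v w \<le> ereal r \<longleftrightarrow> w \<in> nbhd (parcs G) v (nat \<lfloor>r\<rfloor>)"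
proof -
  interpret pair_wf_digraph G by fact
  interpret S: pair_wf_digraph "mk_symmetric (with_proj G)" by (rule wellformed_mk_symmetric)
  have cost: "S.awalk_cost (\<lambda>_. 1) p = real (length p)" for p
    by (induction p) auto
  have eq: "unoriented_dist (with_proj G) v w = (INF p\<in>{p. S.awalk v p w}. ereal (real (length p)))"
    by (simp add: unoriented_dist_def S.\<mu>_def cost)
  show ?thesis
  proof
    assume "w \<in> nbhd (parcs G) v (nat \<lfloor>r\<rfloor>)"
    then obtain p where p: "S.awalk v p w" "length p \<le> nat \<lfloor>r\<rfloor>"
      using nbhd_imp_awalk[OF assms(1,2)] by blast
    then have "real (length p) \<le> r" using assms(3) by linarith
    with p(1) show "unoriented_dist (with_proj G) v w \<le> ereal r"
      unfolding eq by (intro INF_lower2[of p]) auto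
  next
    assume le: "unoriented_dist (with_proj G) v w \<le> ereal r"
    show "w \<in> nbhd (parcs G) v (nat \<lfloor>r\<rfloor>)"
    proof (rule ccontr)
      assume no: "w \<notin> nbhd (parcs G) v (nat \<lfloor>r\<rfloor>)"
      \<comment> \<open>The distance is an infimum, so a uniform gap is wanted: every walk has
        length at least floor r + 1, which exceeds r.\<close>
      have "ereal (of_int \<lfloor>r\<rfloor> + 1) \<le> ereal (real (length p))" if "S.awalk v p w" for p
      proof -
        have "\<not> length p \<le> nat \<lfloor>r\<rfloor>"
          using awalk_imp_nbhd[OF assms(1) that] no
            subsetD[OF nbhd_mono[of "length p" "nat \<lfloor>r\<rfloor>" "parcs G" v], of w] by auto
        then show ?thesis using assms(3) by simp
      qed
      then have "ereal (of_int \<lfloor>r\<rfloor> + 1) \<le> unoriented_dist (with_proj G) v w"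
        unfolding eq by (intro INF_greatest) auto
      with le have "ereal (of_int \<lfloor>r\<rfloor> + 1) \<le> ereal r" by (rule order_trans[rotated])
      then show False by simp linarith
    qed
  qed
qed

lemma rooted_ball_eq:
  assumes "pair_wf_digraph G" "v \<in> pverts G" "0 \<le> r"
  shows "rooted_ball (with_proj G) v r =
    with_proj \<lparr> pverts = nbhd (parcs G) v (nat \<lfloor>r\<rfloor>),
      parcs = parcs G \<inter> nbhd (parcs G) v (nat \<lfloor>r\<rfloor>) \<times> nbhd (parcs G) v (nat \<lfloor>r\<rfloor>) \<rparr>"
proof -
  interpret pair_wf_digraph G by fact
  have "parcs G \<subseteq> pverts G \<times> pverts G" using in_arcsD1 in_arcsD2 by auto
  from nbhd_subset[OF this assms(2)]
  have "{w \<in> pverts G. unoriented_dist (with_proj G) v w \<le> ereal r} = nbhd (parcs G) v (nat \<lfloor>r\<rfloor>)"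
    unfolding unoriented_dist_le_iff[OF assms] by auto
  moreover have "{e \<in> parcs G. fst e \<in> S \<and> snd e \<in> S} = parcs G \<inter> S \<times> S" for S by auto
  ultimately show ?thesis
    by (simp add: rooted_ball_def induce_subgraph_def with_proj_def)
qed

text \<open>Equality of the records forces tail and head to be \<open>fst\<close> and
  \<open>snd\<close>, so on each arc the arc map is the vertex map applied to both ends.
  Well-formedness of \<open>P\<close> is part of the library notion of isomorphism.\<close>

lemma rooted_iso_with_proj_iff:
  "(with_proj P, v) \<simeq>\<^sub>r (with_proj H, u) \<longleftrightarrow>
    pair_wf_digraph P \<and> (\<exists>f. inj_on f (pverts P) \<and> f ` pverts P = pverts H \<and>
      map_prod f f ` parcs P = parcs H \<and> f v = u)" (is "?L \<longleftrightarrow> ?R")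
proof
  assume ?L
  then obtain h where h: "pre_digraph.digraph_isomorphism (with_proj P) h"
    "with_proj H = app_iso h (with_proj P)" "iso_verts h v = u"
    by (auto simp: rooted_iso_def)
  have eqs: "pverts H = iso_verts h ` pverts P" "parcs H = iso_arcs h ` parcs P"
    "iso_tail h = fst" "iso_head h = snd"
    using arg_cong[OF h(2), of verts] arg_cong[OF h(2), of arcs]
      arg_cong[OF h(2), of tail] arg_cong[OF h(2), of head] by simp_all
  have wf: "pair_wf_digraph P" and inj: "inj_on (iso_verts h) (pverts P)"
    and a: "\<And>a. a \<in> parcs P \<Longrightarrow> iso_arcs h a = map_prod (iso_verts h) (iso_verts h) a"
    using h(1) eqs(3,4) unfolding pre_digraph.digraph_isomorphism_def
    by (auto simp: wf_digraph_wp_iff prod_eq_iff)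
  show ?R
    using wf inj eqs h(3) a by (intro conjI exI[of _ "iso_verts h"]) (auto simp: image_iff)
next
  assume ?R
  then obtain f where f: "pair_wf_digraph P" "inj_on f (pverts P)" "f ` pverts P = pverts H"
    "map_prod f f ` parcs P = parcs H" "f v = u" by blast
  define h where "h = \<lparr> iso_verts = f, iso_arcs = map_prod f f, iso_head = snd, iso_tail = fst \<rparr>"
  interpret pair_wf_digraph P by fact
  have sub: "parcs P \<subseteq> pverts P \<times> pverts P" using in_arcsD1 in_arcsD2 by auto
  have "inj_on (map_prod f f) (parcs P)"
    by (rule inj_on_subset[OF map_prod_inj_on[OF f(2) f(2)] sub])
  then have "pre_digraph.digraph_isomorphism (with_proj P) h"
    using f(1,2) by (auto simp: pre_digraph.digraph_isomorphism_def h_def wf_digraph_wp_iff)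
  moreover have "with_proj H = app_iso h (with_proj P)"
    using f(3,4) by (simp add: app_iso_def h_def with_proj_def)
  ultimately show ?L using f(5) by (auto simp: rooted_iso_def h_def intro!: exI[of _ h])
qed

lemma rooted_iso_image:
  assumes inj: "inj_on \<phi> (pverts P)" and v: "v \<in> pverts P"
    and sub: "parcs P \<subseteq> pverts P \<times> pverts P"
    and Q: "pverts Q = \<phi> ` pverts P" "parcs Q = map_prod \<phi> \<phi> ` parcs P"
  shows "(with_proj P, v) \<simeq>\<^sub>r (with_proj H, u) \<longleftrightarrow> (with_proj Q, \<phi> v) \<simeq>\<^sub>r (with_proj H, u)"
proof -
  have wfP: "pair_wf_digraph P" using sub by unfold_locales auto
  have wfQ: "pair_wf_digraph Q" using sub unfolding pair_wf_digraph_def Q by auto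
  define \<psi> where "\<psi> = the_inv_into (pverts P) \<phi>"
  have inv: "\<psi> (\<phi> x) = x" if "x \<in> pverts P" for x
    using the_inv_into_f_f[OF inj that] by (simp add: \<psi>_def)
  show ?thesis unfolding rooted_iso_with_proj_iff
  proof (intro iffI conjI wfP wfQ; elim conjE exE)
    fix f assume f: "inj_on f (pverts P)" "f ` pverts P = pverts H"
      "map_prod f f ` parcs P = parcs H" "f v = u"
    have 1: "inj_on (f \<circ> \<psi>) (pverts Q)"
      using f(1) inv by (auto simp: Q inj_on_def)
    have 2: "(f \<circ> \<psi>) ` pverts Q = pverts H"
      using f(2) inv by (auto simp: Q image_image cong: image_cong)
    have "map_prod (f \<circ> \<psi>) (f \<circ> \<psi>) (map_prod \<phi> \<phi> e) = map_prod f f e" if "e \<in> parcs P" for e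
      using sub that inv by (auto simp: prod_eq_iff)
    then have 3: "map_prod (f \<circ> \<psi>) (f \<circ> \<psi>) ` parcs Q = parcs H"
      using f(3) by (simp add: Q image_image cong: image_cong)
    show "\<exists>f. inj_on f (pverts Q) \<and> f ` pverts Q = pverts H \<and> map_prod f f ` parcs Q = parcs H
        \<and> f (\<phi> v) = u"
      using 1 2 3 f(4) inv[OF v] by (intro exI[of _ "f \<circ> \<psi>"]) simp
  next
    fix f assume f: "inj_on f (pverts Q)" "f ` pverts Q = pverts H"
      "map_prod f f ` parcs Q = parcs H" "f (\<phi> v) = u"
    have "inj_on (f \<circ> \<phi>) (pverts P)" using inj f(1) by (simp add: Q comp_inj_on)
    moreover have "map_prod (f \<circ> \<phi>) (f \<circ> \<phi>) ` parcs P = parcs H"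
      using f(3) by (simp add: Q image_image map_prod_def split_beta)
    ultimately show "\<exists>f. inj_on f (pverts P) \<and> f ` pverts P = pverts H \<and> map_prod f f ` parcs P = parcs H
        \<and> f v = u"
      using f(2,4) by (intro exI[of _ "f \<circ> \<phi>"]) (simp add: Q image_comp)
  qed
qed

text \<open>Matching neighbourhoods propagate by induction on the distance from the root.
  Injectivity is asked only on a set containing the ball and its neighbours; it lets an arc between
  two images be pulled back.\<close>

lemma rooted_ball_iso_cong:
  assumes wf: "pair_wf_digraph G1" "pair_wf_digraph G2"
    and v: "v \<in> pverts G1" "\<phi> v \<in> pverts G2" and r: "0 \<le> r"
    and inj: "inj_on \<phi> P"
    and P: "nbhd (parcs G1) v (nat \<lfloor>r\<rfloor>) \<subseteq> P"
    and out: "\<And>p. p \<in> nbhd (parcs G1) v (nat \<lfloor>r\<rfloor>) \<Longrightarrow> parcs G1 `` {p} \<subseteq> P"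
      "\<And>p. p \<in> nbhd (parcs G1) v (nat \<lfloor>r\<rfloor>) \<Longrightarrow> parcs G2 `` {\<phi> p} = \<phi> ` (parcs G1 `` {p})"
    and inn: "\<And>p. p \<in> nbhd (parcs G1) v (nat \<lfloor>r\<rfloor>) \<Longrightarrow> (parcs G1)\<inverse> `` {p} \<subseteq> P"
      "\<And>p. p \<in> nbhd (parcs G1) v (nat \<lfloor>r\<rfloor>) \<Longrightarrow> (parcs G2)\<inverse> `` {\<phi> p} = \<phi> ` ((parcs G1)\<inverse> `` {p})"
  shows "(rooted_ball (with_proj G1) v r, v) \<simeq>\<^sub>r (with_proj H, u) \<longleftrightarrow>
    (rooted_ball (with_proj G2) (\<phi> v) r, \<phi> v) \<simeq>\<^sub>r (with_proj H, u)"
proof -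
  define B where "B = nbhd (parcs G1) v (nat \<lfloor>r\<rfloor>)"
  have nb: "nbhd (parcs G2) (\<phi> v) j = \<phi> ` nbhd (parcs G1) v j" if "j \<le> nat \<lfloor>r\<rfloor>" for j
    using that
  proof (induction j)
    case (Suc j)
    have "(parcs G2 \<union> (parcs G2)\<inverse>) `` {\<phi> p} = \<phi> ` ((parcs G1 \<union> (parcs G1)\<inverse>) `` {p})"
      if "p \<in> nbhd (parcs G1) v j" for p
    proof -
      have "p \<in> nbhd (parcs G1) v (nat \<lfloor>r\<rfloor>)" using that subsetD[OF nbhd_mono[of j "nat \<lfloor>r\<rfloor>"]] Suc.prems by auto
      from out(2)[OF this] inn(2)[OF this] show ?thesis by (simp add: Un_Image image_Un)
    qed
    then have "(parcs G2 \<union> (parcs G2)\<inverse>) `` (\<phi> ` nbhd (parcs G1) v j)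
        = \<phi> ` ((parcs G1 \<union> (parcs G1)\<inverse>) `` nbhd (parcs G1) v j)"
      by (subst (1 2) Image_eq_UN) (simp add: image_UN)
    with Suc show ?case by (simp add: image_Un)
  qed simp
  have B2: "nbhd (parcs G2) (\<phi> v) (nat \<lfloor>r\<rfloor>) = \<phi> ` B" by (simp add: nb B_def)
  have arc: "(\<phi> p, \<phi> q) \<in> parcs G2 \<longleftrightarrow> (p, q) \<in> parcs G1" if "p \<in> B" "q \<in> B" for p q
  proof -
    have "(\<phi> p, \<phi> q) \<in> parcs G2 \<longleftrightarrow> \<phi> q \<in> \<phi> ` (parcs G1 `` {p})"
      using out(2)[of p] that(1) by (auto simp: B_def)
    also have "\<dots> \<longleftrightarrow> q \<in> parcs G1 `` {p}"
      using inj_on_image_mem_iff[OF inj, of q "parcs G1 `` {p}"] that P out(1)[of p]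
      by (auto simp: B_def)
    finally show ?thesis by simp
  qed
  show ?thesis
    unfolding rooted_ball_eq[OF wf(1) v(1) r] rooted_ball_eq[OF wf(2) v(2) r] B2 B_def[symmetric]
  proof (rule rooted_iso_image, goal_cases)
    case 1
    show ?case using inj P by (auto simp: B_def intro: inj_on_subset)
  next
    case 2
    show ?case by (simp add: B_def nbhd_self)
  next
    case 5
    show ?case using arc by (auto simp: image_iff)
  qed auto
qed

section \<open>Spanning arborescences as parent maps\<close>

definition fgraph :: "'a set \<Rightarrow> ('a \<Rightarrow> 'a) \<Rightarrow> 'a rel" where
  "fgraph S f = (\<lambda>v. (v, f v)) ` S"

lemma mem_fgraph_iff [simp]: "(x, y) \<in> fgraph S f \<longleftrightarrow> x \<in> S \<and> y = f x"
  by (auto simp: fgraph_def)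

lemma sum_fgraph: "(\<Sum>e\<in>fgraph S f. w e) = (\<Sum>v\<in>S. w (v, f v))"
  unfolding fgraph_def by (subst sum.reindex) (auto simp: inj_on_def)

lemma finite_fgraph [simp]: "finite S \<Longrightarrow> finite (fgraph S f)"
  by (simp add: fgraph_def)

text \<open>The number of vertices reachable in at least one step decreases along arcs:
  \<open>f v\<close> is reachable from \<open>v\<close> but, by acyclicity, not from itself.\<close>

lemma acyclic_fgraph_height:
  assumes "finite S" "acyclic (fgraph S f)"
  shows "\<exists>h::'a \<Rightarrow> nat. \<forall>v\<in>S. h (f v) < h v"
proof -
  define A where "A = fgraph S f"
  have fin: "finite {x. (v, x) \<in> A\<^sup>+}" for v
  proof (rule finite_subset)
    show "{x. (v, x) \<in> A\<^sup>+} \<subseteq> f ` S"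
      by (auto simp: A_def elim: tranclE)
  qed (use assms in auto)
  have "card {x. (f v, x) \<in> A\<^sup>+} < card {x. (v, x) \<in> A\<^sup>+}" if "v \<in> S" for v
  proof (rule psubset_card_mono[OF fin])
    have e: "(v, f v) \<in> A" using that by (simp add: A_def)
    then have "f v \<in> {x. (v, x) \<in> A\<^sup>+}" "f v \<notin> {x. (f v, x) \<in> A\<^sup>+}"
      using assms(2) by (auto simp: A_def acyclic_def)
    moreover have "{x. (f v, x) \<in> A\<^sup>+} \<subseteq> {x. (v, x) \<in> A\<^sup>+}"
      using e by (auto intro: trancl_into_trancl2)
    ultimately show "{x. (f v, x) \<in> A\<^sup>+} \<subset> {x. (v, x) \<in> A\<^sup>+}" by blast
  qed
  then show ?thesis by (intro exI[of _ "\<lambda>v. card {x. (v, x) \<in> A\<^sup>+}"]) simp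
qed

lemma pcas_nth:
  assumes "pcas x p y"
  shows "i < length p \<Longrightarrow> fst (p ! i) = (if i = 0 then x else snd (p ! (i - 1)))"
    and "p \<noteq> [] \<Longrightarrow> snd (last p) = y"
  using assms by (induction p arbitrary: x i) (auto simp: nth_Cons split: nat.splits)

text \<open>Every arc points from larger to smaller height. On an unoriented cycle, the two edges at
  a vertex of maximal height would both have to leave it, but a vertex has only one out-arc.\<close>

lemma fgraph_unoriented_acyclic:
  assumes fin: "finite S" and h: "\<And>v. v \<in> S \<Longrightarrow> h (f v) < (h v :: nat)"
  shows "unoriented_acyclic (with_proj \<lparr> pverts = V, parcs = fgraph S f \<rparr>)"
proof -
  let ?G = "with_proj \<lparr> pverts = V, parcs = fgraph S f \<rparr>"
  let ?S = "with_proj (mk_symmetric ?G)"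
  have "forest ?G"
    unfolding forest_def
  proof
    assume "\<exists>p. pre_digraph.cycle ?G p"
    then obtain p x where p: "pre_digraph.awalk ?G x p x" "p \<noteq> []"
      by (auto simp: pre_digraph.cycle_def)
    have *: "h y < h x \<or> (p = [] \<and> x = y)" if "set p \<subseteq> fgraph S f" "pcas x p y" for x y p
      using that
    proof (induction p arbitrary: x)
      case (Cons e p)
      obtain a where "e = (a, f a)" "a \<in> S" using Cons.prems(1) by (auto simp: fgraph_def)
      with Cons h[of a] show ?case by force
    qed auto
    from p *[of p x x] show False
      by (auto simp: pre_digraph.awalk_def cas_with_proj_eq)
  qed
  moreover have False if cyc: "pre_digraph.cycle ?S p" "3 \<le> length p" for p
  proof -
    obtain x where x: "set p \<subseteq> parcs (mk_symmetric ?G)" "pcas x p x"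
      "distinct (tl (pawalk_verts x p))"
      using cyc by (auto simp: pre_digraph.cycle_def pre_digraph.awalk_def cas_with_proj_eq
        awalk_verts_with_proj_eq)
    have "pawalk_verts y p = y # map snd p" if "pcas y p x" for y p
      using that by (induction p arbitrary: y) auto
    with x have dist: "distinct (map snd p)" by auto
    define m where "m = length p"
    have m: "3 \<le> m" using cyc(2) m_def by simp
    define X where "X i = h (snd (p ! i))" for i
    obtain i where i: "i < m" "\<And>j. j < m \<Longrightarrow> X j \<le> X i"
    proof -
      have i0: "0 < m" using m by simp
      have "Max (X ` {..<m}) \<in> X ` {..<m}" using i0 by (intro Max_in) auto
      then obtain i where "i < m" "X i = Max (X ` {..<m})" by auto
      then show ?thesis using that[of i] by simp
    qed
    have arc: "p ! j \<in> fgraph S f \<or> (snd (p ! j), fst (p ! j)) \<in> fgraph S f" if "j < m" for j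
    proof -
      have "p ! j \<in> parcs (mk_symmetric ?G)"
        using x(1) nth_mem[of j p] that unfolding m_def by blast
      then show ?thesis by (cases "p ! j") (auto simp: parcs_mk_symmetric simp del: mem_fgraph_iff)
    qed
    \<comment> \<open>The cyclic neighbours of the peak \<open>i\<close>. They are different because
      the length is at least 3, yet both turn out to be the parent of the peak.\<close>
    define prv where "prv = (if i = 0 then m - 1 else i - 1)"
    define nxt where "nxt = (if i = m - 1 then 0 else Suc i)"
    have lt: "prv < m" "nxt < m" "prv \<noteq> nxt" using i(1) m by (auto simp: prv_def nxt_def)
    have pi: "fst (p ! i) = snd (p ! prv)"
      using pcas_nth[OF x(2)] i(1) m unfolding prv_def m_def
      by (cases "i = 0") (auto simp: last_conv_nth)
    have pn: "fst (p ! nxt) = snd (p ! i)"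
      using pcas_nth(1)[OF x(2), of nxt] pcas_nth(2)[OF x(2)] lt(2) i(1) m last_conv_nth[of p]
      unfolding nxt_def m_def by (cases "i = length p - 1") auto
    have "snd (p ! prv) = f (snd (p ! i))"
      using arc[OF i(1)] pi h[of "snd (p ! prv)"] i(2)[OF lt(1)]
      by (cases "p ! i") (auto simp: X_def)
    moreover have "snd (p ! nxt) = f (snd (p ! i))"
      using arc[OF lt(2)] pn h[of "snd (p ! nxt)"] i(2)[OF lt(2)]
      by (cases "p ! nxt") (auto simp: X_def)
    ultimately show False
      using lt nth_eq_iff_index_eq[OF dist, of prv nxt] by (simp add: m_def)
  qed
  ultimately show ?thesis by (auto simp: unoriented_acyclic_def)
qed

lemma spanning_arborescence_fgraph:
  assumes "d \<in> {1..n}" "\<And>v. v \<in> {1..n} - {d} \<Longrightarrow> f v \<in> {1..n} - {v}"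
    and "acyclic (fgraph ({1..n} - {d}) f)"
  shows "spanning_arborescence (complete_oriented n) d (fgraph ({1..n} - {d}) f)"
proof -
  let ?S = "{1..n} - {d}"
  obtain h :: "nat \<Rightarrow> nat" where h: "\<forall>v\<in>?S. h (f v) < h v"
    using acyclic_fgraph_height[OF _ assms(3)] by blast
  have out: "out_arcs (with_proj \<lparr>pverts = {1..n}, parcs = fgraph ?S f\<rparr>) v =
      (if v \<in> ?S then {(v, f v)} else {})" for v
    by (auto simp: out_arcs_def)
  show ?thesis
    unfolding spanning_arborescence_def Let_def
  proof (intro conjI)
    show "fgraph ?S f \<subseteq> parcs (complete_oriented n)"
      using assms(1,2) by (fastforce simp: complete_oriented_def fgraph_def)
  next
    show "unoriented_acyclic (with_proj \<lparr>pverts = pverts (complete_oriented n), parcs = fgraph ?S f\<rparr>)"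
      using h by (intro fgraph_unoriented_acyclic) auto
  next
    have "\<exists>!e. e \<in> (if v \<in> ?S then {(v, f v)} else {})" if "v \<in> ?S" for v
      using that by (intro ex1I[of _ "(v, f v)"]) (simp_all split: if_splits)
    then show "\<forall>v\<in>pverts (complete_oriented n) - {d}.
        \<exists>!e. e \<in> out_arcs (with_proj \<lparr>pverts = pverts (complete_oriented n), parcs = fgraph ?S f\<rparr>) v"
      unfolding complete_oriented_def pair_pre_digraph.select_convs out by blast
  next
    show "out_arcs (with_proj \<lparr>pverts = pverts (complete_oriented n), parcs = fgraph ?S f\<rparr>) d = {}"
      unfolding complete_oriented_def pair_pre_digraph.select_convs out by simp
  qed
qed

lemma spanning_arborescenceD:
  assumes "spanning_arborescence (complete_oriented n) d A"
  shows "\<exists>f. (\<forall>v\<in>{1..n} - {d}. f v \<in> {1..n} - {v}) \<and> A = fgraph ({1..n} - {d}) f"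
proof -
  have sub: "A \<subseteq> parcs (complete_oriented n)"
    and ex1: "\<forall>v\<in>{1..n} - {d}. \<exists>!e. e \<in> A \<and> fst e = v"
    and no: "{e \<in> A. fst e = d} = {}"
    using assms by (auto simp: spanning_arborescence_def Let_def out_arcs_def complete_oriented_def)
  define f where "f v = snd (THE e. e \<in> A \<and> fst e = v)" for v
  have f: "(v, f v) \<in> A" "\<And>y. (v, y) \<in> A \<Longrightarrow> y = f v" if "v \<in> {1..n} - {d}" for v
  proof -
    from theI'[OF bspec[OF ex1 that]] show *: "(v, f v) \<in> A"
      by (metis f_def prod.collapse)
    show "y = f v" if "(v, y) \<in> A" for y
      using bspec[OF ex1 \<open>v \<in> {1..n} - {d}\<close>] * that by auto
  qed
  have "A = fgraph ({1..n} - {d}) f"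
  proof (intro set_eqI iffI)
    fix e assume e: "e \<in> A"
    then have "fst e \<in> {1..n} - {d}" using sub no by (cases e) (auto simp: complete_oriented_def)
    with f(2)[of "fst e" "snd e"] e show "e \<in> fgraph ({1..n} - {d}) f" by (cases e) auto
  next
    fix e assume "e \<in> fgraph ({1..n} - {d}) f"
    then obtain v where "v \<in> {1..n} - {d}" "e = (v, f v)" unfolding fgraph_def by blast
    with f(1)[of v] show "e \<in> A" by simp
  qed
  moreover have "f v \<in> {1..n} - {v}" if "v \<in> {1..n} - {d}" for v
    using f(1)[OF that] sub by (auto simp: complete_oriented_def)
  ultimately show ?thesis by blast
qed

lemma spanning_arborescence_acyclic:
  assumes "spanning_arborescence (complete_oriented n) d A" "d \<in> {1..n}"
  shows "acyclic A"
proof -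
  let ?G = "with_proj \<lparr> pverts = {1..n}, parcs = A \<rparr>"
  have sub: "A \<subseteq> {1..n} \<times> {1..n}" and forest: "forest ?G"
    using assms(1) by (auto simp: spanning_arborescence_def Let_def complete_oriented_def
        unoriented_acyclic_def)
  have "pair_wf_digraph \<lparr> pverts = {1..n}, parcs = A \<rparr>"
    using sub by unfold_locales auto
  then interpret wf_digraph ?G by (simp add: wf_digraph_wp_iff)
  show ?thesis
  proof (rule acyclicI, rule allI, rule notI)
    fix x assume "(x, x) \<in> A\<^sup>+"
    then obtain p where "awalk x p x" "p \<noteq> []"
      using reachable1_awalk[of x x] by auto
    then have "closed_w p" unfolding closed_w_def by blast
    then show False using forest closed_w_imp_cycle by (auto simp: forest_def)
  qed
qed

lemma acyclic_map_prod:
  assumes "inj \<pi>" "acyclic A"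
  shows "acyclic (map_prod \<pi> \<pi> ` A)"
proof (rule acyclicI, rule allI, rule notI)
  have *: "\<exists>a b. x = \<pi> a \<and> y = \<pi> b \<and> (a, b) \<in> A\<^sup>+" if "(x, y) \<in> (map_prod \<pi> \<pi> ` A)\<^sup>+" for x y
    using that
  proof induction
    case (base y)
    then show ?case by force
  next
    case (step y z)
    then obtain a b where ab: "x = \<pi> a" "y = \<pi> b" "(a, b) \<in> A\<^sup>+" by blast
    obtain b' c where c: "y = \<pi> b'" "z = \<pi> c" "(b', c) \<in> A" using step.hyps(2) by auto
    have "b' = b" using ab(2) c(1) assms(1) by (auto dest: injD)
    with ab(3) c(3) have "(a, c) \<in> A\<^sup>+" by (meson trancl.trancl_into_trancl)
    with ab(1) c(2) show ?case by blast
  qed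
  fix x assume "(x, x) \<in> (map_prod \<pi> \<pi> ` A)\<^sup>+"
  from *[OF this] assms show False by (auto simp: acyclic_def dest: injD)
qed

section \<open>Exponential weights\<close>

abbreviation exp_measure :: "real measure" where
  "exp_measure \<equiv> density lborel (exponential_density 1)"

text \<open>The exponential density is at most 1.\<close>

lemma emeasure_exp_measure_le:
  assumes "0 \<le> t"
  shows "emeasure exp_measure {a..<a + t} \<le> ennreal t"
proof -
  have "emeasure exp_measure {a..<a + t} = (\<integral>\<^sup>+x\<in>{a..<a + t}. ennreal (exponential_density 1 x) \<partial>lborel)"
    by (subst emeasure_density) auto
  also have "\<dots> \<le> (\<integral>\<^sup>+x. indicator {a..<a + t} x \<partial>lborel)"
    by (intro nn_integral_mono) (auto simp: exponential_density_def indicator_def)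
  also have "\<dots> = ennreal t"
    using assms by simp
  finally show ?thesis .
qed

locale rooted_complete =
  fixes n d :: nat
  assumes d_mem: "d \<in> {1..n} - {1}"
begin

definition V :: "nat set" where "V = {1..n} - {d}"

abbreviation E :: "(nat \<times> nat) set" where "E \<equiv> parcs (complete_oriented n)"

text \<open>The canonical product space on which all estimates are made;
  \<open>prob_transfer\<close> carries the probabilities over to an arbitrary space of
  weights.\<close>

definition P :: "(nat \<times> nat \<Rightarrow> real) measure" where "P = PiM E (\<lambda>_. exp_measure)"

lemma n_ge_2: "2 \<le> n" and d_in: "d \<in> {1..n}" and one_in_V: "1 \<in> V"
  using d_mem by (auto simp: V_def)

lemma finite_V [simp]: "finite V" and card_V: "card V = n - 1"
  using d_mem by (auto simp: V_def)

lemma E_eq: "E = {(u, v). u \<in> {1..n} \<and> v \<in> {1..n} \<and> u \<noteq> v}"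
  by (simp add: complete_oriented_def)

lemma finite_E [simp]: "finite E"
  by (rule finite_subset[of _ "{1..n} \<times> {1..n}"]) (auto simp: E_eq)

sublocale product_prob_space "\<lambda>_. exp_measure" E
  by (rule product_prob_spaceI) (simp add: prob_space_exponential_density)

sublocale Pr: prob_space P
  unfolding P_def by (rule prob_space_PiM) (rule prob_space_exponential_density, simp)

lemma space_P: "space P = E \<rightarrow>\<^sub>E UNIV"
  by (simp add: P_def space_PiM)

lemma measurable_component_P [measurable]: "e \<in> E \<Longrightarrow> (\<lambda>w. w e) \<in> borel_measurable P"
  unfolding P_def using measurable_component_singleton[of e E "\<lambda>_. exp_measure"]
  by (simp add: measurable_cong_sets[OF refl, of exp_measure borel])

text \<open>Integrate out the coordinate \<open>e\<close> before the others: \<open>Y\<close> is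
  then constant and the event is an interval of length t. With t tending to 0 this excludes ties,
  with t fixed it bounds near-ties.\<close>

lemma prob_coordinate_window:
  assumes e: "e \<in> E" and Y: "Y \<in> borel_measurable P"
    and dep: "\<And>w y. Y (w(e := y)) = Y w" and t: "0 \<le> t"
  shows "Pr.prob {w \<in> space P. Y w \<le> w e \<and> w e < Y w + t} \<le> t"
proof -
  define S where "S = {w \<in> space P. Y w \<le> w e \<and> w e < Y w + t}"
  have [measurable]: "Y \<in> borel_measurable P" by fact
  have [measurable]: "(\<lambda>w. w e) \<in> borel_measurable P" using e by simp
  have S[measurable]: "S \<in> sets P"
    unfolding S_def
    by (intro sets.sets_Collect_conj borel_measurable_le borel_measurable_less borel_measurable_add
        borel_measurable_const) auto
  have E: "insert e (E - {e}) = E" using e by auto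
  have "emeasure P S = (\<integral>\<^sup>+w. indicator S w \<partial>P)" by simp
  also have "\<dots> = (\<integral>\<^sup>+x. \<integral>\<^sup>+y. indicator S (x(e := y)) \<partial>exp_measure \<partial>PiM (E - {e}) (\<lambda>_. exp_measure))"
    using product_nn_integral_insert[of "E - {e}" e "indicator S"] S unfolding E P_def by simp
  also have "\<dots> \<le> (\<integral>\<^sup>+x. ennreal t \<partial>PiM (E - {e}) (\<lambda>_. exp_measure))"
  proof (rule nn_integral_mono)
    fix x :: "nat \<times> nat \<Rightarrow> real"
    have "(\<integral>\<^sup>+y. indicator S (x(e := y)) \<partial>exp_measure) \<le> (\<integral>\<^sup>+y. indicator {Y x..<Y x + t} y \<partial>exp_measure)"
      by (intro nn_integral_mono) (auto simp: S_def indicator_def dep)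
    also have "\<dots> \<le> ennreal t"
      using emeasure_exp_measure_le[OF t, of "Y x"] by simp
    finally show "(\<integral>\<^sup>+y. indicator S (x(e := y)) \<partial>exp_measure) \<le> ennreal t" .
  qed
  also have "\<dots> = ennreal t"
  proof -
    interpret Q: prob_space "PiM (E - {e}) (\<lambda>_. exp_measure)"
      by (rule prob_space_PiM) (rule prob_space_exponential_density, simp)
    show ?thesis by (simp add: Q.emeasure_space_1)
  qed
  finally have "emeasure P S \<le> ennreal t" .
  then show ?thesis using t unfolding S_def[symmetric] Pr.emeasure_eq_measure by simp
qed

section \<open>Ties between edge sets and events determined by comparisons\<close>

definition wsum :: "(nat \<times> nat \<Rightarrow> real) \<Rightarrow> (nat \<times> nat) set \<Rightarrow> real" where
  "wsum w A = (\<Sum>e\<in>A. w e)"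

lemma measurable_wsum [measurable]: "A \<subseteq> E \<Longrightarrow> (\<lambda>w. wsum w A) \<in> borel_measurable P"
  unfolding wsum_def by (intro borel_measurable_sum) auto

text \<open>Absence of ties. It makes all row minima and the minimum arborescence unique at once, so
  that the choices made by \<open>SOME\<close> and \<open>arg_min\<close> commute with
  relabellings.\<close>

definition gen :: "(nat \<times> nat \<Rightarrow> real) \<Rightarrow> bool" where
  "gen w \<longleftrightarrow> inj_on (wsum w) (Pow E)"

text \<open>Equality of the two sums determines \<open>w e\<close> from the other weights, so it has
  probability at most t for every positive t.\<close>

lemma AE_wsum_neq:
  assumes "A \<subseteq> E" "B \<subseteq> E" "e \<in> A" "e \<notin> B"
  shows "AE w in P. wsum w A \<noteq> wsum w B"
proof -
  define Y where "Y w = wsum w B - wsum w (A - {e})" for w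
  have [measurable]: "(\<lambda>w. w e) \<in> borel_measurable P" using assms by auto
  have Y[measurable]: "Y \<in> borel_measurable P" unfolding Y_def using assms
    by (intro borel_measurable_diff measurable_wsum) auto
  have dep: "Y (w(e := y)) = Y w" for w y
    using assms by (auto simp: Y_def wsum_def intro!: arg_cong2[of _ _ _ _ "(-)"] sum.cong)
  have fin: "finite A" by (rule finite_subset[OF assms(1) finite_E])
  have eq: "wsum w A = wsum w B \<longleftrightarrow> w e = Y w" for w
    using sum.remove[OF fin assms(3), of w] by (auto simp: Y_def wsum_def)
  have "Pr.prob {w \<in> space P. w e = Y w} \<le> t" if "0 < t" for t
  proof -
    have "Pr.prob {w \<in> space P. w e = Y w} \<le> Pr.prob {w \<in> space P. Y w \<le> w e \<and> w e < Y w + t}"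
      using that by (intro Pr.finite_measure_mono) (auto intro!: sets.sets_Collect_conj
          borel_measurable_le borel_measurable_less borel_measurable_add)
    also have "\<dots> \<le> t"
      using that assms by (intro prob_coordinate_window Y dep) auto
    finally show ?thesis .
  qed
  then have "Pr.prob {w \<in> space P. w e = Y w} \<le> 0"
    by (rule field_le_epsilon) simp
  then have "Pr.prob {w \<in> space P. w e = Y w} = 0"
    using measure_nonneg[of P "{w \<in> space P. w e = Y w}"] by linarith
  then have "AE w in P. w e \<noteq> Y w"
    by (subst AE_iff_measurable[OF _ refl]) (auto simp: Pr.emeasure_eq_measure)
  then show ?thesis by (simp add: eq)
qed

lemma AE_gen: "AE w in P. gen w"
proof -
  have "AE w in P. \<forall>p\<in>{(A, B). A \<in> Pow E \<and> B \<in> Pow E \<and> A \<noteq> B}. wsum w (fst p) \<noteq> wsum w (snd p)"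
  proof (rule AE_finite_allI)
    have "finite (Pow E \<times> Pow E)" by (simp del: Pow_iff)
    then show "finite {(A, B). A \<in> Pow E \<and> B \<in> Pow E \<and> A \<noteq> B}"
      by (rule finite_subset[rotated]) auto
  next
    fix p assume p: "p \<in> {(A, B). A \<in> Pow E \<and> B \<in> Pow E \<and> A \<noteq> B}"
    then have "fst p \<noteq> snd p" by auto
    then obtain e where "e \<in> fst p - snd p \<or> e \<in> snd p - fst p" by blast
    then show "AE w in P. wsum w (fst p) \<noteq> wsum w (snd p)"
    proof
      assume "e \<in> fst p - snd p"
      then show ?thesis using p by (intro AE_wsum_neq[of _ _ e]) auto
    next
      assume "e \<in> snd p - fst p"
      then have "AE w in P. wsum w (snd p) \<noteq> wsum w (fst p)"
        using p by (intro AE_wsum_neq[of _ _ e]) auto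
      then show ?thesis by (rule AE_mp) (auto intro!: AE_I2)
    qed
  qed
  then show ?thesis
  proof (rule AE_mp, intro AE_I2 impI)
    fix w assume ne: "\<forall>p\<in>{(A, B). A \<in> Pow E \<and> B \<in> Pow E \<and> A \<noteq> B}. wsum w (fst p) \<noteq> wsum w (snd p)"
    show "gen w"
      unfolding gen_def
    proof (rule inj_onI, rule ccontr)
      fix A B assume "A \<in> Pow E" "B \<in> Pow E" "wsum w A = wsum w B" "A \<noteq> B"
      then show False using bspec[OF ne, of "(A, B)"] by simp
    qed
  qed
qed

text \<open>All the combinatorial objects below depend on the weights only through the comparisons of
  the weights of edge sets, of which there are finitely many; this is what makes them measurable.\<close>

definition pat :: "(nat \<times> nat \<Rightarrow> real) \<Rightarrow> ((nat \<times> nat) set \<times> (nat \<times> nat) set) set" where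
  "pat w = {(A, B). A \<in> Pow E \<and> B \<in> Pow E \<and> wsum w A \<le> wsum w B}"

lemma pat_measurable:
  assumes "\<And>w w'. pat w = pat w' \<Longrightarrow> Q w = Q w'"
  shows "{w \<in> space P. Q w} \<in> sets P"
proof -
  define \<S> where "\<S> = {S. S \<subseteq> Pow E \<times> Pow E \<and> (\<exists>w. Q w \<and> pat w = S)}"
  have "\<S> \<subseteq> Pow (Pow E \<times> Pow E)" by (auto simp: \<S>_def)
  then have "finite \<S>" by (rule finite_subset) simp
  have "{w \<in> space P. pat w = S} \<in> sets P" if "S \<subseteq> Pow E \<times> Pow E" for S
  proof -
    have "pat w = S \<longleftrightarrow> (\<forall>p\<in>Pow E \<times> Pow E. p \<in> S \<longleftrightarrow> wsum w (fst p) \<le> wsum w (snd p))" for w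
    proof -
      have "pat w = {p \<in> Pow E \<times> Pow E. wsum w (fst p) \<le> wsum w (snd p)}"
        by (auto simp: pat_def)
      then show ?thesis using that by blast
    qed
    then have "{w \<in> space P. pat w = S} =
        {w \<in> space P. \<forall>p\<in>Pow E \<times> Pow E. p \<in> S \<longleftrightarrow> wsum w (fst p) \<le> wsum w (snd p)}"
      by simp
    also have "\<dots> \<in> sets P"
    proof (rule sets.sets_Collect_finite_All)
      fix p assume "p \<in> Pow E \<times> Pow E"
      then have "{w \<in> space P. wsum w (fst p) \<le> wsum w (snd p)} \<in> sets P"
        by (intro borel_measurable_le measurable_wsum) auto
      then show "{w \<in> space P. p \<in> S \<longleftrightarrow> wsum w (fst p) \<le> wsum w (snd p)} \<in> sets P"
        using sets.sets_Collect_neg by (cases "p \<in> S") auto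
    qed simp
    finally show ?thesis .
  qed
  then have "(\<Union>S\<in>\<S>. {w \<in> space P. pat w = S}) \<in> sets P"
    using \<open>finite \<S>\<close> by (intro sets.finite_UN) (simp_all add: \<S>_def)
  also have "(\<Union>S\<in>\<S>. {w \<in> space P. pat w = S}) = {w \<in> space P. Q w}"
  proof -
    have "pat w \<in> \<S> \<longleftrightarrow> Q w" for w
    proof
      assume "pat w \<in> \<S>"
      then obtain w' where "Q w'" "pat w' = pat w" unfolding \<S>_def by blast
      with assms[of w' w] show "Q w" by simp
    next
      assume "Q w"
      moreover have "pat w \<subseteq> Pow E \<times> Pow E" by (auto simp: pat_def)
      ultimately show "pat w \<in> \<S>" unfolding \<S>_def by blast
    qed
    then show ?thesis by blast
  qed
  finally show ?thesis .
qed

lemma pat_cong: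
  assumes "pat w = pat w'" "A \<subseteq> E" "B \<subseteq> E"
  shows "wsum w A \<le> wsum w B \<longleftrightarrow> wsum w' A \<le> wsum w' B"
  using assms(2,3) arg_cong[OF assms(1), of "\<lambda>S. (A, B) \<in> S"] by (simp add: pat_def)

text \<open>Points of \<open>space P\<close> are extensional functions, while a permuted weight
  function or the weights of the theorem need not be. Patterns ignore the values outside
  \<open>E\<close>.\<close>

lemma pat_restrict: "pat (restrict w E) = pat w"
  unfolding pat_def wsum_def by (auto intro!: sum.cong simp: subset_eq)

lemma prob_reindex:
  assumes \<tau>: "bij_betw \<tau> E E" and Q: "\<And>w w'. pat w = pat w' \<Longrightarrow> Q w = Q w'"
  shows "Pr.prob {w \<in> space P. Q w} = Pr.prob {w \<in> space P. Q (w \<circ> \<tau>)}"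
proof -
  have eq: "distr P P (\<lambda>w. \<lambda>e\<in>E. w (\<tau> e)) = P"
    unfolding P_def
    by (rule distr_PiM_reindex[of E "\<lambda>_. exp_measure" \<tau> E])
       (use \<tau> in \<open>auto simp: bij_betw_def intro: prob_space_exponential_density\<close>)
  have meas: "(\<lambda>w. \<lambda>e\<in>E. w (\<tau> e)) \<in> measurable P P"
    using \<tau> unfolding P_def
    by (intro measurable_restrict measurable_component_singleton) (auto simp: bij_betw_def)
  have "Pr.prob {w \<in> space P. Q w} = measure (distr P P (\<lambda>w. \<lambda>e\<in>E. w (\<tau> e))) {w \<in> space P. Q w}"
    by (simp add: eq)
  also have "\<dots> = Pr.prob ((\<lambda>w. \<lambda>e\<in>E. w (\<tau> e)) -` {w \<in> space P. Q w} \<inter> space P)"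
    by (rule measure_distr[OF meas pat_measurable[OF Q]])
  also have "(\<lambda>w. \<lambda>e\<in>E. w (\<tau> e)) -` {w \<in> space P. Q w} \<inter> space P = {w \<in> space P. Q (w \<circ> \<tau>)}"
  proof -
    have "Q (\<lambda>e\<in>E. w (\<tau> e)) = Q (w \<circ> \<tau>)" for w
      using Q[OF pat_restrict[of "w \<circ> \<tau>"]] by (simp add: comp_def)
    moreover have "(\<lambda>e\<in>E. w (\<tau> e)) \<in> space P" for w :: "nat \<times> nat \<Rightarrow> real"
      by (simp add: space_P)
    ultimately show ?thesis by auto
  qed
  finally show ?thesis .
qed

lemma wsum_comp:
  assumes "bij_betw \<tau> E E" "A \<subseteq> E"
  shows "wsum (w \<circ> \<tau>) A = wsum w (\<tau> ` A)"
  unfolding wsum_def using assms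
  by (subst sum.reindex) (auto simp: bij_betw_def intro: inj_on_subset)

lemma gen_comp:
  assumes "bij_betw \<tau> E E" "gen w"
  shows "gen (w \<circ> \<tau>)"
  unfolding gen_def
proof (rule inj_onI)
  fix A B assume A: "A \<in> Pow E" and B: "B \<in> Pow E" and "wsum (w \<circ> \<tau>) A = wsum (w \<circ> \<tau>) B"
  then have "wsum w (\<tau> ` A) = wsum w (\<tau> ` B)" using wsum_comp[OF assms(1)] by auto
  moreover have "\<tau> ` A \<in> Pow E" "\<tau> ` B \<in> Pow E" using A B assms(1) by (auto simp: bij_betw_def)
  ultimately have "\<tau> ` A = \<tau> ` B" using assms(2) by (auto simp: gen_def inj_on_def)
  then show "A = B" using A B assms(1) by (auto simp: bij_betw_def inj_on_image_eq_iff)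
qed

section \<open>Row minima and the minimum arborescence\<close>

text \<open>Comparing weights through \<open>wsum\<close> of singletons makes the choice depend on
  \<open>pat w\<close> only, and the restriction to \<open>V\<close> makes it an element of the
  finite set \<open>maps\<close>.\<close>

definition rowmin :: "(nat \<times> nat \<Rightarrow> real) \<Rightarrow> nat \<Rightarrow> nat" where
  "rowmin w = (\<lambda>v\<in>V. SOME u. u \<in> {1..n} - {v} \<and> (\<forall>u'\<in>{1..n} - {v}. wsum w {(v, u)} \<le> wsum w {(v, u')}))"

definition mina :: "(nat \<times> nat \<Rightarrow> real) \<Rightarrow> (nat \<times> nat) set" where
  "mina w = parcs (min_arborescence n d w)"

abbreviation maps :: "(nat \<Rightarrow> nat) set" where
  "maps \<equiv> (\<Pi>\<^sub>E v\<in>V. {1..n} - {v})"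

lemma edge_in_E: "v \<in> V \<Longrightarrow> u \<in> {1..n} - {v} \<Longrightarrow> (v, u) \<in> E"
  by (auto simp: E_eq V_def)

lemma rowmin_props:
  assumes "v \<in> V"
  shows "rowmin w v \<in> {1..n} - {v}" "u \<in> {1..n} - {v} \<Longrightarrow> w (v, rowmin w v) \<le> w (v, u)"
proof -
  have "(if v = 1 then 2 else 1) \<in> {1..n} - {v}" using n_ge_2 by auto
  then have ne: "{1..n} - {v} \<noteq> {}" by blast
  obtain u0 where "u0 \<in> {1..n} - {v} \<and> (\<forall>u'\<in>{1..n} - {v}. wsum w {(v, u0)} \<le> wsum w {(v, u')})"
    using ex_is_arg_min_if_finite[OF _ ne, of "\<lambda>u. wsum w {(v, u)}"]
    unfolding is_arg_min_linorder by blast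
  from someI[of "\<lambda>u. u \<in> {1..n} - {v} \<and> (\<forall>u'\<in>{1..n} - {v}. wsum w {(v, u)} \<le> wsum w {(v, u')})", OF this]
  show "rowmin w v \<in> {1..n} - {v}" "u \<in> {1..n} - {v} \<Longrightarrow> w (v, rowmin w v) \<le> w (v, u)"
    using assms by (auto simp: rowmin_def wsum_def)
qed

lemma rowmin_in_maps: "rowmin w \<in> maps"
  using rowmin_props(1) by (auto simp: PiE_def extensional_def rowmin_def)

lemma rowmin_unique:
  assumes "gen w" "v \<in> V" "u \<in> {1..n} - {v}" "\<And>u'. u' \<in> {1..n} - {v} \<Longrightarrow> w (v, u) \<le> w (v, u')"
  shows "rowmin w v = u"
proof -
  have "w (v, u) = w (v, rowmin w v)"
    using rowmin_props[OF assms(2)] assms(3,4) by (auto intro!: antisym)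
  then have "wsum w {(v, u)} = wsum w {(v, rowmin w v)}" by (simp add: wsum_def)
  moreover have "{(v, u)} \<in> Pow E" "{(v, rowmin w v)} \<in> Pow E"
    using edge_in_E rowmin_props(1) assms(2,3) by auto
  ultimately show ?thesis using assms(1) by (auto simp: gen_def inj_on_def)
qed

lemma rowmin_cong:
  assumes "pat w = pat w'"
  shows "rowmin w = rowmin w'"
proof -
  have "wsum w {(v, u)} \<le> wsum w {(v, u')} \<longleftrightarrow> wsum w' {(v, u)} \<le> wsum w' {(v, u')}"
    if "v \<in> V" "u \<in> {1..n} - {v}" "u' \<in> {1..n} - {v}" for v u u'
    using that edge_in_E by (intro pat_cong[OF assms]) auto
  then show ?thesis
    unfolding rowmin_def by (intro restrict_ext arg_cong[of _ _ Eps] ext conj_cong ball_cong) auto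
qed

abbreviation spanning :: "(nat \<times> nat) set \<Rightarrow> bool" where
  "spanning \<equiv> spanning_arborescence (complete_oriented n) d"

lemma spanning_subset: "spanning A \<Longrightarrow> A \<subseteq> E"
  by (simp add: spanning_arborescence_def)

text \<open>With one out-arc per vertex, absence of directed cycles already excludes unoriented
  ones, so an arborescence is a parent map with acyclic graph.\<close>

lemma spanning_iff:
  "spanning A \<longleftrightarrow> (\<exists>f. (\<forall>v\<in>V. f v \<in> {1..n} - {v}) \<and> A = fgraph V f \<and> acyclic A)"
proof
  assume A: "spanning A"
  from spanning_arborescenceD[OF A] spanning_arborescence_acyclic[OF A d_in]
  show "\<exists>f. (\<forall>v\<in>V. f v \<in> {1..n} - {v}) \<and> A = fgraph V f \<and> acyclic A"
    unfolding V_def by blast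
next
  assume "\<exists>f. (\<forall>v\<in>V. f v \<in> {1..n} - {v}) \<and> A = fgraph V f \<and> acyclic A"
  then show "spanning A"
    unfolding V_def using spanning_arborescence_fgraph[OF d_in] by blast
qed

lemma mina_props:
  shows "spanning (mina w)" "spanning B \<Longrightarrow> wsum w (mina w) \<le> wsum w B"
proof -
  \<comment> \<open>The star at \<open>d\<close> is an arborescence, so the minimum is over a
    nonempty set.\<close>
  have "acyclic (fgraph V (\<lambda>_. d))"
  proof (rule acyclicI, rule allI, rule notI)
    fix x assume "(x, x) \<in> (fgraph V (\<lambda>_. d))\<^sup>+"
    then show False by (rule converse_tranclE; auto elim: tranclE simp: V_def)
  qed
  then have "spanning (fgraph V (\<lambda>_. d))"
    using d_in unfolding spanning_iff by (intro exI[of _ "\<lambda>_. d"]) (auto simp: V_def)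
  then have ne: "Collect spanning \<noteq> {}" by auto
  have "Collect spanning \<subseteq> Pow E" using spanning_subset by auto
  then have fin: "finite (Collect spanning)" by (rule finite_subset) simp
  have "mina w = (SOME A. is_arg_min (wsum w) spanning A)"
    by (simp add: mina_def min_arborescence_def arg_min_def wsum_def[abs_def])
  moreover have "\<exists>A. is_arg_min (wsum w) spanning A"
    using ex_is_arg_min_if_finite[OF fin ne] by simp
  ultimately have "is_arg_min (wsum w) spanning (mina w)" by (metis someI_ex)
  then show "spanning (mina w)" "spanning B \<Longrightarrow> wsum w (mina w) \<le> wsum w B"
    by (auto simp: is_arg_min_linorder)
qed

lemma mina_unique:
  assumes "gen w" "spanning A" "\<And>B. spanning B \<Longrightarrow> wsum w A \<le> wsum w B"
  shows "mina w = A"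
proof -
  have "wsum w A = wsum w (mina w)"
    using assms(2,3) mina_props by (auto intro!: antisym)
  then show ?thesis
    using assms(1,2) mina_props(1) spanning_subset by (auto simp: gen_def inj_on_def)
qed

lemma mina_cong:
  assumes "pat w = pat w'"
  shows "mina w = mina w'"
proof -
  have "is_arg_min (wsum w) spanning A = is_arg_min (wsum w') spanning A" for A
    unfolding is_arg_min_linorder
    using pat_cong[OF assms] spanning_subset by blast
  then have "is_arg_min (wsum w) spanning = is_arg_min (wsum w') spanning" by blast
  then show ?thesis
    by (simp add: mina_def min_arborescence_def arg_min_def wsum_def[abs_def])
qed

end

section \<open>Symmetries\<close>

context rooted_complete
begin

lemma bij_betw_E_involution:
  assumes "\<And>e. e \<in> E \<Longrightarrow> \<tau> e \<in> E \<and> \<tau> (\<tau> e) = e"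
  shows "bij_betw \<tau> E E"
  by (rule bij_betw_byWitness[where f' = \<tau>]) (use assms in blast)+

lemma pat_comp_cong:
  assumes "bij_betw \<tau> E E" "pat w = pat w'"
  shows "pat (w \<circ> \<tau>) = pat (w' \<circ> \<tau>)"
proof -
  have "wsum w (\<tau> ` A) \<le> wsum w (\<tau> ` B) \<longleftrightarrow> wsum w' (\<tau> ` A) \<le> wsum w' (\<tau> ` B)"
    if "A \<subseteq> E" "B \<subseteq> E" for A B
    using that assms(1) by (intro pat_cong[OF assms(2)]) (auto simp: bij_betw_def)
  then have "(A, B) \<in> pat (w \<circ> \<tau>) \<longleftrightarrow> (A, B) \<in> pat (w' \<circ> \<tau>)" for A B
    using wsum_comp[OF assms(1)] by (cases "A \<subseteq> E \<and> B \<subseteq> E") (auto simp: pat_def)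
  then show ?thesis by (intro set_eqI) (metis surj_pair)
qed

text \<open>Symmetry identities hold only when no choice has to be made among ties; here the null
  set of ties is discarded.\<close>

lemma prob_eq_by_symmetry:
  assumes \<tau>: "bij_betw \<tau> E E"
    and Q: "\<And>w w'. pat w = pat w' \<Longrightarrow> Q w = Q w'"
    and Q': "\<And>w w'. pat w = pat w' \<Longrightarrow> Q' w = Q' w'"
    and eq: "\<And>w. gen w \<Longrightarrow> Q (w \<circ> \<tau>) = Q' w"
  shows "Pr.prob {w \<in> space P. Q w} = Pr.prob {w \<in> space P. Q' w}"
proof -
  have "Pr.prob {w \<in> space P. Q w} = Pr.prob {w \<in> space P. Q (w \<circ> \<tau>)}"
    by (rule prob_reindex[OF \<tau> Q])
  also have "\<dots> = Pr.prob {w \<in> space P. Q' w}"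
  proof (rule Pr.finite_measure_eq_AE)
    show "AE w in P. w \<in> {w \<in> space P. Q (w \<circ> \<tau>)} \<longleftrightarrow> w \<in> {w \<in> space P. Q' w}"
      using AE_gen by (rule AE_mp) (auto intro!: AE_I2 simp: eq)
    show "{w \<in> space P. Q (w \<circ> \<tau>)} \<in> sets P"
      by (rule pat_measurable) (rule Q, rule pat_comp_cong[OF \<tau>])
    show "{w \<in> space P. Q' w} \<in> sets P"
      by (rule pat_measurable) (rule Q')
  qed
  finally show ?thesis .
qed

text \<open>Swapping the edges to \<open>g v\<close> and \<open>g' v\<close> in each row
  \<open>v\<close> permutes the i.i.d. weights and carries the row-minimum map \<open>g\<close> to
  \<open>g'\<close>. Hence the row-minimum map is uniform on \<open>maps\<close>.\<close>

lemma prob_rowmin_eq: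
  assumes g: "g \<in> maps" and g': "g' \<in> maps"
  shows "Pr.prob {w \<in> space P. rowmin w = g} = Pr.prob {w \<in> space P. rowmin w = g'}"
proof -
  define \<sigma> where "\<sigma> v = Transposition.transpose (g v) (g' v)" for v
  \<comment> \<open>Edges out of \<open>d\<close> stay fixed, as row minima concern only the
    vertices of \<open>V\<close>.\<close>
  define \<tau> where "\<tau> e = (fst e, if fst e \<in> V then \<sigma> (fst e) (snd e) else snd e)" for e
  have gv: "g v \<in> {1..n} - {v}" "g' v \<in> {1..n} - {v}" if "v \<in> V" for v
    using g g' that by (auto simp: PiE_def Pi_def)
  have \<sigma>: "\<sigma> v u \<in> {1..n} - {v}" if "v \<in> V" "u \<in> {1..n} - {v}" for v u
    using gv[OF that(1)] that(2) by (auto simp: \<sigma>_def Transposition.transpose_def)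
  have inv: "\<sigma> v (\<sigma> v u) = u" for v u by (simp add: \<sigma>_def)
  have \<tau>: "bij_betw \<tau> E E"
  proof (rule bij_betw_E_involution)
    fix e assume "e \<in> E"
    then show "\<tau> e \<in> E \<and> \<tau> (\<tau> e) = e"
      using \<sigma>[of "fst e" "snd e"] by (auto simp: \<tau>_def inv E_eq)
  qed
  have rm: "rowmin (w \<circ> \<tau>) v = \<sigma> v (rowmin w v)" if "gen w" "v \<in> V" for w v
  proof (rule rowmin_unique[OF gen_comp[OF \<tau> that(1)] that(2)])
    show "\<sigma> v (rowmin w v) \<in> {1..n} - {v}" using \<sigma> that(2) rowmin_props(1) by blast
    fix u' assume "u' \<in> {1..n} - {v}"
    then show "(w \<circ> \<tau>) (v, \<sigma> v (rowmin w v)) \<le> (w \<circ> \<tau>) (v, u')"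
      using rowmin_props(2)[OF that(2) \<sigma>[OF that(2)]] that(2) by (simp add: \<tau>_def inv)
  qed
  show ?thesis
  proof (rule prob_eq_by_symmetry[OF \<tau>])
    fix w assume w: "gen w"
    have ext: "h = h' \<longleftrightarrow> (\<forall>v\<in>V. h v = h' v)" if "h \<in> maps" "h' \<in> maps" for h h'
      using that by (auto intro: PiE_ext)
    show "(rowmin (w \<circ> \<tau>) = g) = (rowmin w = g')"
      unfolding ext[OF rowmin_in_maps g] ext[OF rowmin_in_maps g']
    proof (intro ball_cong refl)
      fix v assume v: "v \<in> V"
      have "\<sigma> v (rowmin w v) = g v \<longleftrightarrow> rowmin w v = \<sigma> v (g v)" using inv by metis
      then show "rowmin (w \<circ> \<tau>) v = g v \<longleftrightarrow> rowmin w v = g' v"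
        by (simp add: rm[OF w v]) (simp add: \<sigma>_def)
    qed
  qed (auto dest: rowmin_cong)
qed

lemma finite_maps: "finite maps"
  by (rule finite_PiE[OF finite_V]) simp

lemma card_maps: "card maps = (n - 1) ^ (n - 1)"
proof -
  have "card maps = (\<Prod>v\<in>V. card ({1..n} - {v}))" by (rule card_PiE[OF finite_V])
  also have "\<dots> = (\<Prod>v\<in>V. n - 1)"
    by (intro prod.cong refl) (auto simp: V_def)
  finally show ?thesis by (simp add: card_V)
qed

lemma prob_rowmin:
  assumes "S \<subseteq> maps"
  shows "Pr.prob {w \<in> space P. rowmin w \<in> S} = card S / real (n - 1) ^ (n - 1)"
proof -
  define p where "p g = Pr.prob {w \<in> space P. rowmin w = g}" for g
  have sum: "Pr.prob {w \<in> space P. rowmin w \<in> S} = (\<Sum>g\<in>S. p g)" if "S \<subseteq> maps" for S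
  proof -
    have "Pr.prob (\<Union>g\<in>S. {w \<in> space P. rowmin w = g}) = (\<Sum>g\<in>S. p g)"
      unfolding p_def
    proof (rule Pr.finite_measure_finite_Union)
      show "finite S" using that finite_maps by (rule finite_subset)
      show "(\<lambda>g. {w \<in> space P. rowmin w = g}) ` S \<subseteq> sets P"
        by (auto intro!: pat_measurable dest: rowmin_cong)
    qed (auto simp: disjoint_family_on_def)
    also have "(\<Union>g\<in>S. {w \<in> space P. rowmin w = g}) = {w \<in> space P. rowmin w \<in> S}" by auto
    finally show ?thesis .
  qed
  obtain g0 where g0: "g0 \<in> maps" using rowmin_in_maps by blast
  have const: "p g = p g0" if "g \<in> maps" for g
    unfolding p_def by (rule prob_rowmin_eq[OF that g0])
  have "1 = (\<Sum>g\<in>maps. p g)"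
    using sum[of maps] rowmin_in_maps by (simp add: Pr.prob_space)
  also have "\<dots> = real ((n - 1) ^ (n - 1)) * p g0"
    unfolding card_maps[symmetric] by (simp add: const)
  finally have p0: "p g0 = 1 / real (n - 1) ^ (n - 1)"
    using n_ge_2 by (simp add: field_simps)
  have "(\<Sum>g\<in>S. p g) = (\<Sum>g\<in>S. p g0)" using assms const by (intro sum.cong) auto
  then show ?thesis using sum[OF assms] by (simp add: p0)
qed

definition rmin :: "(nat \<times> nat \<Rightarrow> real) \<Rightarrow> (nat \<times> nat) set" where
  "rmin w = fgraph V (rowmin w)"

text \<open>Permute the weights by the transposition of 1 and \<open>v\<close>. It fixes
  \<open>d\<close>, because both vertices lie in \<open>V\<close>, and therefore relabels both
  graphs at once. Applied to \<open>bad\<close>, this turns the probability at 1 into an average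
  over \<open>V\<close>.\<close>

lemma exchangeable:
  assumes v: "v \<in> V"
    and Q: "\<And>\<pi> v R A. inj \<pi> \<Longrightarrow> Q (\<pi> v) (map_prod \<pi> \<pi> ` R) (map_prod \<pi> \<pi> ` A) = Q v R A"
  shows "Pr.prob {w \<in> space P. Q v (rmin w) (mina w)} = Pr.prob {w \<in> space P. Q 1 (rmin w) (mina w)}"
proof -
  define \<pi> :: "nat \<Rightarrow> nat" where "\<pi> = Transposition.transpose 1 v"
  define \<tau> where "\<tau> = map_prod \<pi> \<pi>"
  have inv: "\<pi> (\<pi> x) = x" for x by (simp add: \<pi>_def)
  have inj: "inj \<pi>" by (metis inv injI)
  have \<pi>1: "\<pi> 1 = v" by (simp add: \<pi>_def)
  have \<pi>V: "\<pi> x \<in> V" if "x \<in> V" for x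
    using that v one_in_V by (auto simp: \<pi>_def Transposition.transpose_def)
  have \<pi>n: "\<pi> x \<in> {1..n}" if "x \<in> {1..n}" for x
    using that v one_in_V by (auto simp: \<pi>_def Transposition.transpose_def V_def)
  have \<pi>ne: "\<pi> y \<in> {1..n} - {\<pi> x}" if "y \<in> {1..n} - {x}" for x y
    using that \<pi>n inj by (auto dest: injD)
  have \<tau>\<tau>: "\<tau> (\<tau> e) = e" for e by (cases e) (simp add: \<tau>_def inv)
  have \<tau>: "bij_betw \<tau> E E"
  proof (rule bij_betw_E_involution)
    fix e assume "e \<in> E"
    then show "\<tau> e \<in> E \<and> \<tau> (\<tau> e) = e"
      using \<pi>ne[of "snd e" "fst e"] \<pi>n[of "fst e"] by (cases e) (auto simp: \<tau>_def inv E_eq)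
  qed
  have \<tau>f: "\<tau> ` fgraph V f = fgraph V (\<lambda>x. \<pi> (f (\<pi> x)))" for f
  proof -
    have "V = \<pi> ` V" using \<pi>V inv by (metis (no_types, lifting) image_eqI image_subsetI subsetI subset_antisym)
    then have "fgraph V (\<lambda>x. \<pi> (f (\<pi> x))) = (\<lambda>x. (x, \<pi> (f (\<pi> x)))) ` \<pi> ` V"
      by (simp add: fgraph_def)
    also have "\<dots> = \<tau> ` fgraph V f"
      by (simp add: fgraph_def image_image inv \<tau>_def)
    finally show ?thesis ..
  qed
  have rm: "rowmin (w \<circ> \<tau>) x = \<pi> (rowmin w (\<pi> x))" if "gen w" "x \<in> V" for w x
  proof (rule rowmin_unique[OF gen_comp[OF \<tau> that(1)] that(2)])
    show "\<pi> (rowmin w (\<pi> x)) \<in> {1..n} - {x}"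
      using \<pi>ne[OF rowmin_props(1)[OF \<pi>V[OF that(2)]]] inv by simp
    fix u assume "u \<in> {1..n} - {x}"
    then show "(w \<circ> \<tau>) (x, \<pi> (rowmin w (\<pi> x))) \<le> (w \<circ> \<tau>) (x, u)"
      using rowmin_props(2)[OF \<pi>V[OF that(2)] \<pi>ne] by (simp add: \<tau>_def inv)
  qed
  have R: "rmin w = \<tau> ` rmin (w \<circ> \<tau>)" if "gen w" for w
    unfolding rmin_def \<tau>f using rm[OF that] \<pi>V by (auto simp: fgraph_def inv intro!: image_cong)
  have span: "spanning (\<tau> ` A)" if A: "spanning A" for A
  proof -
    obtain f where f: "\<forall>x\<in>V. f x \<in> {1..n} - {x}" "A = fgraph V f" "acyclic A"
      using A unfolding spanning_iff by blast
    have "\<pi> (f (\<pi> x)) \<in> {1..n} - {x}" if "x \<in> V" for x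
      using \<pi>ne[OF bspec[OF f(1) \<pi>V[OF that]]] inv by simp
    moreover have "acyclic (\<tau> ` A)"
      unfolding \<tau>_def by (rule acyclic_map_prod[OF inj f(3)])
    ultimately show ?thesis
      unfolding spanning_iff f(2) \<tau>f by (intro exI[of _ "\<lambda>x. \<pi> (f (\<pi> x))"]) simp
  qed
  have A: "mina w = \<tau> ` mina (w \<circ> \<tau>)" if "gen w" for w
  proof (rule mina_unique[OF that])
    show "spanning (\<tau> ` mina (w \<circ> \<tau>))" by (intro span mina_props)
    fix B assume B: "spanning B"
    have "wsum w (\<tau> ` mina (w \<circ> \<tau>)) = wsum (w \<circ> \<tau>) (mina (w \<circ> \<tau>))"
      using wsum_comp[OF \<tau>] spanning_subset mina_props(1) by simp
    also have "\<dots> \<le> wsum (w \<circ> \<tau>) (\<tau> ` B)" by (intro mina_props span B)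
    also have "\<dots> = wsum w (\<tau> ` \<tau> ` B)"
      using wsum_comp[OF \<tau> spanning_subset[OF span[OF B]]] .
    also have "\<dots> = wsum w B" by (simp add: image_image \<tau>\<tau>)
    finally show "wsum w (\<tau> ` mina (w \<circ> \<tau>)) \<le> wsum w B" .
  qed
  have cong: "Q x (rmin w) (mina w) = Q x (rmin w') (mina w')" if "pat w = pat w'" for w w' x
    using rowmin_cong[OF that] mina_cong[OF that] by (simp add: rmin_def)
  show ?thesis
  proof (rule prob_eq_by_symmetry[OF \<tau> cong cong, symmetric])
    fix w assume "gen w"
    then show "Q 1 (rmin (w \<circ> \<tau>)) (mina (w \<circ> \<tau>)) = Q v (rmin w) (mina w)"
      using Q[OF inj, of 1 "rmin (w \<circ> \<tau>)" "mina (w \<circ> \<tau>)"]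
      unfolding \<pi>1 \<tau>_def[symmetric] by (simp flip: R A)
  qed auto
qed

end

section \<open>Vertices whose ball is affected by a change of few arcs\<close>

text \<open>The size condition concerns radius 2k because two roots within distance k of the same
  changed vertex are within 2k of each other; it thereby bounds the number of roots spoilt by that
  vertex.\<close>

definition bad :: "nat \<Rightarrow> nat \<Rightarrow> 'a \<Rightarrow> 'a rel \<Rightarrow> 'a rel \<Rightarrow> bool" where
  "bad m k v R A \<longleftrightarrow> card (nbhd R v (2 * k)) \<le> m \<and> nbhd R v k \<inter> Field ((R - A) \<union> (A - R)) \<noteq> {}"

lemma bad_map_prod:
  assumes "inj \<pi>"
  shows "bad m k (\<pi> v) (map_prod \<pi> \<pi> ` R) (map_prod \<pi> \<pi> ` A) = bad m k v R A"
proof -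
  have inj2: "inj (map_prod \<pi> \<pi>)" using assms by (simp add: prod.inj_map)
  have "(map_prod \<pi> \<pi> ` R - map_prod \<pi> \<pi> ` A) \<union> (map_prod \<pi> \<pi> ` A - map_prod \<pi> \<pi> ` R)
      = map_prod \<pi> \<pi> ` ((R - A) \<union> (A - R))"
    using inj2 by (simp add: image_Un image_set_diff)
  moreover have "Field (map_prod \<pi> \<pi> ` S) = \<pi> ` Field S" for S
    by (force simp: Field_def Domain_iff Range_iff image_iff)
  moreover have "\<pi> ` S \<inter> \<pi> ` T = {} \<longleftrightarrow> S \<inter> T = {}" for S T
    using assms by (auto dest: injD)
  ultimately show ?thesis
    using assms by (simp add: bad_def nbhd_map_prod card_image inj_on_subset[OF assms])
qed

text \<open>A row where the maps differ has three ends of changed arcs: \<open>v\<close>,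
  \<open>f v\<close> and \<open>a v\<close>. All bad vertices within distance k of one such end lie
  in the 2k-ball around any one of them, so there are at most m.\<close>

lemma card_bad_le:
  assumes fin: "finite S"
  shows "card {v \<in> S. bad m k v (fgraph S f) (fgraph S a)} \<le> 3 * m * card {v \<in> S. f v \<noteq> a v}"
proof -
  let ?R = "fgraph S f" and ?A = "fgraph S a"
  define D where "D = {v \<in> S. f v \<noteq> a v}"
  define X where "X = D \<union> f ` D \<union> a ` D"
  have finD: "finite D" using fin by (simp add: D_def)
  have "Field ((?R - ?A) \<union> (?A - ?R)) \<subseteq> X"
  proof -
    have "x \<in> D \<and> (y = f x \<or> y = a x)" if "(x, y) \<in> (?R - ?A) \<union> (?A - ?R)" for x y
      using that by (auto simp: D_def)
    then show ?thesis by (fastforce simp: Field_def X_def)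
  qed
  define B where "B x = {v \<in> S. bad m k v ?R ?A \<and> x \<in> nbhd ?R v k}" for x
  have B: "card (B x) \<le> m" for x
  proof (cases "B x = {}")
    case False
    then obtain v0 where v0: "card (nbhd ?R v0 (2 * k)) \<le> m" "x \<in> nbhd ?R v0 k"
      by (auto simp: B_def bad_def)
    have "B x \<subseteq> nbhd ?R v0 (k + k)"
      using nbhd_trans[OF v0(2) nbhd_sym] by (auto simp: B_def)
    then have "card (B x) \<le> card (nbhd ?R v0 (k + k))"
      using fin by (intro card_mono finite_nbhd) auto
    with v0(1) show ?thesis by (simp add: mult_2)
  qed simp
  have "{v \<in> S. bad m k v ?R ?A} \<subseteq> (\<Union>x\<in>X. B x)"
    using \<open>Field ((?R - ?A) \<union> (?A - ?R)) \<subseteq> X\<close> by (fastforce simp: B_def bad_def)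
  then have "card {v \<in> S. bad m k v ?R ?A} \<le> card (\<Union>x\<in>X. B x)"
    using finD fin by (intro card_mono) (auto simp: X_def B_def)
  also have "\<dots> \<le> (\<Sum>x\<in>X. card (B x))"
    using finD by (intro card_UN_le) (auto simp: X_def)
  also have "\<dots> \<le> (\<Sum>x\<in>X. m)" by (intro sum_mono B)
  also have "\<dots> = card X * m" by simp
  also have "card X \<le> card D + card D + card D"
    unfolding X_def
    by (intro order_trans[OF card_Un_le] add_mono card_image_le finD order_refl)
  finally show ?thesis by (simp add: D_def algebra_simps)
qed

section \<open>Breaking the cycles of a parent map\<close>

text \<open>The largest vertex of each directed cycle, with \<open>xs\<close> listing the others in
  the order of traversal. Demanding the maximum counts every cycle once and leaves at most z - 1
  choices for each entry of \<open>xs\<close>.\<close>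

definition cycle_max :: "nat set \<Rightarrow> (nat \<Rightarrow> nat) \<Rightarrow> nat set" where
  "cycle_max S f =
    {z \<in> S. \<exists>xs. set xs \<subseteq> S \<inter> {..<z} \<and> distinct xs \<and> map f (z # xs) = xs @ [z]}"

lemma relpow_fgraph:
  "(x, y) \<in> fgraph S f ^^ k \<Longrightarrow> y = (f ^^ k) x \<and> (\<forall>i<k. (f ^^ i) x \<in> S)"
  by (induction k arbitrary: y) (auto simp: less_Suc_eq)

text \<open>A directed cycle yields a periodic orbit; the iterates of its maximum over one least
  period form the required list.\<close>

lemma cycle_max_nonempty:
  assumes "finite S" "\<not> acyclic (fgraph S f)"
  shows "cycle_max S f \<noteq> {}"
proof -
  obtain x where "(x, x) \<in> (fgraph S f)\<^sup>+" using assms(2) by (auto simp: acyclic_def)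
  then obtain k where k: "0 < k" "(x, x) \<in> fgraph S f ^^ k" by (auto simp: trancl_power)
  then have per: "(f ^^ k) x = x" and inS: "\<And>i. i < k \<Longrightarrow> (f ^^ i) x \<in> S"
    using relpow_fgraph[OF k(2)] by auto
  have all: "(f ^^ i) x \<in> S" for i
    using inS[of "i mod k"] k(1) funpow_mod_eq[OF per, of i] by simp
  define Orb where "Orb = range (\<lambda>i. (f ^^ i) x)"
  have Orb: "finite Orb" "Orb \<noteq> {}" "Orb \<subseteq> S"
    using all by (auto simp: Orb_def intro: finite_subset[OF _ assms(1)])
  define z where "z = Max Orb"
  have "z \<in> Orb" unfolding z_def using Orb by simp
  then obtain i0 where i0: "z = (f ^^ i0) x" by (auto simp: Orb_def)
  have itOrb: "(f ^^ i) z \<in> Orb" for i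
    by (auto simp: Orb_def i0 funpow_add[symmetric, unfolded comp_def, THEN fun_cong])
  have "(f ^^ k) z = (f ^^ (k + i0)) x" by (simp add: funpow_add i0)
  also have "\<dots> = (f ^^ (i0 + k)) x" by (simp add: add.commute)
  also have "\<dots> = z" by (simp add: funpow_add per i0)
  finally have perz: "(f ^^ k) z = z" .
  define p where "p = (LEAST p. 0 < p \<and> (f ^^ p) z = z)"
  have p: "0 < p" "(f ^^ p) z = z"
    using LeastI[of "\<lambda>p. 0 < p \<and> (f ^^ p) z = z" k] k(1) perz by (auto simp: p_def)
  have least: "(f ^^ i) z \<noteq> z" if "0 < i" "i < p" for i
    using not_less_Least[of i "\<lambda>p. 0 < p \<and> (f ^^ p) z = z"] that by (auto simp: p_def)
  define xs where "xs = map (\<lambda>i. (f ^^ i) z) [1..<p]"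
  have "set xs \<subseteq> S \<inter> {..<z}"
  proof
    fix y assume "y \<in> set xs"
    then obtain i where i: "1 \<le> i" "i < p" "y = (f ^^ i) z" by (auto simp: xs_def)
    have "y \<in> Orb" using itOrb i(3) by simp
    moreover from this have "y \<le> z" unfolding z_def using Orb by simp
    moreover have "y \<noteq> z" using least[of i] i by simp
    ultimately show "y \<in> S \<inter> {..<z}" using Orb(3) by auto
  qed
  moreover have "distinct xs"
  proof -
    \<comment> \<open>A coincidence of two iterates, advanced by p - j steps, would bring z back
      after p - j + i < p steps.\<close>
    have ne: "(f ^^ i) z \<noteq> (f ^^ j) z" if "1 \<le> i" "i < j" "j < p" for i j
    proof
      assume eq: "(f ^^ i) z = (f ^^ j) z"
      have "(f ^^ (p - j + i)) z = (f ^^ (p - j)) ((f ^^ j) z)" by (simp add: funpow_add eq)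
      also have "\<dots> = (f ^^ (p - j + j)) z" by (simp only: funpow_add comp_apply)
      also have "\<dots> = z" using that p by simp
      finally have "(f ^^ (p - j + i)) z = z" .
      moreover have "(f ^^ (p - j + i)) z \<noteq> z"
        by (rule least) (use that in linarith)+
      ultimately show False by contradiction
    qed
    have "inj_on (\<lambda>i. (f ^^ i) z) {1..<p}"
    proof (rule inj_onI)
      fix i j assume "i \<in> {1..<p}" "j \<in> {1..<p}" "(f ^^ i) z = (f ^^ j) z"
      then show "i = j" using ne[of i j] ne[of j i] by (cases i j rule: linorder_cases) auto
    qed
    then show ?thesis by (simp add: xs_def distinct_map)
  qed
  moreover have "map f (z # xs) = xs @ [z]"
  proof -
    have "z # xs = map (\<lambda>i. (f ^^ i) z) [0..<p]"
      using p(1) by (simp add: xs_def upt_conv_Cons)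
    then have "map f (z # xs) = map (\<lambda>i. (f ^^ Suc i) z) [0..<p]" by simp
    also have "\<dots> = map (\<lambda>i. (f ^^ i) z) (map Suc [0..<p])" by simp
    also have "map Suc [0..<p] = [1..<p] @ [p]"
      using p(1) by (simp add: map_Suc_upt)
    finally show ?thesis by (simp add: xs_def p(2))
  qed
  moreover have "z \<in> S" using \<open>z \<in> Orb\<close> Orb(3) by blast
  ultimately show ?thesis unfolding cycle_max_def by blast
qed

lemma acyclic_redirect:
  assumes fin: "finite S" and d: "d \<notin> S"
    and Z: "Z = cycle_max S f"
    and g: "\<And>v. v \<in> S \<Longrightarrow> g v = (if v \<in> u ` Z then d else if v \<in> Z then u v else f v)"
  shows "acyclic (fgraph S g)"
proof (rule ccontr)
  assume "\<not> acyclic (fgraph S g)"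
  from cycle_max_nonempty[OF fin this] obtain z xs
    where z: "z \<in> S" and xs: "set xs \<subseteq> S \<inter> {..<z}" "distinct xs" "map g (z # xs) = xs @ [z]"
    unfolding cycle_max_def by blast
  define C where "C = set (z # xs)"
  have gC: "g ` C = C" using arg_cong[OF xs(3), of set] by (simp add: C_def)
  have CS: "C \<subseteq> S" using z xs(1) by (auto simp: C_def)
  have noU: "y \<notin> u ` Z" if "y \<in> C" for y
    using g[of y] that gC CS d by (metis imageI subsetD)
  have noZ: "y \<notin> Z" if "y \<in> C" for y
  proof
    assume "y \<in> Z"
    then have "g y = u y" using g[of y] noU[OF that] that CS by auto
    moreover have "g y \<in> C" using gC that by blast
    ultimately show False using \<open>y \<in> Z\<close> noU[of "g y"] by auto
  qed
  have "map f (z # xs) = map g (z # xs)"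
    using noU noZ g CS by (intro map_cong refl) (auto simp: C_def)
  then have "map f (z # xs) = xs @ [z]" using xs(3) by (rule trans)
  then have "z \<in> cycle_max S f"
    unfolding cycle_max_def mem_Collect_eq by (intro conjI exI[of _ xs] z xs)
  then show False using noZ[of z] Z by (simp add: C_def)
qed

section \<open>Cost of breaking the cycles of the row minima\<close>

context rooted_complete
begin

definition nonneg :: "(nat \<times> nat \<Rightarrow> real) \<Rightarrow> bool" where
  "nonneg w \<longleftrightarrow> (\<forall>e\<in>E. 0 \<le> w e)"

text \<open>The direct edge from \<open>z\<close> to \<open>d\<close> has weight of order 1, too
  much to pay; a detour leaves n - 2 candidates for the middle vertex, among which a cheap one is
  likely.\<close>

definition well_connected :: "real \<Rightarrow> (nat \<times> nat \<Rightarrow> real) \<Rightarrow> bool" where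
  "well_connected s w \<longleftrightarrow> (\<forall>z\<in>V. \<exists>u\<in>{1..n} - {z, d}. w (z, u) \<le> s \<and> w (u, d) \<le> s)"

abbreviation Z :: "(nat \<times> nat \<Rightarrow> real) \<Rightarrow> nat set" where
  "Z w \<equiv> cycle_max V (rowmin w)"

lemma Z_subset: "Z w \<subseteq> V" and finite_Z [simp]: "finite (Z w)"
proof -
  show "Z w \<subseteq> V" by (auto simp: cycle_max_def)
  then show "finite (Z w)" by (rule finite_subset) simp
qed

text \<open>The redirected map is a competitor in the minimization. At most twice as many vertices
  as there are cycles change their edge; the new edges cost at most s, and the discarded ones have
  nonnegative weight.\<close>

lemma mina_cost_le:
  assumes "nonneg w" "well_connected s w" "0 \<le> s"
  shows "wsum w (mina w) \<le> wsum w (rmin w) + 2 * s * card (Z w)"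
proof -
  obtain u where u: "\<And>z. z \<in> V \<Longrightarrow> u z \<in> {1..n} - {z, d} \<and> w (z, u z) \<le> s \<and> w (u z, d) \<le> s"
    using assms(2) unfolding well_connected_def by metis
  define g where "g v = (if v \<in> u ` Z w then d else if v \<in> Z w then u v else rowmin w v)" for v
  have dV: "d \<notin> V" by (simp add: V_def)
  have "acyclic (fgraph V g)"
    by (rule acyclic_redirect[OF finite_V dV refl]) (simp add: g_def)
  moreover have "g v \<in> {1..n} - {v}" if "v \<in> V" for v
  proof -
    have "d \<in> {1..n} - {v}" "u v \<in> {1..n} - {v}"
      using d_in that u[OF that] by (auto simp: V_def)
    then show ?thesis using rowmin_props(1)[OF that, of w] by (simp only: g_def split: if_split) blast
  qed
  ultimately have "spanning (fgraph V g)" unfolding spanning_iff by blast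
  then have "wsum w (mina w) \<le> wsum w (fgraph V g)" by (rule mina_props)
  also have "\<dots> = (\<Sum>v\<in>V. w (v, g v))" by (simp add: wsum_def sum_fgraph)
  also have "\<dots> \<le> (\<Sum>v\<in>V. w (v, rowmin w v) + (if v \<in> u ` Z w \<union> Z w then s else 0))"
  proof (rule sum_mono)
    fix v assume v: "v \<in> V"
    have "0 \<le> w (v, rowmin w v)"
      using assms(1) edge_in_E[OF v rowmin_props(1)[OF v]] by (auto simp: nonneg_def)
    moreover have "w (v, d) \<le> s" if "v \<in> u ` Z w"
      using that u Z_subset by blast
    moreover have "w (v, u v) \<le> s" using u[OF v] by simp
    ultimately show "w (v, g v) \<le> w (v, rowmin w v) + (if v \<in> u ` Z w \<union> Z w then s else 0)"
      using assms(3) by (auto simp: g_def)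
  qed
  also have "\<dots> = wsum w (rmin w) + (\<Sum>v\<in>V \<inter> (u ` Z w \<union> Z w). s)"
    unfolding sum.distrib wsum_def rmin_def sum_fgraph sum.inter_restrict[OF finite_V] ..
  also have "(\<Sum>v\<in>V \<inter> (u ` Z w \<union> Z w). s) \<le> 2 * s * card (Z w)"
  proof -
    have "card (V \<inter> (u ` Z w \<union> Z w)) \<le> card (u ` Z w \<union> Z w)"
      by (intro card_mono) auto
    also have "\<dots> \<le> card (Z w) + card (Z w)"
      by (intro order_trans[OF card_Un_le] add_mono card_image_le order_refl) simp
    finally have "real (card (V \<inter> (u ` Z w \<union> Z w))) \<le> 2 * real (card (Z w))" by simp
    from mult_right_mono[OF this assms(3)] show ?thesis by (simp add: mult_ac)
  qed
  finally show ?thesis by simp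
qed

section \<open>Near-ties within a row and the number of differing rows\<close>

definition out_edges :: "(nat \<times> nat) set" where
  "out_edges = (SIGMA v:V. {1..n} - {v})"

text \<open>Leaving out \<open>snd e\<close> makes this independent of \<open>w e\<close>, as
  \<open>prob_coordinate_window\<close> demands. If n = 2 the minimum is over the empty set and is
  an unspecified constant.\<close>

definition rest_min :: "nat \<times> nat \<Rightarrow> (nat \<times> nat \<Rightarrow> real) \<Rightarrow> real" where
  "rest_min e w = Min ((\<lambda>u. w (fst e, u)) ` ({1..n} - {fst e, snd e}))"

definition near :: "real \<Rightarrow> nat \<times> nat \<Rightarrow> (nat \<times> nat \<Rightarrow> real) \<Rightarrow> bool" where
  "near t e w \<longleftrightarrow> rest_min e w \<le> w e \<and> w e < rest_min e w + t"

lemma finite_out_edges [simp]: "finite out_edges"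
  by (simp add: out_edges_def)

lemma card_out_edges: "card out_edges \<le> n * n"
proof -
  have "out_edges \<subseteq> {1..n} \<times> {1..n}" by (auto simp: out_edges_def V_def)
  then have "card out_edges \<le> card ({1..n} \<times> {1..n})" by (intro card_mono) auto
  then show ?thesis by simp
qed

lemma rest_min_measurable:
  assumes "e \<in> out_edges"
  shows "rest_min e \<in> borel_measurable P"
  unfolding rest_min_def[abs_def] using assms
  by (intro borel_measurable_Min measurable_component_P) (auto simp: out_edges_def E_eq V_def)

lemma out_edges_subset: "out_edges \<subseteq> E"
  by (auto simp: out_edges_def E_eq V_def)

lemma near_sets:
  assumes "e \<in> out_edges"
  shows "{w \<in> space P. near t e w} \<in> sets P"
  unfolding near_def using assms rest_min_measurable out_edges_subset
  by (intro sets.sets_Collect_conj borel_measurable_le borel_measurable_less borel_measurable_add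
      borel_measurable_const) auto

lemma prob_near_le:
  assumes "e \<in> out_edges" "0 \<le> t"
  shows "Pr.prob {w \<in> space P. near t e w} \<le> t"
  unfolding near_def
proof (rule prob_coordinate_window)
  show "rest_min e (w(e := y)) = rest_min e w" for w y
    unfolding rest_min_def by (cases e) (auto intro!: arg_cong[of _ _ Min] image_cong)
qed (use assms rest_min_measurable out_edges_subset in auto)

text \<open>The excess cost of M is the sum over the rows of the nonnegative gaps between chosen and
  cheapest edge. As in Markov's inequality, dividing it by t bounds the number of rows with gap at
  least t; the other differing rows inject into the near-ties by
  \<open>v \<mapsto> (v, a v)\<close>.\<close>

lemma card_diff_le:
  assumes nn: "nonneg w" and wc: "well_connected s w" and s: "0 \<le> s" and t: "0 < t"
    and a: "\<And>v. v \<in> V \<Longrightarrow> a v \<in> {1..n} - {v}" "mina w = fgraph V a"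
  shows "card {v \<in> V. rowmin w v \<noteq> a v} \<le> card {e \<in> out_edges. near t e w} + 2 * s / t * card (Z w)"
proof -
  define gap where "gap v = w (v, a v) - w (v, rowmin w v)" for v
  define D where "D = {v \<in> V. rowmin w v \<noteq> a v}"
  define D1 where "D1 = {v \<in> D. gap v < t}"
  define D2 where "D2 = {v \<in> D. t \<le> gap v}"
  have fin: "finite D1" "finite D2" by (simp_all add: D1_def D2_def D_def)
  have gap0: "0 \<le> gap v" if "v \<in> V" for v
    using rowmin_props(2)[OF that a(1)[OF that], of w] by (simp add: gap_def)
  have "card D1 \<le> card {e \<in> out_edges. near t e w}"
  proof (rule card_inj_on_le[of "\<lambda>v. (v, a v)"])
    show "(\<lambda>v. (v, a v)) ` D1 \<subseteq> {e \<in> out_edges. near t e w}"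
    proof safe
      fix v assume v: "v \<in> D1"
      then have vV: "v \<in> V" and ne: "rowmin w v \<noteq> a v" and gap: "gap v < t"
        by (auto simp: D1_def D_def)
      show "(v, a v) \<in> out_edges" using a(1)[OF vV] vV by (auto simp: out_edges_def)
      \<comment> \<open>Since \<open>a v\<close> is not the row minimum, removing it leaves the
        minimum of the row unchanged.\<close>
      have "rest_min (v, a v) w = w (v, rowmin w v)"
        unfolding rest_min_def fst_conv snd_conv
      proof (rule Min_eqI)
        show "w (v, rowmin w v) \<in> (\<lambda>u. w (v, u)) ` ({1..n} - {v, a v})"
          using rowmin_props(1)[OF vV, of w] ne by blast
        fix y assume "y \<in> (\<lambda>u. w (v, u)) ` ({1..n} - {v, a v})"
        then show "w (v, rowmin w v) \<le> y" using rowmin_props(2)[OF vV] by auto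
      qed auto
      then show "near t (v, a v) w" using gap gap0[OF vV] by (simp add: near_def gap_def)
    qed
  qed (auto simp: inj_on_def)
  moreover have "real (card D2) \<le> 2 * s / t * card (Z w)"
  proof -
    have "card D2 * t = (\<Sum>v\<in>D2. t)" by simp
    also have "\<dots> \<le> (\<Sum>v\<in>D2. gap v)" by (intro sum_mono) (simp add: D2_def)
    also have "\<dots> \<le> (\<Sum>v\<in>V. gap v)"
      using gap0 by (intro sum_mono2) (auto simp: D2_def D_def)
    also have "\<dots> = wsum w (mina w) - wsum w (rmin w)"
      by (simp add: gap_def sum_subtractf a(2) rmin_def wsum_def sum_fgraph)
    also have "\<dots> \<le> 2 * s * card (Z w)" using mina_cost_le[OF nn wc s] by simp
    finally show ?thesis using t by (simp add: field_simps)
  qed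
  moreover have "card D = card D1 + card D2"
    using fin by (subst card_Un_disjoint[symmetric]) (auto simp: D1_def D2_def intro: arg_cong[of _ _ card])
  ultimately show ?thesis unfolding D_def[symmetric] by simp
qed

section \<open>The expected number of cycles\<close>

lemma card_maps_fixed:
  assumes "T \<subseteq> V"
  shows "card {g \<in> maps. \<forall>v\<in>T. g v = h v} \<le> (n - 1) ^ (n - 1 - card T)"
proof -
  let ?F = "\<lambda>v. if v \<in> T then {h v} else {1..n} - {v}"
  have "{g \<in> maps. \<forall>v\<in>T. g v = h v} \<subseteq> PiE V ?F"
    using assms by (auto simp: PiE_def Pi_def)
  moreover have "finite (PiE V ?F)" by (intro finite_PiE) auto
  ultimately have "card {g \<in> maps. \<forall>v\<in>T. g v = h v} \<le> card (PiE V ?F)" by (intro card_mono)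
  also have "\<dots> = (\<Prod>v\<in>V. card (?F v))" by (rule card_PiE[OF finite_V])
  also have "\<dots> = (\<Prod>v\<in>V. if v \<in> T then 1 else n - 1)"
    by (intro prod.cong refl) (auto simp: V_def)
  also have "\<dots> = (\<Prod>v\<in>V - T. n - 1)"
    using assms by (intro prod.mono_neutral_cong_right) auto
  also have "\<dots> = (n - 1) ^ (n - 1 - card T)"
    using assms finite_subset[OF assms] by (simp add: card_Diff_subset card_V)
  finally show ?thesis .
qed

text \<open>Union bound over the remaining vertices of the cycle. A list of length k prescribes k +
  1 values of a uniform map, and there are at most (z - 1)^k lists. Lengths stop below n - 1 since
  the cycle lies in \<open>V\<close>.\<close>

lemma prob_Z_le:
  assumes z: "z \<in> V"
  shows "Pr.prob {w \<in> space P. z \<in> Z w} \<le> (\<Sum>k<n - 1. real (z - 1) ^ k / real (n - 1) ^ Suc k)"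
proof -
  let ?L = "\<lambda>k. {xs. set xs \<subseteq> V \<inter> {..<z} \<and> distinct xs \<and> length xs = k}"
  let ?G = "\<lambda>xs. {g \<in> maps. map g (z # xs) = xs @ [z]}"
  define N where "N = {g \<in> maps. z \<in> cycle_max V g}"
  have finL: "finite (?L k)" and cardL: "card (?L k) \<le> (z - 1) ^ k" for k
  proof -
    have sub: "?L k \<subseteq> {xs. set xs \<subseteq> {1..<z} \<and> length xs = k}"
      by (fastforce simp: V_def)
    moreover have "finite {xs. set xs \<subseteq> {1..<z} \<and> length xs = k}" by (rule finite_lists_length_eq) simp
    ultimately show "finite (?L k)" by (rule finite_subset)
    have "card (?L k) \<le> card {xs. set xs \<subseteq> {1..<z} \<and> length xs = k}"
      using sub by (intro card_mono finite_lists_length_eq) auto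
    also have "\<dots> = card {1..<z} ^ k" by (rule card_lists_length_eq) simp
    finally show "card (?L k) \<le> (z - 1) ^ k" by simp
  qed
  have G: "card (?G xs) \<le> (n - 1) ^ (n - 1 - Suc k)" if xs: "xs \<in> ?L k" for xs k
  proof (cases "?G xs = {}")
    case False
    \<comment> \<open>The prescribed values are read off from one map with this cycle; if there is
      none, the set to be counted is empty.\<close>
    then obtain h where h: "map h (z # xs) = xs @ [z]" by blast
    have c: "card (set (z # xs)) = Suc k"
      using xs by (subst distinct_card) auto
    have "map g (z # xs) = xs @ [z] \<longleftrightarrow> (\<forall>v\<in>set (z # xs). g v = h v)" for g
      unfolding h[symmetric] by (rule map_eq_conv)
    then have "card (?G xs) = card {g \<in> maps. \<forall>v\<in>set (z # xs). g v = h v}" by simp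
    also have "\<dots> \<le> (n - 1) ^ (n - 1 - card (set (z # xs)))"
      using z xs by (intro card_maps_fixed) auto
    finally show ?thesis unfolding c .
  next
    case True
    then show ?thesis by (simp only: card.empty le0)
  qed
  have "N \<subseteq> (\<Union>k<n - 1. \<Union>xs\<in>?L k. ?G xs)"
  proof
    fix g assume g: "g \<in> N"
    then obtain xs where xs: "set xs \<subseteq> V \<inter> {..<z}" "distinct xs" "map g (z # xs) = xs @ [z]"
      by (auto simp: N_def cycle_max_def)
    have "card (set (z # xs)) \<le> card V" using xs z by (intro card_mono) auto
    moreover have "card (set (z # xs)) = Suc (length xs)"
      using xs by (subst distinct_card) auto
    ultimately have "length xs < n - 1" by (simp add: card_V)
    with xs g show "g \<in> (\<Union>k<n - 1. \<Union>xs\<in>?L k. ?G xs)" by (auto simp: N_def)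
  qed
  moreover have finG: "finite (?G xs)" for xs
    using finite_maps by (rule rev_finite_subset) auto
  moreover have finU: "finite (\<Union>k<n - 1. \<Union>xs\<in>?L k. ?G xs)"
    using finL finG by (intro finite_UN_I) auto
  ultimately have "card N \<le> card (\<Union>k<n - 1. \<Union>xs\<in>?L k. ?G xs)"
    by (intro card_mono)
  also have "\<dots> \<le> (\<Sum>k<n - 1. card (\<Union>xs\<in>?L k. ?G xs))" by (intro card_UN_le) simp
  also have "\<dots> \<le> (\<Sum>k<n - 1. (z - 1) ^ k * (n - 1) ^ (n - 1 - Suc k))"
  proof (rule sum_mono)
    fix k
    have "card (\<Union>xs\<in>?L k. ?G xs) \<le> (\<Sum>xs\<in>?L k. card (?G xs))" by (intro card_UN_le finL)
    also have "\<dots> \<le> (\<Sum>xs\<in>?L k. (n - 1) ^ (n - 1 - Suc k))" by (intro sum_mono G)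
    also have "\<dots> \<le> (z - 1) ^ k * (n - 1) ^ (n - 1 - Suc k)" using cardL[of k] by simp
    finally show "card (\<Union>xs\<in>?L k. ?G xs) \<le> (z - 1) ^ k * (n - 1) ^ (n - 1 - Suc k)" .
  qed
  finally have "real (card N) \<le> real (\<Sum>k<n - 1. (z - 1) ^ k * (n - 1) ^ (n - 1 - Suc k))"
    by (rule of_nat_mono)
  also have "\<dots> = (\<Sum>k<n - 1. real (z - 1) ^ k * real (n - 1) ^ (n - 1 - Suc k))" by simp
  finally have cN: "real (card N) \<le> (\<Sum>k<n - 1. real (z - 1) ^ k * real (n - 1) ^ (n - 1 - Suc k))" .
  have pos: "0 < real (n - 1)" using n_ge_2 by simp
  have "{w \<in> space P. z \<in> Z w} = {w \<in> space P. rowmin w \<in> N}"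
    using rowmin_in_maps by (auto simp: N_def)
  also have "Pr.prob \<dots> = card N / real (n - 1) ^ (n - 1)"
    by (rule prob_rowmin) (auto simp: N_def)
  also have "\<dots> \<le> (\<Sum>k<n - 1. real (z - 1) ^ k * real (n - 1) ^ (n - 1 - Suc k)) / real (n - 1) ^ (n - 1)"
    using cN by (intro divide_right_mono) auto
  also have "\<dots> = (\<Sum>k<n - 1. real (z - 1) ^ k / real (n - 1) ^ Suc k)"
    unfolding sum_divide_distrib
  proof (intro sum.cong refl)
    fix k assume "k \<in> {..<n - 1}"
    then have e: "n - 1 - Suc k + Suc k = n - 1" by simp
    have "real (n - 1) ^ (n - 1) = real (n - 1) ^ (n - 1 - Suc k) * real (n - 1) ^ Suc k"
      by (simp only: power_add[symmetric] e)
    with pos show "real (z - 1) ^ k * real (n - 1) ^ (n - 1 - Suc k) / real (n - 1) ^ (n - 1)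
        = real (z - 1) ^ k / real (n - 1) ^ Suc k" by (simp only: divide_simps) simp
  qed
  finally show ?thesis .
qed

text \<open>For fixed z < n the bound is a geometric sum with ratio (z - 1) / (n - 1), hence at most
  1 / (n - z). Summation over z gives a harmonic number.\<close>

lemma sum_prob_Z_le: "(\<Sum>z\<in>V. Pr.prob {w \<in> space P. z \<in> Z w}) \<le> 2 + ln n"
proof -
  define N where "N = n - 1"
  have N: "1 \<le> N" and n: "n = Suc N" using n_ge_2 by (auto simp: N_def)
  define S where "S z = (\<Sum>k<N. real (z - 1) ^ k / real N ^ Suc k)" for z
  have S0: "0 \<le> S z" for z unfolding S_def by (intro sum_nonneg) auto
  have "(\<Sum>z\<in>V. Pr.prob {w \<in> space P. z \<in> Z w}) \<le> (\<Sum>z\<in>V. S z)"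
    unfolding S_def N_def by (intro sum_mono prob_Z_le)
  also have "\<dots> \<le> (\<Sum>z\<in>{1..n}. S z)"
    using S0 by (intro sum_mono2) (auto simp: V_def)
  also have "\<dots> = S n + (\<Sum>z\<in>{1..N}. S z)" unfolding n by simp
  \<comment> \<open>At z = n the ratio is 1 and the geometric bound fails, but the sum consists of N
    terms equal to 1 / N.\<close>
  also have "S n = 1" using N by (simp add: S_def n)
  also have "(\<Sum>z\<in>{1..N}. S z) \<le> (\<Sum>z\<in>{1..N}. 1 / real (n - z))"
  proof (rule sum_mono)
    fix z assume z: "z \<in> {1..N}"
    define q where "q = real (z - 1) / real N"
    have q: "0 \<le> q" "q < 1" using z N by (auto simp: q_def of_nat_diff)
    have "S z = (\<Sum>k<N. q ^ k) / N"
      by (simp add: S_def q_def sum_divide_distrib power_divide mult.commute)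
    also have "(\<Sum>k<N. q ^ k) \<le> 1 / (1 - q)"
      using q sum_le_suminf[of "\<lambda>k. q ^ k" "{..<N}"] by (simp add: suminf_geometric summable_geometric)
    then have "(\<Sum>k<N. q ^ k) / N \<le> 1 / (1 - q) / N" by (intro divide_right_mono) auto
    also have "1 / (1 - q) / N = 1 / (N - N * q)" by (simp add: algebra_simps)
    also have "N - N * q = real (n - z)" using z N by (simp add: q_def n of_nat_diff)
    finally show "S z \<le> 1 / real (n - z)" by simp
  qed
  also have "(\<Sum>z\<in>{1..N}. 1 / real (n - z)) = harm N"
    unfolding harm_def
    by (rule sum.reindex_bij_witness[of _ "\<lambda>z. n - z" "\<lambda>z. n - z"]) (auto simp: n inverse_eq_divide)
  also have "harm N \<le> 1 + ln (real N)"
  proof -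
    have "harm (Suc (N - 1)) - ln (Suc (N - 1)) \<le> harm (Suc 0) - ln (Suc 0)"
      using decseqD[OF decseq_harm_diff_ln, of 0 "N - 1"] by simp
    then show ?thesis using N by (simp add: harm_expand)
  qed
  also have "ln (real N) \<le> ln (real n)" using N n by simp
  finally show ?thesis by simp
qed

end

section \<open>Ball of the minimum arborescence versus ball of the row minima\<close>

context rooted_complete
begin

section \<open>Cheap detours exist with high probability\<close>

lemma indep_coordinates: "Pr.indep_vars (\<lambda>_. exp_measure) (\<lambda>e w. w e) E"
proof (subst Pr.indep_vars_iff_distr_eq_PiM')
  show "E \<noteq> {}" using edge_in_E[OF one_in_V, of d] d_mem by auto
  show rv: "(\<lambda>w. w e) \<in> measurable P exp_measure" if "e \<in> E" for e
    using that unfolding P_def by (rule measurable_component_singleton)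
  have "distr P (PiM E (\<lambda>_. exp_measure)) (\<lambda>x. \<lambda>i\<in>E. x i) = distr P P (\<lambda>x. x)"
    unfolding P_def[symmetric] by (intro distr_cong refl) (auto simp: space_P)
  also have "\<dots> = P" by simp
  also have "\<dots> = PiM E (\<lambda>i. distr P exp_measure (\<lambda>x. x i))"
    unfolding P_def
    by (intro PiM_cong refl distr_PiM_component[symmetric]) (simp_all add: prob_space_exponential_density)
  finally show "distr P (PiM E (\<lambda>_. exp_measure)) (\<lambda>x. \<lambda>i\<in>E. x i)
    = PiM E (\<lambda>i. distr P exp_measure (\<lambda>x. x i))" .
qed

lemma prob_coordinate_le:
  assumes "e \<in> E" "0 \<le> s"
  shows "Pr.prob {w \<in> space P. w e \<le> s} = 1 - exp (- s)"
proof -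
  have "distr P lborel (\<lambda>w. w e) = distr P exp_measure (\<lambda>w. w e)"
    by (intro distr_cong refl) simp
  also have "\<dots> = exp_measure"
    unfolding P_def using assms(1)
    by (intro distr_PiM_component) (simp_all add: prob_space_exponential_density)
  finally have "distributed P lborel (\<lambda>w. w e) (exponential_density 1)"
    using assms(1) unfolding distributed_def by simp
  from Pr.exponential_distributedD_le[OF this assms(2)] show ?thesis by simp
qed

lemma AE_nonneg: "AE w in P. nonneg w"
  unfolding nonneg_def
proof (rule AE_finite_allI[OF finite_E])
  fix e assume e: "e \<in> E"
  have "AE x in exp_measure. 0 \<le> x"
    by (subst AE_density) (auto simp: exponential_density_def)
  then show "AE w in P. 0 \<le> w e"
    unfolding P_def by (intro AE_PiM_component[OF _ e]) (simp_all add: prob_space_exponential_density)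
qed

lemma well_connected_sets: "{w \<in> space P. well_connected s w} \<in> sets P"
  unfolding well_connected_def
proof (intro sets.sets_Collect_finite_All sets.sets_Collect_finite_Ex sets.sets_Collect_conj
    borel_measurable_le borel_measurable_const measurable_component_P)
qed (use d_in in \<open>auto simp: E_eq V_def\<close>)

text \<open>Detours through different middle vertices use disjoint pairs of edges, so their failures
  are independent; a single detour succeeds with probability (1 - exp (- s))^2.\<close>

lemma prob_not_well_connected_at:
  assumes z: "z \<in> V" and s: "0 \<le> s"
  shows "Pr.prob {w \<in> space P. \<forall>u\<in>{1..n} - {z, d}. \<not> (w (z, u) \<le> s \<and> w (u, d) \<le> s)}
    \<le> (1 - (1 - exp (- s))\<^sup>2) ^ (n - 2)"
proof -
  define L where "L = {1..n} - {z, d}"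
  define K where "K u = {(z, u), (u, d)}" for u
  have KE: "K u \<subseteq> E" "(z, u) \<noteq> (u, d)" if "u \<in> L" for u
    using that z d_in by (auto simp: K_def L_def E_eq V_def)
  define A where "A u = {x \<in> space (PiM (K u) (\<lambda>_. exp_measure)). \<not> (x (z, u) \<le> s \<and> x (u, d) \<le> s)}" for u
  define X where "X u w = restrict w (K u)" for u and w :: "nat \<times> nat \<Rightarrow> real"
  have cardL: "card L = n - 2"
    using z d_in by (simp add: L_def card_Diff_subset V_def)
  have pre: "X u -` A u \<inter> space P = {w \<in> space P. \<not> (w (z, u) \<le> s \<and> w (u, d) \<le> s)}" for u
    by (auto simp: A_def X_def K_def space_PiM)
  have meas: "{w \<in> space P. w e \<le> s} \<in> sets P" if "e \<in> E" for e
    using that by (intro borel_measurable_le borel_measurable_const measurable_component_P)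
  have pu: "Pr.prob {w \<in> space P. \<not> (w (z, u) \<le> s \<and> w (u, d) \<le> s)} = 1 - (1 - exp (- s))\<^sup>2"
    if u: "u \<in> L" for u
  proof -
    have "Pr.prob (\<Inter>e\<in>K u. (\<lambda>w. w e) -` {..s} \<inter> space P)
        = (\<Prod>e\<in>K u. Pr.prob ((\<lambda>w. w e) -` {..s} \<inter> space P))"
      using KE[OF u] by (intro Pr.indep_varsD[OF indep_coordinates]) (auto simp: K_def)
    also have "\<dots> = (\<Prod>e\<in>K u. 1 - exp (- s))"
    proof (intro prod.cong refl)
      fix e assume "e \<in> K u"
      then have "e \<in> E" using KE[OF u] by auto
      from prob_coordinate_le[OF this s] show "Pr.prob ((\<lambda>w. w e) -` {..s} \<inter> space P) = 1 - exp (- s)"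
        by (simp add: vimage_def Int_def conj_commute)
    qed
    also have "\<dots> = (1 - exp (- s))\<^sup>2" using KE(2)[OF u] by (simp add: K_def power2_eq_square)
    also have "(\<Inter>e\<in>K u. (\<lambda>w. w e) -` {..s} \<inter> space P) = {w \<in> space P. w (z, u) \<le> s \<and> w (u, d) \<le> s}"
      by (auto simp: K_def)
    finally have "Pr.prob {w \<in> space P. w (z, u) \<le> s \<and> w (u, d) \<le> s} = (1 - exp (- s))\<^sup>2" .
    moreover have "{w \<in> space P. w (z, u) \<le> s \<and> w (u, d) \<le> s} \<in> sets P"
      using KE[OF u] meas by (intro sets.sets_Collect_conj) (auto simp: K_def)
    ultimately show ?thesis
      using Pr.prob_neg[of "\<lambda>w. w (z, u) \<le> s \<and> w (u, d) \<le> s"] by (simp only:)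
  qed
  show ?thesis
  \<comment> \<open>For n = 2 there is no middle vertex and the bound is 1; the product rule for
    independent variables wants a nonempty index set.\<close>
  proof (cases "L = {}")
    case True
    then show ?thesis using cardL by simp
  next
    case False
    have "disjoint_family_on K L" by (auto simp: disjoint_family_on_def K_def L_def)
    then have ind: "Pr.indep_vars (\<lambda>u. PiM (K u) (\<lambda>_. exp_measure)) (\<lambda>u w. restrict (\<lambda>e. w e) (K u)) L"
      using KE by (intro Pr.indep_vars_restrict[OF indep_coordinates]) auto
    have "Pr.prob (\<Inter>u\<in>L. X u -` A u \<inter> space P) = (\<Prod>u\<in>L. Pr.prob (X u -` A u \<inter> space P))"
      unfolding X_def
    proof (rule Pr.indep_varsD_finite[OF ind False])
      show "finite L" by (simp add: L_def)
      fix u assume "u \<in> L"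
      have comp: "(\<lambda>x. x e) \<in> borel_measurable (PiM (K u) (\<lambda>_. exp_measure))" if "e \<in> K u" for e
        using measurable_component_singleton[of e "K u" "\<lambda>_. exp_measure"] that
        by (simp add: measurable_cong_sets[OF refl, of exp_measure borel])
      show "A u \<in> sets (PiM (K u) (\<lambda>_. exp_measure))"
        unfolding A_def by (intro sets.sets_Collect_neg sets.sets_Collect_conj borel_measurable_le
            borel_measurable_const comp) (simp_all add: K_def)
    qed
    also have "\<dots> = (\<Prod>u\<in>L. 1 - (1 - exp (- s))\<^sup>2)"
      unfolding pre by (intro prod.cong refl pu)
    also have "\<dots> = (1 - (1 - exp (- s))\<^sup>2) ^ (n - 2)" by (simp add: cardL)
    also have "(\<Inter>u\<in>L. X u -` A u \<inter> space P)
        = {w \<in> space P. \<forall>u\<in>L. \<not> (w (z, u) \<le> s \<and> w (u, d) \<le> s)}"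
      unfolding pre using False by auto
    finally show ?thesis by (simp add: L_def)
  qed
qed

lemma prob_not_well_connected:
  assumes s: "0 \<le> s"
  shows "Pr.prob {w \<in> space P. \<not> well_connected s w} \<le> n * exp (- ((1 - exp (- s))\<^sup>2 * (n - 2)))"
proof -
  let ?B = "\<lambda>z. {w \<in> space P. \<forall>u\<in>{1..n} - {z, d}. \<not> (w (z, u) \<le> s \<and> w (u, d) \<le> s)}"
  define p where "p = (1 - exp (- s))\<^sup>2"
  have B: "?B z \<in> sets P" if "z \<in> V" for z
    using that d_in
    by (intro sets.sets_Collect_finite_All sets.sets_Collect_neg sets.sets_Collect_conj
        borel_measurable_le borel_measurable_const measurable_component_P) (auto simp: E_eq V_def)
  have p: "0 \<le> p" "p \<le> 1" using s by (auto simp: p_def power_le_one)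
  have "{w \<in> space P. \<not> well_connected s w} \<subseteq> (\<Union>z\<in>V. ?B z)"
    by (auto simp: well_connected_def)
  then have "Pr.prob {w \<in> space P. \<not> well_connected s w} \<le> Pr.prob (\<Union>z\<in>V. ?B z)"
    using B by (intro Pr.finite_measure_mono sets.finite_UN) auto
  also have "\<dots> \<le> (\<Sum>z\<in>V. Pr.prob (?B z))"
    using B by (intro Pr.finite_measure_subadditive_finite) auto
  also have "\<dots> \<le> (\<Sum>z\<in>V. (1 - p) ^ (n - 2))"
    unfolding p_def by (intro sum_mono prob_not_well_connected_at s)
  also have "\<dots> \<le> n * (1 - p) ^ (n - 2)"
    using p by (simp add: card_V mult_right_mono)
  also have "(1 - p) ^ (n - 2) \<le> exp (- p) ^ (n - 2)"
    using p exp_ge_add_one_self[of "- p"] by (intro power_mono) auto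
  also have "exp (- p) ^ (n - 2) = exp (- (p * (n - 2)))"
    by (simp add: exp_of_nat_mult[symmetric] mult_ac)
  finally show ?thesis unfolding p_def by (simp add: mult_left_mono)
qed

section \<open>The probability that the ball around 1 is affected\<close>

lemma bad_sets: "{w \<in> space P. bad m k v (rmin w) (mina w)} \<in> sets P"
  by (rule pat_measurable) (metis rmin_def rowmin_cong mina_cong)

text \<open>By exchangeability the left-hand side is the expected number of bad vertices in
  \<open>V\<close>. Its three error terms come from near-ties, from the cost of breaking cycles, and
  from weights without cheap detours.\<close>

lemma prob_bad_le:
  fixes s t :: real
  assumes s: "0 \<le> s" and t: "0 < t"
  shows "(n - 1) * Pr.prob {w \<in> space P. bad m k 1 (rmin w) (mina w)} \<le>
    3 * real m * (real n * real n * t + 2 * s / t * (2 + ln n)) + n * (n * exp (- ((1 - exp (- s))\<^sup>2 * (n - 2))))"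
proof -
  let ?B = "\<lambda>v. {w \<in> space P. bad m k v (rmin w) (mina w)}"
  let ?N = "\<lambda>e. {w \<in> space P. near t e w}"
  let ?Z = "\<lambda>z. {w \<in> space P. z \<in> Z w}"
  let ?G = "{w \<in> space P. \<not> well_connected s w}"
  define c where "c = 2 * s / t"
  have c: "0 \<le> c" using s t by (simp add: c_def)
  have Zs: "?Z z \<in> sets P" for z by (rule pat_measurable) (metis rowmin_cong)
  have Gs: "?G \<in> sets P" by (intro sets.sets_Collect_neg well_connected_sets)
  have Ns: "?N e \<in> sets P" if "e \<in> out_edges" for e by (rule near_sets[OF that])
  \<comment> \<open>An almost sure upper bound for the number of bad vertices:
    \<open>card_bad_le\<close> combined with \<open>card_diff_le\<close> for well-connected weights,
    and the trivial bound n otherwise.\<close>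
  define X where "X w = 3 * real m * ((\<Sum>e\<in>out_edges. indicator (?N e) w) + c * (\<Sum>z\<in>V. indicator (?Z z) w))
    + n * indicat_real ?G w" for w
  have int: "integrable P (indicator S :: _ \<Rightarrow> real)" if "S \<in> sets P" for S
    using that by (simp add: Pr.emeasure_eq_measure)
  have "(n - 1) * Pr.prob (?B 1) = (\<Sum>v\<in>V. Pr.prob (?B v))"
  proof -
    have "Pr.prob (?B v) = Pr.prob (?B 1)" if "v \<in> V" for v
      by (rule exchangeable[OF that]) (rule bad_map_prod)
    then show ?thesis using n_ge_2 by (simp add: card_V of_nat_diff)
  qed
  also have "\<dots> = (\<integral>w. (\<Sum>v\<in>V. indicator (?B v) w) \<partial>P)"
    using int[OF bad_sets] bad_sets by (subst Bochner_Integration.integral_sum) (auto simp: sets.Int_space_eq2)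
  also have "\<dots> \<le> (\<integral>w. X w \<partial>P)"
  proof (rule integral_mono_AE)
    show "integrable P (\<lambda>w. \<Sum>v\<in>V. indicator (?B v) w :: real)"
      by (intro Bochner_Integration.integrable_sum int bad_sets)
    show "integrable P X"
      unfolding X_def using int Ns Zs Gs
      by (intro Bochner_Integration.integrable_add integrable_mult_right Bochner_Integration.integrable_sum) auto
    show "AE w in P. (\<Sum>v\<in>V. indicator (?B v) w) \<le> X w"
      using AE_nonneg AE_space
    proof eventually_elim
      case (elim w)
      have cnt: "(\<Sum>i\<in>I. indicator {w \<in> space P. Q i w} w) = real (card {i \<in> I. Q i w})"
        if "finite I" for I :: "'c set" and Q
        using elim(2) that by (simp add: indicator_def sum.If_cases Int_def)
      have eqX: "X w = 3 * real m * (card {e \<in> out_edges. near t e w} + c * card (Z w))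
          + (if well_connected s w then 0 else real n)"
      proof -
        have "{z \<in> V. z \<in> Z w} = Z w" using Z_subset by auto
        then show ?thesis
          using elim(2) unfolding X_def cnt[OF finite_out_edges] cnt[OF finite_V]
          by (simp add: indicator_def)
      qed
      obtain a where a: "\<And>v. v \<in> V \<Longrightarrow> a v \<in> {1..n} - {v}" "mina w = fgraph V a"
        using mina_props(1)[of w] unfolding spanning_iff by blast
      show "(\<Sum>v\<in>V. indicator (?B v) w) \<le> X w"
      proof (cases "well_connected s w")
        case True
        have "real (card {v \<in> V. bad m k v (rmin w) (mina w)}) \<le> real (3 * m * card {v \<in> V. rowmin w v \<noteq> a v})"
          unfolding rmin_def a(2) by (intro of_nat_mono card_bad_le finite_V)
        also have "\<dots> = 3 * real m * card {v \<in> V. rowmin w v \<noteq> a v}" by simp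
        also have "\<dots> \<le> 3 * real m * (card {e \<in> out_edges. near t e w} + c * card (Z w))"
          unfolding c_def using card_diff_le[OF elim(1) True s t a] by (intro mult_left_mono) auto
        finally show ?thesis using True by (simp add: cnt eqX)
      next
        case False
        have "card {v \<in> V. bad m k v (rmin w) (mina w)} \<le> card V" by (intro card_mono) auto
        then have "card {v \<in> V. bad m k v (rmin w) (mina w)} \<le> n" using card_V by simp
        moreover have "0 \<le> 3 * real m * (card {e \<in> out_edges. near t e w} + c * card (Z w))"
          using c by (intro mult_nonneg_nonneg add_nonneg_nonneg) auto
        ultimately show ?thesis using False by (simp add: cnt eqX)
      qed
    qed
  qed
  also have "\<dots> = 3 * real m * ((\<Sum>e\<in>out_edges. Pr.prob (?N e)) + c * (\<Sum>z\<in>V. Pr.prob (?Z z)))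
      + n * Pr.prob ?G"
  proof -
    have i1: "integrable P (\<lambda>w. \<Sum>e\<in>out_edges. indicator (?N e) w :: real)"
      and i2: "integrable P (\<lambda>w. \<Sum>z\<in>V. indicator (?Z z) w :: real)"
      by (intro Bochner_Integration.integrable_sum int Ns Zs; assumption)+
    have e1: "(\<integral>w. (\<Sum>e\<in>out_edges. indicator (?N e) w) \<partial>P) = (\<Sum>e\<in>out_edges. Pr.prob (?N e))"
      using int Ns by (subst Bochner_Integration.integral_sum) (auto simp: sets.Int_space_eq2)
    have e2: "(\<integral>w. (\<Sum>z\<in>V. indicator (?Z z) w) \<partial>P) = (\<Sum>z\<in>V. Pr.prob (?Z z))"
      using int Zs by (subst Bochner_Integration.integral_sum) (auto simp: sets.Int_space_eq2)
    have e3: "(\<integral>w. indicat_real ?G w \<partial>P) = Pr.prob ?G"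
      using Gs by (simp add: sets.Int_space_eq2)
    show ?thesis
      unfolding X_def using i1 i2 int[OF Gs] e1 e2 e3 by simp
  qed
  also have "\<dots> \<le> 3 * real m * (real n * real n * t + c * (2 + ln n))
      + n * (n * exp (- ((1 - exp (- s))\<^sup>2 * (n - 2))))"
  proof (intro add_mono mult_left_mono)
    have "(\<Sum>e\<in>out_edges. Pr.prob (?N e)) \<le> (\<Sum>e\<in>out_edges. t)"
      using t by (intro sum_mono prob_near_le) auto
    also have "\<dots> \<le> real n * real n * t"
    proof -
      have "real (card out_edges) \<le> real n * real n"
        using of_nat_mono[OF card_out_edges, where ?'a = real] by simp
      then show ?thesis using t by (simp add: mult_right_mono)
    qed
    finally show "(\<Sum>e\<in>out_edges. Pr.prob (?N e)) \<le> real n * real n * t" .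
  qed (use sum_prob_Z_le prob_not_well_connected[OF s] c in auto)
  finally show ?thesis by (simp add: c_def)
qed

end

lemma prob_bad_tendsto_0:
  assumes d: "\<And>n. 2 \<le> n \<Longrightarrow> d n \<in> {1..n} - {1}"
  shows "(\<lambda>n. measure (rooted_complete.P n)
    {w \<in> space (rooted_complete.P n).
      bad m k 1 (rooted_complete.rmin n (d n) w) (rooted_complete.mina n (d n) w)}) \<longlonglongrightarrow> 0"
proof (rule tendsto_sandwich[OF _ _ tendsto_const])
  \<comment> \<open>After division by n the errors are of order n t, s log n / (n t) and n exp (- n
    s^2). With s = n^(-1/4) the exponent n s^2 = n^(1/2) beats log n, and t must lie between
    n^(-5/4) log n and n^(-1); the exponent -17/16 lies in this window.\<close>
  define s :: "nat \<Rightarrow> real" where "s n = n powr (- 1 / 4)" for n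
  define t :: "nat \<Rightarrow> real" where "t n = n powr (- 17 / 16)" for n
  define b where "b n = (3 * real m * (real n * real n * t n + 2 * s n / t n * (2 + ln n))
    + n * (n * exp (- ((1 - exp (- s n))\<^sup>2 * (real n - 2))))) / (real n - 1)" for n
  show "b \<longlonglongrightarrow> 0" unfolding b_def s_def t_def by real_asymp
  show "\<forall>\<^sub>F n in sequentially. measure (rooted_complete.P n)
    {w \<in> space (rooted_complete.P n).
      bad m k 1 (rooted_complete.rmin n (d n) w) (rooted_complete.mina n (d n) w)} \<le> b n"
    using eventually_ge_at_top[of 2]
  proof eventually_elim
    case (elim n)
    interpret rooted_complete n "d n" using d[of n] elim by unfold_locales auto
    have "0 < t n" "0 \<le> s n" using elim by (simp_all add: t_def s_def)
    from prob_bad_le[OF this(2,1), of m k] show ?case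
      using elim by (simp add: b_def field_simps of_nat_diff)
  qed
qed (simp add: measure_nonneg)

section \<open>Finite pieces of the spine tree\<close>

lemma Nil_in_gw_tree [simp]: "[] \<in> gw_tree c"
  by (simp add: gw_tree_def)

lemma snoc_in_gw_tree [simp]: "xs @ [j] \<in> gw_tree c \<longleftrightarrow> xs \<in> gw_tree c \<and> j < c xs"
proof
  assume *: "xs @ [j] \<in> gw_tree c"
  have "k < c ys" if "xs = ys @ k # zs" for ys k zs
    using * that unfolding gw_tree_def by (metis (mono_tags, lifting) append.assoc append_Cons mem_Collect_eq)
  moreover have "j < c xs" using * unfolding gw_tree_def by blast
  ultimately show "xs \<in> gw_tree c \<and> j < c xs" unfolding gw_tree_def by blast
next
  assume *: "xs \<in> gw_tree c \<and> j < c xs"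
  have "k < c ys" if "xs @ [j] = ys @ k # zs" for ys k zs
  proof (cases zs rule: rev_cases)
    case Nil
    then show ?thesis using that * by simp
  next
    case (snoc zs' z)
    then have "xs = ys @ k # zs'" using that by simp
    then show ?thesis using * unfolding gw_tree_def by blast
  qed
  then show "xs @ [j] \<in> gw_tree c" unfolding gw_tree_def by blast
qed

lemma finite_gw_tree_level: "finite {xs \<in> gw_tree c. length xs \<le> l}"
proof (induction l)
  case (Suc l)
  have "{xs \<in> gw_tree c. length xs \<le> Suc l} \<subseteq> {[]} \<union>
      (\<Union>xs\<in>{xs \<in> gw_tree c. length xs \<le> l}. (\<lambda>j. xs @ [j]) ` {..<c xs})"
  proof
    fix xs assume xs: "xs \<in> {xs \<in> gw_tree c. length xs \<le> Suc l}"
    show "xs \<in> {[]} \<union> (\<Union>xs\<in>{xs \<in> gw_tree c. length xs \<le> l}. (\<lambda>j. xs @ [j]) ` {..<c xs})"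
      using xs by (cases xs rule: rev_cases) auto
  qed
  then show ?case by (rule finite_subset) (use Suc in auto)
qed simp

definition nchild :: "(nat \<Rightarrow> nat list \<Rightarrow> nat) \<Rightarrow> nat \<times> nat list \<Rightarrow> nat" where
  "nchild c p = c (fst p) (snd p)"

definition child :: "nat \<times> nat list \<Rightarrow> nat \<Rightarrow> nat \<times> nat list" where
  "child p j = (fst p, snd p @ [j])"

definition parent :: "nat \<times> nat list \<Rightarrow> nat \<times> nat list" where
  "parent p = (if snd p = [] then (Suc (fst p), []) else (fst p, butlast (snd p)))"

text \<open>Besides its Galton-Watson children, a path vertex has the preceding path vertex as
  in-neighbour.\<close>

definition spine_child :: "nat \<times> nat list \<Rightarrow> (nat \<times> nat list) set" where
  "spine_child p = (if snd p = [] \<and> 0 < fst p then {(fst p - 1, [])} else {})"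

text \<open>The finite piece to be located in a map. It ends in the bare path vertex
  \<open>(N, [])\<close>, which is present so that \<open>(N - 1, [])\<close> has its parent in the
  piece; \<open>expanded\<close> collects the vertices whose whole in-neighbourhood belongs to the
  piece.\<close>

definition positions :: "nat \<Rightarrow> (nat \<Rightarrow> nat list \<Rightarrow> nat) \<Rightarrow> (nat \<times> nat list) set" where
  "positions N c = {(i, xs). xs \<in> gw_tree (c i) \<and> (i < N \<and> length xs \<le> N \<or> i = N \<and> xs = [])}"

definition expanded :: "nat \<Rightarrow> (nat \<Rightarrow> nat list \<Rightarrow> nat) \<Rightarrow> (nat \<times> nat list) set" where
  "expanded N c = {(i, xs). xs \<in> gw_tree (c i) \<and> i < N \<and> length xs < N}"

lemma parent_child [simp]: "parent (child p j) = p"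
  by (simp add: parent_def child_def)

lemma child_inject [simp]: "child p i = child q j \<longleftrightarrow> p = q \<and> i = j"
  by (auto simp: child_def prod_eq_iff)

lemma child_neq_Nil [simp]: "child p j \<noteq> (i, [])" "(i, []) \<noteq> child p j"
  by (auto simp: child_def)

lemma parent_spine [simp]: "parent (i, []) = (Suc i, [])"
  by (simp add: parent_def)

lemma position_cases:
  obtains i where "q = (i, [])" | p j where "q = child p j"
proof (cases "snd q" rule: rev_cases)
  case Nil
  then show ?thesis using that(1)[of "fst q"] by (cases q) simp
next
  case (snoc xs j)
  then show ?thesis using that(2)[of "(fst q, xs)" j] by (cases q) (simp add: child_def)
qed

lemma spine_in_positions [simp]: "(i, []) \<in> positions N c \<longleftrightarrow> i \<le> N"
  by (auto simp: positions_def)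

lemma spine_in_expanded [simp]: "(i, []) \<in> expanded N c \<longleftrightarrow> i < N"
  by (auto simp: expanded_def)

lemma child_in_positions [simp]:
  "child p j \<in> positions N c \<longleftrightarrow> p \<in> expanded N c \<and> j < nchild c p"
  by (cases p) (auto simp: positions_def expanded_def child_def nchild_def)

lemma expanded_eq: "expanded N c = {p \<in> positions N c. fst p < N \<and> length (snd p) < N}"
  by (auto simp: positions_def expanded_def)

lemma expanded_subset: "expanded N c \<subseteq> positions N c - {(N, [])}"
  by (auto simp: expanded_def positions_def)

lemma parent_in_positions:
  assumes "q \<in> positions N c - {(N, [])}"
  shows "parent q \<in> positions N c"
  using assms expanded_subset[of N c] by (cases q rule: position_cases) auto

lemma parent_eq_iff: "parent q = p \<longleftrightarrow> (\<exists>j. q = child p j) \<or> q \<in> spine_child p"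
proof (cases q rule: position_cases)
  case (1 i)
  then show ?thesis by (cases p) (auto simp: spine_child_def)
qed (auto simp: spine_child_def)

lemma spine_child_subset: "p \<in> expanded N c \<Longrightarrow> spine_child p \<subseteq> positions N c - {(N, [])}"
  by (auto simp: spine_child_def expanded_def)

lemma child_spine_child_disjoint: "child p ` A \<inter> spine_child p = {}"
  by (auto simp: spine_child_def)

lemma finite_positions [simp]: "finite (positions N c)"
proof -
  have "positions N c \<subseteq> (SIGMA i:{..N}. {xs \<in> gw_tree (c i). length xs \<le> N})"
    by (auto simp: positions_def)
  moreover have "finite (SIGMA i:{..N}. {xs \<in> gw_tree (c i). length xs \<le> N})"
    by (intro finite_SigmaI finite_gw_tree_level) simp
  ultimately show ?thesis by (rule finite_subset)
qed

lemma finite_expanded [simp]: "finite (expanded N c)"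
  by (rule finite_subset[OF expanded_subset]) simp

section \<open>Codes of parent maps\<close>

definition labelling :: "nat \<Rightarrow> (nat \<Rightarrow> nat list \<Rightarrow> nat) \<Rightarrow> nat set \<Rightarrow> (nat \<times> nat list \<Rightarrow> nat) \<Rightarrow> bool" where
  "labelling N c S \<phi> \<longleftrightarrow> \<phi> \<in> positions N c \<rightarrow>\<^sub>E S \<and> inj_on \<phi> (positions N c) \<and> \<phi> (0, []) = 1"

text \<open>In a labelled graph the order of siblings is arbitrary. Demanding increasing labels
  picks one of the orderings and makes the labelling unique.\<close>

definition sorted_labelling ::
    "nat \<Rightarrow> (nat \<Rightarrow> nat list \<Rightarrow> nat) \<Rightarrow> nat set \<Rightarrow> (nat \<times> nat list \<Rightarrow> nat) \<Rightarrow> bool" where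
  "sorted_labelling N c S \<phi> \<longleftrightarrow> labelling N c S \<phi> \<and>
    (\<forall>p\<in>expanded N c. strict_mono_on {..<nchild c p} (\<lambda>j. \<phi> (child p j)))"

text \<open>The second clause denies expanded vertices any further in-neighbours. The end
  \<open>(N, [])\<close> is special in both clauses: its own image is not prescribed, but it may not
  map back to an expanded vertex, which would close a cycle.\<close>

definition follows ::
    "nat \<Rightarrow> (nat \<Rightarrow> nat list \<Rightarrow> nat) \<Rightarrow> nat set \<Rightarrow> (nat \<Rightarrow> nat) \<Rightarrow> (nat \<times> nat list \<Rightarrow> nat) \<Rightarrow> bool" where
  "follows N c S g \<phi> \<longleftrightarrow>
    (\<forall>p\<in>positions N c - {(N, [])}. g (\<phi> p) = \<phi> (parent p)) \<and>
    (\<forall>v\<in>S. g v \<in> \<phi> ` expanded N c \<longrightarrow> v \<in> \<phi> ` (positions N c - {(N, [])}))"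

definition encodes ::
    "nat \<Rightarrow> (nat \<Rightarrow> nat list \<Rightarrow> nat) \<Rightarrow> nat set \<Rightarrow> (nat \<Rightarrow> nat) \<Rightarrow> (nat \<times> nat list \<Rightarrow> nat) \<Rightarrow> bool" where
  "encodes N c S g \<phi> \<longleftrightarrow> sorted_labelling N c S \<phi> \<and> follows N c S g \<phi>"

text \<open>Every preimage carries a label by the second clause of \<open>follows\<close>, and by
  injectivity the position of that label has parent \<open>p\<close>.\<close>

lemma follows_preimage:
  assumes lab: "labelling N c S \<phi>" and fol: "follows N c S g \<phi>" and p: "p \<in> expanded N c"
  shows "{v \<in> S. g v = \<phi> p} = \<phi> ` (child p ` {..<nchild c p} \<union> spine_child p)"
proof -
  have inj: "inj_on \<phi> (positions N c)" and im: "\<And>q. q \<in> positions N c \<Longrightarrow> \<phi> q \<in> S"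
    using lab by (auto simp: labelling_def)
  have ppos: "p \<in> positions N c" using p expanded_subset by blast
  show ?thesis
  proof (intro equalityI subsetI)
    fix v assume v: "v \<in> {v \<in> S. g v = \<phi> p}"
    then obtain q where q: "q \<in> positions N c - {(N, [])}" "v = \<phi> q"
      using fol p unfolding follows_def by blast
    then have "\<phi> (parent q) = \<phi> p" using fol v unfolding follows_def by auto
    then have "parent q = p"
      using inj_onD[OF inj _ parent_in_positions[OF q(1)] ppos] by blast
    then have "q \<in> child p ` {..<nchild c p} \<union> spine_child p"
      using q(1) unfolding parent_eq_iff by auto
    then show "v \<in> \<phi> ` (child p ` {..<nchild c p} \<union> spine_child p)" using q(2) by blast
  next
    fix v assume "v \<in> \<phi> ` (child p ` {..<nchild c p} \<union> spine_child p)"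
    then obtain q where q: "q \<in> child p ` {..<nchild c p} \<union> spine_child p" "v = \<phi> q" by blast
    then have "q \<in> positions N c - {(N, [])}" using p spine_child_subset[OF p] by auto
    moreover have "parent q = p" using q(1) unfolding parent_eq_iff by auto
    ultimately show "v \<in> {v \<in> S. g v = \<phi> p}"
      using fol im q(2) unfolding follows_def by auto
  qed
qed

lemma strict_mono_on_image_unique:
  fixes f h :: "nat \<Rightarrow> nat"
  assumes "strict_mono_on {..<a} f" "strict_mono_on {..<b} h" "f ` {..<a} = h ` {..<b}"
  shows "a = b" "\<forall>j<a. f j = h j"
proof -
  have "card (f ` {..<a}) = a" "card (h ` {..<b}) = b"
    using assms(1,2) by (simp_all add: card_image strict_mono_on_imp_inj_on)
  with assms(3) show ab: "a = b" by simp
  have srt: "sorted (map f [0..<a])" "distinct (map f [0..<a])"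
    if "strict_mono_on {..<a} f" for f :: "nat \<Rightarrow> nat"
  proof -
    have "f i \<le> f j" if "i \<le> j" "j < a" for i j
      using strict_mono_onD[OF \<open>strict_mono_on {..<a} f\<close>, of i j] that by (cases "i = j") auto
    then show "sorted (map f [0..<a])" by (simp add: sorted_iff_nth_mono)
    show "distinct (map f [0..<a])"
      using strict_mono_on_imp_inj_on[OF that] by (simp add: distinct_map atLeast0LessThan)
  qed
  have "map f [0..<a] = map h [0..<a]"
    using srt[OF assms(1)] srt[of h] assms(2,3) ab
    by (intro sorted_distinct_set_unique) (auto simp: atLeast0LessThan)
  then show "\<forall>j<a. f j = h j" by simp
qed

text \<open>The map \<open>g\<close> determines everything: the path is the orbit 1, g 1, g (g 1),
  ..., and the children of a vertex are its preimages without the preceding path vertex, in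
  increasing order. So distinct codes, and distinct labellings, belong to disjoint sets of
  maps.\<close>

lemma encodes_unique:
  assumes e: "encodes N c S g \<phi>" and e': "encodes N c' S g \<phi>'"
  shows "expanded N c = expanded N c'" "\<And>p. p \<in> expanded N c \<Longrightarrow> nchild c p = nchild c' p" "\<phi> = \<phi>'"
proof -
  have lab: "labelling N c S \<phi>" "labelling N c' S \<phi>'"
    and fol: "follows N c S g \<phi>" "follows N c' S g \<phi>'"
    and srt: "\<And>p. p \<in> expanded N c \<Longrightarrow> strict_mono_on {..<nchild c p} (\<lambda>j. \<phi> (child p j))"
      "\<And>p. p \<in> expanded N c' \<Longrightarrow> strict_mono_on {..<nchild c' p} (\<lambda>j. \<phi>' (child p j))"
    using e e' by (auto simp: encodes_def sorted_labelling_def)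
  have spine: "\<phi> (i, []) = \<phi>' (i, [])" if "i \<le> N" for i
    using that
  proof (induction i)
    case 0
    then show ?case using lab by (simp add: labelling_def)
  next
    case (Suc i)
    have "\<phi> (Suc i, []) = g (\<phi> (i, []))" "\<phi>' (Suc i, []) = g (\<phi>' (i, []))"
      using fol Suc.prems unfolding follows_def by force+
    then show ?case using Suc by simp
  qed
  have step: "nchild c p = nchild c' p \<and> (\<forall>j<nchild c p. \<phi> (child p j) = \<phi>' (child p j))"
    if p: "p \<in> expanded N c" "p \<in> expanded N c'" "\<phi> p = \<phi>' p" for p
  proof -
    have sp: "\<phi> ` spine_child p = \<phi>' ` spine_child p"
      using p(1) spine by (auto simp: spine_child_def expanded_def)
    have *: "\<phi> ` child p ` {..<nchild c p} = {v \<in> S. g v = \<phi> p} - \<phi> ` spine_child p"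
      if "labelling N c S \<phi>" "follows N c S g \<phi>" "p \<in> expanded N c" for c \<phi>
    proof -
      have "inj_on \<phi> (child p ` {..<nchild c p} \<union> spine_child p)"
      proof (rule inj_on_subset)
        show "inj_on \<phi> (positions N c)" using that(1) by (simp add: labelling_def)
        show "child p ` {..<nchild c p} \<union> spine_child p \<subseteq> positions N c"
          using that(3) spine_child_subset[OF that(3)] by auto
      qed
      from inj_on_image_Int[OF this, of "child p ` {..<nchild c p}" "spine_child p"]
      have "\<phi> ` child p ` {..<nchild c p} \<inter> \<phi> ` spine_child p = {}"
        by (simp add: child_spine_child_disjoint)
      then show ?thesis unfolding follows_preimage[OF that] by blast
    qed
    have "\<phi> ` child p ` {..<nchild c p} = \<phi>' ` child p ` {..<nchild c' p}"
      unfolding *[OF lab(1) fol(1) p(1)] *[OF lab(2) fol(2) p(2)] p(3) sp ..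
    then show ?thesis
      using strict_mono_on_image_unique[OF srt(1)[OF p(1)] srt(2)[OF p(2)]] by (auto simp: image_image)
  qed
  \<comment> \<open>Levels of the attached trees: membership and labels on level l + 1 follow from
    those on level l and the offspring numbers there.\<close>
  have lev: "length (snd p) = l \<Longrightarrow> (p \<in> positions N c \<longleftrightarrow> p \<in> positions N c') \<and>
      (p \<in> positions N c \<longrightarrow> \<phi> p = \<phi>' p)" for l p
  proof (induction l arbitrary: p)
    case 0
    then show ?case using spine by (cases p) auto
  next
    case (Suc l)
    then obtain q j where p: "p = child q j" by (cases p rule: position_cases) auto
    then have "length (snd q) = l" using Suc.prems by (simp add: child_def)
    note IH = Suc.IH[OF this]
    have "q \<in> expanded N c \<longleftrightarrow> q \<in> expanded N c'" using IH by (auto simp: expanded_eq)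
    moreover have "\<phi> q = \<phi>' q" if "q \<in> expanded N c" using IH that by (simp add: expanded_eq)
    ultimately show ?case unfolding p using step[of q] by auto
  qed
  have pos: "positions N c = positions N c'" using lev by blast
  then show int: "expanded N c = expanded N c'" by (simp add: expanded_eq)
  show "nchild c p = nchild c' p" if "p \<in> expanded N c" for p
    using step[of p] that int lev[OF refl, of p] by (simp add: expanded_eq)
  show "\<phi> = \<phi>'"
  proof (rule PiE_ext)
    show "\<phi> \<in> positions N c \<rightarrow>\<^sub>E S" "\<phi>' \<in> positions N c \<rightarrow>\<^sub>E S"
      using lab pos by (auto simp: labelling_def)
  qed (use lev in auto)
qed

section \<open>Counting the parent maps with a given code\<close>

lemma exists_sorting_permutation:
  fixes f :: "nat \<Rightarrow> nat"
  assumes "inj_on f {..<a}"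
  shows "\<exists>\<sigma>. \<sigma> permutes {..<a} \<and> strict_mono_on {..<a} (\<lambda>j. f (\<sigma> j))"
proof -
  define ys where "ys = sorted_list_of_set (f ` {..<a})"
  have len: "length ys = a" and set: "set ys = f ` {..<a}" and srt: "sorted_wrt (<) ys"
    using assms by (simp_all add: ys_def card_image strict_sorted_list_of_set)
  define \<sigma> where "\<sigma> j = (if j < a then inv_into {..<a} f (ys ! j) else j)" for j
  have mem: "ys ! j \<in> f ` {..<a}" if "j < a" for j
    using that len set nth_mem[of j ys] by simp
  have f\<sigma>: "f (\<sigma> j) = ys ! j" and \<sigma>lt: "\<sigma> j < a" if "j < a" for j
    using that f_inv_into_f[OF mem[OF that]] inv_into_into[OF mem[OF that]] by (auto simp: \<sigma>_def)
  have mono: "strict_mono_on {..<a} (\<lambda>j. f (\<sigma> j))"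
    using sorted_wrt_nth_less[OF srt] len by (auto simp: strict_mono_on_def f\<sigma>)
  have inj: "inj_on \<sigma> {..<a}"
    using strict_mono_on_imp_inj_on[OF mono] by (auto simp: inj_on_def)
  have "\<sigma> ` {..<a} = {..<a}"
    using \<sigma>lt by (intro endo_inj_surj inj) auto
  then have "\<sigma> permutes {..<a}"
    using inj by (intro bij_imp_permutes) (auto simp: bij_betw_def \<sigma>_def)
  with mono show ?thesis by blast
qed

text \<open>Only the last letter of an address is permuted, so descendants keep their addresses and
  the permutations of different families can be inverted separately.\<close>

definition move :: "(nat \<times> nat list \<Rightarrow> nat \<Rightarrow> nat) \<Rightarrow> nat \<times> nat list \<Rightarrow> nat \<times> nat list" where
  "move \<rho> q = (if snd q = [] then q
    else child (fst q, butlast (snd q)) (\<rho> (fst q, butlast (snd q)) (last (snd q))))"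

lemma move_simps [simp]: "move \<rho> (i, []) = (i, [])" "move \<rho> (child p j) = child p (\<rho> p j)"
  by (simp_all add: move_def child_def)

lemma finite_labellings: "finite S \<Longrightarrow> finite {\<phi>. labelling N c S \<phi>}"
  by (rule finite_subset[of _ "positions N c \<rightarrow>\<^sub>E S"])
     (auto simp: labelling_def intro: finite_PiE)

text \<open>Sorting the labels within each family of siblings, without moving the subtrees, turns a
  labelling into a sorted one, and each sorted labelling arises from at most
  \<open>\<Prod>p. fact (nchild c p)\<close> labellings.\<close>

lemma card_labellings_le:
  assumes "finite S"
  shows "card {\<phi>. labelling N c S \<phi>} \<le>
    card {\<phi>. sorted_labelling N c S \<phi>} * (\<Prod>p\<in>expanded N c. fact (nchild c p))"
proof -
  define Perms where "Perms = (\<Pi>\<^sub>E p\<in>expanded N c. {\<sigma>. \<sigma> permutes {..<nchild c p}})"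
  define \<Phi> where "\<Phi> x = (\<lambda>q\<in>positions N c. (fst x) (move (snd x) q))"
    for x :: "(nat \<times> nat list \<Rightarrow> nat) \<times> (nat \<times> nat list \<Rightarrow> nat \<Rightarrow> nat)"
  have finP: "finite Perms" unfolding Perms_def
    by (intro finite_PiE finite_expanded finite_permutations) simp
  have "card Perms = (\<Prod>p\<in>expanded N c. card {\<sigma>. \<sigma> permutes {..<nchild c p}})"
    unfolding Perms_def by (rule card_PiE) simp
  then have cardP: "card Perms = (\<Prod>p\<in>expanded N c. fact (nchild c p))"
    by (simp add: card_permutations[OF refl])
  have finS: "finite {\<phi>. sorted_labelling N c S \<phi>}"
    by (rule finite_subset[OF _ finite_labellings[OF assms]]) (auto simp: sorted_labelling_def)
  have "{\<phi>. labelling N c S \<phi>} \<subseteq> \<Phi> ` ({\<phi>. sorted_labelling N c S \<phi>} \<times> Perms)"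
  proof safe
    fix \<phi> assume lab: "labelling N c S \<phi>"
    then have inj: "inj_on \<phi> (positions N c)" and PiE: "\<phi> \<in> positions N c \<rightarrow>\<^sub>E S"
      and root: "\<phi> (0, []) = 1"
      by (auto simp: labelling_def)
    have "\<exists>\<sigma>. \<sigma> permutes {..<nchild c p} \<and> strict_mono_on {..<nchild c p} (\<lambda>j. \<phi> (child p (\<sigma> j)))"
      if "p \<in> expanded N c" for p
    proof (rule exists_sorting_permutation, rule inj_onI)
      fix i j assume "i \<in> {..<nchild c p}" "j \<in> {..<nchild c p}" "\<phi> (child p i) = \<phi> (child p j)"
      then have "child p i = child p j" using that by (intro inj_onD[OF inj]) auto
      then show "i = j" by simp
    qed
    then obtain \<sigma> where \<sigma>: "\<And>p. p \<in> expanded N c \<Longrightarrow> \<sigma> p permutes {..<nchild c p}"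
      and mono: "\<And>p. p \<in> expanded N c \<Longrightarrow> strict_mono_on {..<nchild c p} (\<lambda>j. \<phi> (child p (\<sigma> p j)))"
      by metis
    have \<sigma>lt: "\<sigma> p j < nchild c p \<longleftrightarrow> j < nchild c p" if "p \<in> expanded N c" for p j
      using permutes_in_image[OF \<sigma>[OF that]] by simp
    have mv: "move \<sigma> q \<in> positions N c" if "q \<in> positions N c" for q
      using that \<sigma>lt by (cases q rule: position_cases) auto
    have mvinj: "inj_on (move \<sigma>) (positions N c)"
    proof (rule inj_onI)
      fix q q' assume q: "q \<in> positions N c" "q' \<in> positions N c" "move \<sigma> q = move \<sigma> q'"
      then show "q = q'"
        by (cases q rule: position_cases; cases q' rule: position_cases)
           (auto dest!: \<sigma> permutes_inj dest: injD)
    qed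
    define \<phi>' where "\<phi>' = (\<lambda>q\<in>positions N c. \<phi> (move \<sigma> q))"
    \<comment> \<open>The inverse permutations undo the sorting, so that \<Phi> recovers the
      original labelling.\<close>
    define \<rho> where "\<rho> = (\<lambda>p\<in>expanded N c. inv (\<sigma> p))"
    have "inj_on (\<phi> \<circ> move \<sigma>) (positions N c)"
      using mv by (intro comp_inj_on mvinj inj_on_subset[OF inj]) auto
    then have inj': "inj_on \<phi>' (positions N c)"
      by (subst inj_on_cong[of _ _ "\<phi> \<circ> move \<sigma>"]) (simp_all add: \<phi>'_def)
    have "\<phi>' \<in> positions N c \<rightarrow>\<^sub>E S" using mv PiE by (auto simp: \<phi>'_def)
    then have "labelling N c S \<phi>'" using inj' root by (simp add: labelling_def \<phi>'_def)
    moreover have "strict_mono_on {..<nchild c p} (\<lambda>j. \<phi>' (child p j))" if "p \<in> expanded N c" for p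
      using mono[OF that] that by (auto simp: strict_mono_on_def \<phi>'_def)
    ultimately have "sorted_labelling N c S \<phi>'" by (simp add: sorted_labelling_def)
    moreover have "\<rho> \<in> Perms" using \<sigma> by (auto simp: \<rho>_def Perms_def permutes_inv)
    moreover have "\<Phi> (\<phi>', \<rho>) = \<phi>"
    proof
      fix q show "\<Phi> (\<phi>', \<rho>) q = \<phi> q"
      proof (cases "q \<in> positions N c")
        case False
        then show ?thesis using PiE_arb[OF PiE False] by (simp add: \<Phi>_def)
      next
        case True
        show ?thesis
        proof (cases q rule: position_cases)
          case (1 i)
          then show ?thesis using True by (simp add: \<Phi>_def \<phi>'_def)
        next
          case (2 p j)
          then have p: "p \<in> expanded N c" "j < nchild c p" using True by auto
          have "\<sigma> p (inv (\<sigma> p) j) = j" using permutes_inverses(1)[OF \<sigma>[OF p(1)]] .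
          moreover from this have "inv (\<sigma> p) j < nchild c p" using \<sigma>lt[OF p(1)] p(2) by metis
          ultimately show ?thesis using p 2 by (simp add: \<Phi>_def \<phi>'_def \<rho>_def)
        qed
      qed
    qed
    ultimately show "\<phi> \<in> \<Phi> ` ({\<phi>. sorted_labelling N c S \<phi>} \<times> Perms)" by force
  qed
  then have "card {\<phi>. labelling N c S \<phi>} \<le> card (\<Phi> ` ({\<phi>. sorted_labelling N c S \<phi>} \<times> Perms))"
    using finS finP by (intro card_mono) auto
  also have "\<dots> \<le> card ({\<phi>. sorted_labelling N c S \<phi>} \<times> Perms)"
    using finS finP by (intro card_image_le) auto
  finally show ?thesis by (simp add: card_cartesian_product cardP)
qed

text \<open>The root must be sent to 1, and the other positions form an injection into
  \<open>S - {1}\<close>: a falling factorial.\<close>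

lemma card_labellings_ge:
  assumes "finite S" "1 \<in> S"
  shows "(\<Prod>i<card (positions N c) - 1. card S - 1 - i) \<le> card {\<phi>. labelling N c S \<phi>}"
proof -
  define B where "B = positions N c - {(0, [])}"
  define F where "F = {\<psi> \<in> B \<rightarrow>\<^sub>E S - {1}. inj_on \<psi> B}"
  have ins: "insert (0, []) B = positions N c" by (auto simp: B_def)
  have nB: "(0, []) \<notin> B" by (simp add: B_def)
  have "(\<Prod>i<card (positions N c) - 1. card S - 1 - i) = card F"
    using card_inj_on_subset_funcset[of B "S - {1}" B] assms
    by (simp add: F_def B_def atLeast0LessThan)
  also have "\<dots> \<le> card {\<phi>. labelling N c S \<phi>}"
  proof (rule card_inj_on_le[of "\<lambda>\<psi>. \<psi>((0, []) := 1)"])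
    show "inj_on (\<lambda>\<psi>. \<psi>((0, []) := 1)) F"
    proof (rule inj_onI)
      fix \<psi> \<psi>' assume F: "\<psi> \<in> F" "\<psi>' \<in> F" and eq: "\<psi>((0, []) := 1) = \<psi>'((0, []) := 1)"
      show "\<psi> = \<psi>'"
      proof
        fix q show "\<psi> q = \<psi>' q"
          using fun_cong[OF eq, of q] F nB
          by (cases "q = (0, [])") (auto simp: F_def PiE_def extensional_def)
      qed
    qed
    show "(\<lambda>\<psi>. \<psi>((0, []) := 1)) ` F \<subseteq> {\<phi>. labelling N c S \<phi>}"
    proof safe
      fix \<psi> assume \<psi>: "\<psi> \<in> F"
      then have "\<psi>((0, []) := 1) \<in> insert (0, []) B \<rightarrow>\<^sub>E S"
        using assms(2) by (auto simp: F_def PiE_def extensional_def Pi_def)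
      moreover have "inj_on (\<psi>((0, []) := 1)) (insert (0, []) B)"
      proof -
        have "inj_on (\<psi>((0, []) := 1)) B"
          using \<psi> nB by (subst inj_on_cong[of _ _ \<psi>]) (auto simp: F_def)
        moreover have "1 \<notin> (\<psi>((0, []) := 1)) ` B"
        proof
          assume "1 \<in> (\<psi>((0, []) := 1)) ` B"
          then obtain x where x: "x \<in> B" "(\<psi>((0, []) := 1)) x = 1" by (metis imageE)
          then have "\<psi> x = 1" using nB by (auto split: if_splits)
          moreover have "\<psi> x \<in> S - {1}" using \<psi> x(1) unfolding F_def by blast
          ultimately show False by simp
        qed
        ultimately show ?thesis using nB by simp
      qed
      ultimately show "labelling N c S (\<psi>((0, []) := 1))"
        unfolding ins by (simp add: labelling_def)
    qed
  qed (rule finite_labellings[OF assms(1)])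
  finally show ?thesis .
qed

context rooted_complete
begin

text \<open>All positions but \<open>(N, [])\<close> have a prescribed image. Every other vertex
  only has to avoid itself and the labels of expanded positions, which leaves at least n - 1 - q
  values.\<close>

lemma card_follows_ge:
  assumes lab: "labelling N c V \<phi>"
  shows "(n - 1 - card (expanded N c)) ^ (n - 1 - (card (positions N c) - 1)) \<le>
    card {g \<in> maps. follows N c V g \<phi>}"
proof -
  define T where "T = positions N c - {(N, [])}"
  define q where "q = card (expanded N c)"
  have inj: "inj_on \<phi> (positions N c)" and im: "\<And>p. p \<in> positions N c \<Longrightarrow> \<phi> p \<in> V"
    using lab by (auto simp: labelling_def)
  have injT: "inj_on \<phi> T" by (rule inj_on_subset[OF inj]) (auto simp: T_def)
  define F where "F v = (if v \<in> \<phi> ` T then {\<phi> (parent (the_inv_into T \<phi> v))} else {1..n} - {v} - \<phi> ` expanded N c)" for v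
  have F\<phi>: "F (\<phi> p) = {\<phi> (parent p)}" if "p \<in> T" for p
    using that the_inv_into_f_f[OF injT that] by (simp add: F_def)
  have par: "\<phi> (parent p) \<in> {1..n} - {\<phi> p}" if "p \<in> T" for p
  proof -
    have pp: "parent p \<in> positions N c" "p \<in> positions N c"
      using parent_in_positions that by (auto simp: T_def)
    \<comment> \<open>A prescribed value must not be a loop, for the map has to lie in
      \<open>maps\<close>.\<close>
    have "parent p \<noteq> p"
    proof
      assume "parent p = p"
      then have "snd p \<noteq> []" "butlast (snd p) = snd p"
        by (auto simp: parent_def prod_eq_iff split: if_splits)
      then show False by (metis append_butlast_last_id append_self_conv not_Cons_self2)
    qed
    then have "\<phi> (parent p) \<noteq> \<phi> p" using inj_onD[OF inj _ pp] by blast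
    then show ?thesis using im[OF pp(1)] by (auto simp: V_def)
  qed
  have "PiE V F \<subseteq> {g \<in> maps. follows N c V g \<phi>}"
  proof (rule subsetI)
    fix g assume g: "g \<in> PiE V F"
    have gF: "g v \<in> F v" if "v \<in> V" for v using g that by auto
    have "g v \<in> {1..n} - {v}" if "v \<in> V" for v
    proof (cases "v \<in> \<phi> ` T")
      case True
      then obtain p where "p \<in> T" "v = \<phi> p" by blast
      then show ?thesis using gF[OF that] F\<phi> par by simp
    next
      case False
      then show ?thesis using gF[OF that] by (simp add: F_def)
    qed
    then have "g \<in> maps" using g by (auto simp: PiE_def Pi_def)
    moreover have "follows N c V g \<phi>"
      unfolding follows_def T_def[symmetric]
    proof (intro conjI ballI impI)
      fix p assume p: "p \<in> T"
      then show "g (\<phi> p) = \<phi> (parent p)" using gF[OF im, of p] F\<phi>[OF p] by (auto simp: T_def)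
    next
      fix v assume "v \<in> V" "g v \<in> \<phi> ` expanded N c"
      then show "v \<in> \<phi> ` T" using gF[of v] by (auto simp: F_def split: if_splits)
    qed
    ultimately show "g \<in> {g \<in> maps. follows N c V g \<phi>}" by blast
  qed
  moreover have "finite {g \<in> maps. follows N c V g \<phi>}" using finite_maps by (rule rev_finite_subset) auto
  ultimately have "card (PiE V F) \<le> card {g \<in> maps. follows N c V g \<phi>}" by (intro card_mono)
  moreover have "(n - 1 - q) ^ (n - 1 - (card (positions N c) - 1)) \<le> card (PiE V F)"
  proof -
    have TV: "\<phi> ` T \<subseteq> V" using im by (auto simp: T_def)
    have "card (\<phi> ` T) = card (positions N c) - 1"
      by (simp add: card_image[OF injT]) (simp add: T_def)
    then have "card (V - \<phi> ` T) = n - 1 - (card (positions N c) - 1)"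
      using TV by (simp add: card_Diff_subset card_V finite_subset[OF TV])
    then have "(n - 1 - q) ^ (n - 1 - (card (positions N c) - 1)) = (\<Prod>v\<in>V - \<phi> ` T. n - 1 - q)"
      by simp
    also have "\<dots> = (\<Prod>v\<in>V. if v \<in> \<phi> ` T then 1 else n - 1 - q)"
      by (intro prod.mono_neutral_cong_left) auto
    also have "\<dots> \<le> (\<Prod>v\<in>V. card (F v))"
    proof (rule prod_mono)
      fix v assume v: "v \<in> V"
      have "n - 1 - q \<le> card ({1..n} - {v} - \<phi> ` expanded N c)"
      proof -
        have "n - 1 = card ({1..n} - {v})" using v by (simp add: V_def)
        moreover have "card (\<phi> ` expanded N c) \<le> q" unfolding q_def by (intro card_image_le) simp
        ultimately show ?thesis
          using diff_card_le_card_Diff[of "\<phi> ` expanded N c" "{1..n} - {v}"] by simp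
      qed
      then show "0 \<le> (if v \<in> \<phi> ` T then 1 else n - 1 - q) \<and>
          (if v \<in> \<phi> ` T then 1 else n - 1 - q) \<le> card (F v)" by (simp add: F_def)
    qed
    also have "\<dots> = card (PiE V F)" by (simp add: card_PiE)
    finally show ?thesis .
  qed
  ultimately show ?thesis unfolding q_def by linarith
qed

text \<open>Because a map determines its sorted labelling, the maps with this code are a disjoint
  union over sorted labellings; the factorials account for the orderings of siblings.\<close>

lemma prob_code_ge:
  defines "m \<equiv> \<lambda>N c. card (positions N c) - 1" and "q \<equiv> \<lambda>N c. card (expanded N c)"
  assumes "m N c \<le> n - 1" "q N c \<le> n - 1"
  shows "(\<Prod>i<m N c. real (n - 2 - i) / real (n - 1)) * (real (n - 1 - q N c) / real (n - 1)) ^ (n - 1)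
    / (\<Prod>p\<in>expanded N c. fact (nchild c p))
    \<le> Pr.prob {w \<in> space P. \<exists>\<phi>. encodes N c V (rowmin w) \<phi>}"
proof -
  let ?m = "m N c" and ?q = "q N c"
  define SL where "SL = {\<phi>. sorted_labelling N c V \<phi>}"
  define x where "x = real (n - 1)"
  define Fc where "Fc = (\<Prod>p\<in>expanded N c. fact (nchild c p) :: nat)"
  have x: "0 < x" using n_ge_2 by (simp add: x_def)
  have Fc: "0 < real Fc" by (simp add: Fc_def prod_pos)
  have finSL: "finite SL"
    unfolding SL_def by (rule finite_subset[OF _ finite_labellings[OF finite_V]]) (auto simp: sorted_labelling_def)
  define C where "C = (\<Union>\<phi>\<in>SL. {g \<in> maps. follows N c V g \<phi>})"
  have C_eq: "C = {g \<in> maps. \<exists>\<phi>. encodes N c V g \<phi>}"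
    by (auto simp: C_def SL_def encodes_def)
  have "card C = (\<Sum>\<phi>\<in>SL. card {g \<in> maps. follows N c V g \<phi>})"
    unfolding C_def
  proof (rule card_UN_disjoint[OF finSL])
    show "\<forall>\<phi>\<in>SL. finite {g \<in> maps. follows N c V g \<phi>}"
      using finite_maps by (auto intro: rev_finite_subset)
    show "\<forall>\<phi>\<in>SL. \<forall>\<phi>'\<in>SL. \<phi> \<noteq> \<phi>' \<longrightarrow>
        {g \<in> maps. follows N c V g \<phi>} \<inter> {g \<in> maps. follows N c V g \<phi>'} = {}"
      using encodes_unique(3) unfolding encodes_def SL_def by blast
  qed
  also have "\<dots> \<ge> (\<Sum>\<phi>\<in>SL. (n - 1 - ?q) ^ (n - 1 - ?m))"
    unfolding m_def q_def by (intro sum_mono card_follows_ge) (simp add: SL_def sorted_labelling_def)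
  finally have "card SL * (n - 1 - ?q) ^ (n - 1 - ?m) \<le> card C" by simp
  then have "Fc * (card SL * (n - 1 - ?q) ^ (n - 1 - ?m)) \<le> Fc * card C" by (rule mult_le_mono2)
  moreover have "(\<Prod>i<?m. n - 2 - i) \<le> card SL * Fc"
    using order_trans[OF card_labellings_ge[OF finite_V one_in_V] card_labellings_le[OF finite_V]]
    unfolding SL_def Fc_def m_def card_V by (simp add: diff_diff_left)
  then have "(\<Prod>i<?m. n - 2 - i) * (n - 1 - ?q) ^ (n - 1 - ?m) \<le> card SL * Fc * (n - 1 - ?q) ^ (n - 1 - ?m)"
    by (rule mult_le_mono1)
  ultimately have le: "(\<Prod>i<?m. n - 2 - i) * (n - 1 - ?q) ^ (n - 1 - ?m) \<le> Fc * card C"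
    unfolding mult.assoc mult.left_commute[of Fc] by linarith
  define y where "y = real (n - 1 - ?q)"
  have y: "0 \<le> y" "y \<le> x" by (auto simp: x_def y_def)
  \<comment> \<open>As y / x is at most 1, raising the exponent to n - 1 only lowers the bound, and
    gives it the form (1 - q / x)^x with limit exp (- q).\<close>
  have "(\<Prod>i<?m. real (n - 2 - i) / x) * (y / x) ^ (n - 1)
      \<le> (\<Prod>i<?m. real (n - 2 - i) / x) * (y / x) ^ (n - 1 - ?m)"
    using x y by (intro mult_left_mono power_decreasing prod_nonneg) auto
  also have "\<dots> = (\<Prod>i<?m. real (n - 2 - i)) * y ^ (n - 1 - ?m) / x ^ (n - 1)"
  proof -
    have e: "?m + (n - 1 - ?m) = n - 1" using assms(3) by simp
    have "x ^ (n - 1) = x ^ ?m * x ^ (n - 1 - ?m)" by (simp only: power_add[symmetric] e)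
    then show ?thesis by (simp add: prod_dividef power_divide)
  qed
  also have "\<dots> \<le> (real Fc * real (card C)) / x ^ (n - 1)"
  proof (rule divide_right_mono)
    show "(\<Prod>i<?m. real (n - 2 - i)) * y ^ (n - 1 - ?m) \<le> real Fc * real (card C)"
      using of_nat_mono[OF le, where ?'a = real] by (simp only: y_def of_nat_mult of_nat_power of_nat_prod)
  qed (use x in simp)
  also have "\<dots> = Fc * (card C / x ^ (n - 1))" by simp
  also have "card C / x ^ (n - 1) = Pr.prob {w \<in> space P. rowmin w \<in> C}"
    unfolding x_def by (rule prob_rowmin[symmetric]) (auto simp: C_eq)
  also have "{w \<in> space P. rowmin w \<in> C} = {w \<in> space P. \<exists>\<phi>. encodes N c V (rowmin w) \<phi>}"
    using rowmin_in_maps by (auto simp: C_eq)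
  finally have "(\<Prod>i<?m. real (n - 2 - i) / x) * (y / x) ^ (n - 1)
      \<le> real Fc * Pr.prob {w \<in> space P. \<exists>\<phi>. encodes N c V (rowmin w) \<phi>}" .
  then have "(\<Prod>i<?m. real (n - 2 - i) / x) * (y / x) ^ (n - 1) / real Fc
      \<le> Pr.prob {w \<in> space P. \<exists>\<phi>. encodes N c V (rowmin w) \<phi>}"
    by (subst pos_divide_le_eq[OF Fc]) (simp only: mult.commute)
  then show ?thesis by (simp add: x_def y_def Fc_def)
qed

end

lemma code_prob_lower_bound_tendsto:
  "(\<lambda>n. (\<Prod>i<m. real (n - 2 - i) / real (n - 1)) * (real (n - 1 - q) / real (n - 1)) ^ (n - 1) / F)
    \<longlonglongrightarrow> exp (- real q) / F"
proof -
  have 1: "(\<lambda>n. \<Prod>i<m. real (n - 2 - i) / real (n - 1)) \<longlonglongrightarrow> (\<Prod>i<m. 1)"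
  proof (rule tendsto_prod)
    fix i
    have "(\<lambda>n. (real n - 2 - real i) / (real n - 1)) \<longlonglongrightarrow> 1" by real_asymp
    then show "(\<lambda>n. real (n - 2 - i) / real (n - 1)) \<longlonglongrightarrow> 1"
    proof (rule Lim_transform_eventually)
      show "\<forall>\<^sub>F n in sequentially. (real n - 2 - real i) / (real n - 1) = real (n - 2 - i) / real (n - 1)"
        using eventually_ge_at_top[of "i + 3"] by eventually_elim (simp add: of_nat_diff)
    qed
  qed
  have "(\<lambda>n. (1 + (- real q) / real n) ^ n) \<longlonglongrightarrow> exp (- real q)"
    by (rule tendsto_exp_limit_sequentially)
  then have "(\<lambda>n. (real (n - q) / real n) ^ n) \<longlonglongrightarrow> exp (- real q)"
  proof (rule Lim_transform_eventually)
    show "\<forall>\<^sub>F n in sequentially. (1 + (- real q) / real n) ^ n = (real (n - q) / real n) ^ n"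
      using eventually_ge_at_top[of "q + 1"] by eventually_elim (simp add: of_nat_diff field_simps)
  qed
  moreover have "filterlim (\<lambda>n::nat. n - 1) sequentially sequentially"
    by (rule filterlim_minus_const_nat_at_top)
  ultimately have 2: "(\<lambda>n. (real (n - 1 - q) / real (n - 1)) ^ (n - 1)) \<longlonglongrightarrow> exp (- real q)"
    by (rule filterlim_compose)
  show ?thesis
    using tendsto_mult_right[OF tendsto_mult[OF 1 2], of "1 / F"] by simp
qed

section \<open>Balls determined by codes\<close>

text \<open>The distance from the root in the spine tree: along the path, and from there into the
  attached tree.\<close>

definition depth :: "nat \<times> nat list \<Rightarrow> nat" where
  "depth p = fst p + length (snd p)"

lemma depth_child [simp]: "depth (child p j) = Suc (depth p)"
  by (simp add: depth_def child_def)

lemma depth_spine [simp]: "depth (i, []) = i"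
  by (simp add: depth_def)

lemma depth_parent_le: "depth (parent p) \<le> Suc (depth p)" "depth p \<le> Suc (depth (parent p))"
  by (cases p rule: position_cases; simp)+

lemma depth_lt_expanded: "p \<in> positions N c \<Longrightarrow> depth p < N \<Longrightarrow> p \<in> expanded N c"
  by (auto simp: expanded_eq depth_def)

lemma child_in_expanded [simp]:
  "child p j \<in> expanded N c \<longleftrightarrow> p \<in> expanded N c \<and> Suc (length (snd p)) < N \<and> j < nchild c p"
  by (cases p) (auto simp: expanded_def child_def nchild_def)

lemma spine_tree_verts: "p \<in> pverts (spine_tree c) \<longleftrightarrow> snd p \<in> gw_tree (c (fst p))"
  by (cases p) (simp add: spine_tree_def)

lemma spine_tree_vert_simps [simp]:
  "(i, []) \<in> pverts (spine_tree c)"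
  "child p j \<in> pverts (spine_tree c) \<longleftrightarrow> p \<in> pverts (spine_tree c) \<and> j < nchild c p"
  by (simp_all add: spine_tree_verts child_def nchild_def)

lemma spine_tree_arcs: "parcs (spine_tree c) = fgraph (pverts (spine_tree c)) parent"
proof -
  have "(p, q) \<in> parcs (spine_tree c) \<longleftrightarrow> p \<in> pverts (spine_tree c) \<and> q = parent p" for p q
  proof (cases p rule: position_cases)
    case (1 i)
    then show ?thesis by (auto simp: spine_tree_def)
  next
    case (2 p' j)
    then show ?thesis by (cases p') (auto simp: spine_tree_def child_def parent_def)
  qed
  then show ?thesis by (intro set_eqI) (metis mem_fgraph_iff surj_pair)
qed

lemma pair_wf_spine_tree: "pair_wf_digraph (spine_tree c)"
proof
  have "parent p \<in> pverts (spine_tree c)" if "p \<in> pverts (spine_tree c)" for p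
    using that by (cases p rule: position_cases) auto
  then show "fst e \<in> pverts (spine_tree c)" "snd e \<in> pverts (spine_tree c)"
    if "e \<in> parcs (spine_tree c)" for e
    using that unfolding spine_tree_arcs by (cases e; auto)+
qed

lemma spine_tree_in_neighbours:
  assumes "p \<in> pverts (spine_tree c)"
  shows "(parcs (spine_tree c))\<inverse> `` {p} = child p ` {..<nchild c p} \<union> spine_child p"
proof -
  have "(parcs (spine_tree c))\<inverse> `` {p} = {q \<in> pverts (spine_tree c). parent q = p}"
    unfolding spine_tree_arcs by auto
  also have "\<dots> = child p ` {..<nchild c p} \<union> spine_child p"
    unfolding parent_eq_iff using assms by (auto simp: spine_child_def)
  finally show ?thesis .
qed

lemma spine_tree_out_neighbours:
  assumes "p \<in> pverts (spine_tree c)"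
  shows "parcs (spine_tree c) `` {p} = {parent p}"
  unfolding spine_tree_arcs using assms by auto

lemma spine_tree_nbhd_depth:
  "p \<in> nbhd (parcs (spine_tree c)) (0, []) j \<Longrightarrow> p \<in> pverts (spine_tree c) \<and> depth p \<le> j"
proof (induction j arbitrary: p)
  case (Suc j)
  interpret pair_wf_digraph "spine_tree c" by (rule pair_wf_spine_tree)
  show ?case
  proof (cases "p \<in> nbhd (parcs (spine_tree c)) (0, []) j")
    case True
    then show ?thesis using Suc.IH[of p] by simp
  next
    case False
    then obtain q where q: "q \<in> nbhd (parcs (spine_tree c)) (0, []) j"
      "(q, p) \<in> parcs (spine_tree c) \<or> (p, q) \<in> parcs (spine_tree c)"
      using Suc.prems by auto
    then have "p = parent q \<or> q = parent p" unfolding spine_tree_arcs by auto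
    then have "depth p \<le> Suc (depth q)" using depth_parent_le[of q] depth_parent_le[of p] by auto
    moreover have "p \<in> pverts (spine_tree c)" using q(2) in_arcsD1 in_arcsD2 by blast
    ultimately show ?thesis using Suc.IH[OF q(1)] by simp
  qed
qed simp

lemma expanded_subset_verts: "expanded N c \<subseteq> pverts (spine_tree c)"
  by (auto simp: expanded_def spine_tree_def)

text \<open>Neighbourhoods are compared only up to depth floor r, where the minimum arborescence can
  be controlled. The lemma serves twice: for the arborescence, and for a tree compared with its own
  truncation.\<close>

lemma rooted_ball_iso_of_code:
  assumes wf: "pair_wf_digraph G" and root: "\<phi> (0, []) \<in> pverts G"
    and inj: "inj_on \<phi> (positions N c)" and r: "0 \<le> r" "nat \<lfloor>r\<rfloor> < N"
    and out: "\<And>p. p \<in> expanded N c \<Longrightarrow> depth p \<le> nat \<lfloor>r\<rfloor> \<Longrightarrow> parcs G `` {\<phi> p} = {\<phi> (parent p)}"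
    and inn: "\<And>p. p \<in> expanded N c \<Longrightarrow> depth p \<le> nat \<lfloor>r\<rfloor> \<Longrightarrow>
      (parcs G)\<inverse> `` {\<phi> p} = \<phi> ` (child p ` {..<nchild c p} \<union> spine_child p)"
  shows "(rooted_ball (with_proj (spine_tree c)) (0, []) r, (0, [])) \<simeq>\<^sub>r (with_proj H, u) \<longleftrightarrow>
    (rooted_ball (with_proj G) (\<phi> (0, [])) r, \<phi> (0, [])) \<simeq>\<^sub>r (with_proj H, u)"
proof -
  have ball: "p \<in> expanded N c \<and> depth p \<le> nat \<lfloor>r\<rfloor>"
    if "p \<in> nbhd (parcs (spine_tree c)) (0, []) (nat \<lfloor>r\<rfloor>)" for p
    using spine_tree_nbhd_depth[OF that] r(2)
    by (cases p) (auto simp: expanded_def depth_def spine_tree_def)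
  have vert: "p \<in> pverts (spine_tree c)" if "p \<in> expanded N c" for p
    using that expanded_subset_verts by blast
  show ?thesis
  proof (rule rooted_ball_iso_cong[OF pair_wf_spine_tree wf _ root r(1) inj])
    show "nbhd (parcs (spine_tree c)) (0, []) (nat \<lfloor>r\<rfloor>) \<subseteq> positions N c"
      using ball expanded_subset by blast
  next
    fix p assume "p \<in> nbhd (parcs (spine_tree c)) (0, []) (nat \<lfloor>r\<rfloor>)"
    from ball[OF this] have p: "p \<in> expanded N c" "depth p \<le> nat \<lfloor>r\<rfloor>" by auto
    then have "parent p \<in> positions N c" using expanded_subset parent_in_positions by blast
    then show "parcs (spine_tree c) `` {p} \<subseteq> positions N c"
      by (simp add: spine_tree_out_neighbours vert p)
    show "parcs G `` {\<phi> p} = \<phi> ` parcs (spine_tree c) `` {p}"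
      using out[OF p] by (simp add: spine_tree_out_neighbours vert p)
    show "(parcs (spine_tree c))\<inverse> `` {p} \<subseteq> positions N c"
      unfolding spine_tree_in_neighbours[OF vert[OF p(1)]] using spine_child_subset[OF p(1)] p(1) by auto
    show "(parcs G)\<inverse> `` {\<phi> p} = \<phi> ` (parcs (spine_tree c))\<inverse> `` {p}"
      unfolding spine_tree_in_neighbours[OF vert[OF p(1)]] by (rule inn[OF p])
  qed simp
qed

text \<open>Vertices of depth below N are expanded, so each further step of the ball stays within
  the labels. This bounds the size of the ball of radius 2k that enters \<open>bad\<close>.\<close>

lemma encodes_nbhd:
  assumes enc: "encodes N c S g \<phi>" and "j \<le> N"
  shows "nbhd (fgraph S g) 1 j \<subseteq> \<phi> ` positions N c"
proof -
  have lab: "labelling N c S \<phi>" and fol: "follows N c S g \<phi>"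
    using enc by (auto simp: encodes_def sorted_labelling_def)
  have "nbhd (fgraph S g) 1 j \<subseteq> \<phi> ` {p \<in> positions N c. depth p \<le> j}"
    using assms(2)
  proof (induction j)
    case 0
    then show ?case using lab by (auto simp: labelling_def intro!: rev_image_eqI[of "(0, [])"])
  next
    case (Suc j)
    have "(fgraph S g \<union> (fgraph S g)\<inverse>) `` \<phi> ` {p \<in> positions N c. depth p \<le> j}
      \<subseteq> \<phi> ` {p \<in> positions N c. depth p \<le> Suc j}"
    proof
      fix y assume "y \<in> (fgraph S g \<union> (fgraph S g)\<inverse>) `` \<phi> ` {p \<in> positions N c. depth p \<le> j}"
      then obtain p where p: "p \<in> positions N c" "depth p \<le> j"
        and y: "(\<phi> p, y) \<in> fgraph S g \<or> (y, \<phi> p) \<in> fgraph S g" by auto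
      have pe: "p \<in> expanded N c" using p Suc.prems by (intro depth_lt_expanded) auto
      then have pt: "p \<in> positions N c - {(N, [])}" using expanded_subset by blast
      show "y \<in> \<phi> ` {p \<in> positions N c. depth p \<le> Suc j}"
        using y
      proof
        assume "(\<phi> p, y) \<in> fgraph S g"
        then have "y = \<phi> (parent p)" using fol pt by (auto simp: follows_def)
        moreover have "depth (parent p) \<le> Suc j" using depth_parent_le(1)[of p] p(2) by simp
        ultimately show ?thesis using parent_in_positions[OF pt] by blast
      next
        assume "(y, \<phi> p) \<in> fgraph S g"
        then have "y \<in> {v \<in> S. g v = \<phi> p}" by simp
        then obtain q where q: "q \<in> child p ` {..<nchild c p} \<union> spine_child p" "y = \<phi> q"
          unfolding follows_preimage[OF lab fol pe] by blast
        have "q \<in> positions N c" using q(1) pe spine_child_subset[OF pe] by auto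
        moreover have "parent q = p" using q(1) unfolding parent_eq_iff by auto
        then have "depth q \<le> Suc j" using depth_parent_le(2)[of q] p(2) by simp
        ultimately show ?thesis using q(2) by blast
      qed
    qed
    moreover have "nbhd (fgraph S g) 1 j \<subseteq> \<phi> ` {p \<in> positions N c. depth p \<le> j}" using Suc by simp
    moreover have "\<phi> ` {p \<in> positions N c. depth p \<le> j} \<subseteq> \<phi> ` {p \<in> positions N c. depth p \<le> Suc j}"
      by auto
    ultimately show ?case
      unfolding nbhd.simps by (meson Image_mono Un_least order_refl order_trans)
  qed
  then show ?thesis by blast
qed

text \<open>The converse inclusion: labels of small depth are close to 1, hence away from the
  changed arcs when 1 is not bad.\<close>

lemma encodes_in_nbhd:
  assumes enc: "encodes N c S g \<phi>" and "p \<in> positions N c"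
  shows "\<phi> p \<in> nbhd (fgraph S g) 1 (depth p)"
proof -
  have lab: "labelling N c S \<phi>" and fol: "follows N c S g \<phi>"
    using enc by (auto simp: encodes_def sorted_labelling_def)
  have adj: "\<phi> p \<in> S \<and> g (\<phi> p) = \<phi> (parent p)" if "p \<in> positions N c - {(N, [])}" for p
    using that lab fol by (auto simp: labelling_def follows_def)
  have spine: "\<phi> (i, []) \<in> nbhd (fgraph S g) 1 i" if "i \<le> N" for i
    using that
  proof (induction i)
    case 0
    then show ?case using lab by (simp add: labelling_def)
  next
    case (Suc i)
    then have "(\<phi> (i, []), \<phi> (Suc i, [])) \<in> fgraph S g" using adj[of "(i, [])"] by simp
    moreover have "\<phi> (i, []) \<in> nbhd (fgraph S g) 1 i" using Suc by simp
    ultimately show ?case unfolding nbhd.simps by blast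
  qed
  have "\<phi> p \<in> nbhd (fgraph S g) 1 (depth p)" if "length (snd p) = l" "p \<in> positions N c" for l p
    using that
  proof (induction l arbitrary: p)
    case 0
    then show ?case using spine by (cases p) auto
  next
    case (Suc l)
    then obtain q j where q: "p = child q j" by (cases p rule: position_cases) auto
    then have "\<phi> q \<in> nbhd (fgraph S g) 1 (depth q)"
    proof (intro Suc.IH)
      show "length (snd q) = l" using Suc.prems(1) by (simp add: q child_def)
      show "q \<in> positions N c" using Suc.prems(2) expanded_subset[of N c] by (auto simp: q)
    qed
    moreover have "(\<phi> q, \<phi> p) \<in> (fgraph S g)\<inverse>" using adj[of p] Suc.prems q by simp
    ultimately show ?case unfolding q depth_child nbhd.simps by blast
  qed
  then show ?thesis using assms(2) by blast
qed

context rooted_complete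
begin

text \<open>The code bounds the ball of radius 2k, so if 1 is not bad no changed arc touches the
  ball of radius k, and there both graphs have the same in- and out-neighbours. The choice N = 2k +
  1 covers radius 2k and keeps k < N even for k = 0.\<close>

lemma rooted_ball_iso_min_arborescence:
  assumes enc: "encodes N c V (rowmin w) \<phi>" and r: "0 \<le> r" and N: "N = 2 * nat \<lfloor>r\<rfloor> + 1"
    and m: "card (positions N c) \<le> m" and good: "\<not> bad m (nat \<lfloor>r\<rfloor>) 1 (rmin w) (mina w)"
  shows "(rooted_ball (with_proj (min_arborescence n d w)) 1 r, 1) \<simeq>\<^sub>r (with_proj H, u) \<longleftrightarrow>
    (rooted_ball (with_proj (spine_tree c)) (0, []) r, (0, [])) \<simeq>\<^sub>r (with_proj H, u)"
proof -
  define k where "k = nat \<lfloor>r\<rfloor>"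
  have lab: "labelling N c V \<phi>" and fol: "follows N c V (rowmin w) \<phi>"
    using enc by (auto simp: encodes_def sorted_labelling_def)
  have \<phi>0: "\<phi> (0, []) = 1" and inj: "inj_on \<phi> (positions N c)"
    and im: "\<And>p. p \<in> positions N c \<Longrightarrow> \<phi> p \<in> V"
    using lab by (auto simp: labelling_def)
  have "card (nbhd (rmin w) 1 (2 * k)) \<le> card (\<phi> ` positions N c)"
    unfolding rmin_def using N by (intro card_mono encodes_nbhd[OF enc]) (auto simp: k_def)
  also have "\<dots> \<le> card (positions N c)" by (intro card_image_le) simp
  finally have "card (nbhd (rmin w) 1 (2 * k)) \<le> m" using m by simp
  then have disj: "nbhd (rmin w) 1 k \<inter> Field ((rmin w - mina w) \<union> (mina w - rmin w)) = {}"
    using good by (simp add: bad_def k_def)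
  have same: "(x, y) \<in> mina w \<longleftrightarrow> (x, y) \<in> rmin w" if "x \<in> nbhd (rmin w) 1 k \<or> y \<in> nbhd (rmin w) 1 k" for x y
    using disj that by (auto simp: Field_def)
  have nb: "\<phi> p \<in> nbhd (rmin w) 1 k" if "p \<in> expanded N c" "depth p \<le> k" for p
  proof -
    have "p \<in> positions N c" using that(1) expanded_subset by blast
    from encodes_in_nbhd[OF enc this] nbhd_mono[OF that(2)] show ?thesis
      unfolding rmin_def by (rule rev_subsetD)
  qed
  have G: "min_arborescence n d w = \<lparr> pverts = {1..n}, parcs = mina w \<rparr>"
    by (simp add: mina_def min_arborescence_def)
  have "pair_wf_digraph (min_arborescence n d w)"
    unfolding G using spanning_subset[OF mina_props(1)[of w]] by unfold_locales (auto simp: E_eq)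
  moreover have "\<phi> (0, []) \<in> pverts (min_arborescence n d w)"
    using n_ge_2 by (simp add: G \<phi>0)
  moreover have "parcs (min_arborescence n d w) `` {\<phi> p} = {\<phi> (parent p)}"
    if p: "p \<in> expanded N c" "depth p \<le> nat \<lfloor>r\<rfloor>" for p
  proof -
    have pt: "p \<in> positions N c - {(N, [])}" using p expanded_subset by blast
    have "parcs (min_arborescence n d w) `` {\<phi> p} = rmin w `` {\<phi> p}"
      using same nb[of p] p by (auto simp: G k_def)
    also have "\<dots> = {\<phi> (parent p)}"
      using pt fol im[of p] by (auto simp: rmin_def follows_def)
    finally show ?thesis .
  qed
  moreover have "(parcs (min_arborescence n d w))\<inverse> `` {\<phi> p} =
      \<phi> ` (child p ` {..<nchild c p} \<union> spine_child p)"
    if p: "p \<in> expanded N c" "depth p \<le> nat \<lfloor>r\<rfloor>" for p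
  proof -
    have "(parcs (min_arborescence n d w))\<inverse> `` {\<phi> p} = (rmin w)\<inverse> `` {\<phi> p}"
      using same nb[of p] p by (auto simp: G k_def)
    also have "\<dots> = {v \<in> V. rowmin w v = \<phi> p}" by (auto simp: rmin_def)
    finally show ?thesis unfolding follows_preimage[OF lab fol p(1)] .
  qed
  ultimately show ?thesis
    using rooted_ball_iso_of_code[of "min_arborescence n d w" \<phi> N c r H u] inj r N by (simp add: \<phi>0)
qed

end

section \<open>The code of the limiting tree\<close>

text \<open>Offspring numbers beyond the piece are reset to 0. The fixed points of
  \<open>code N\<close> are the canonical representatives, one for each finite piece.\<close>

definition code :: "nat \<Rightarrow> (nat \<Rightarrow> nat list \<Rightarrow> nat) \<Rightarrow> nat \<Rightarrow> nat list \<Rightarrow> nat" where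
  "code N c = (\<lambda>i xs. if (i, xs) \<in> expanded N c then c i xs else 0)"

lemma expanded_cong:
  assumes "\<And>p. p \<in> expanded N c \<Longrightarrow> nchild c p = nchild c' p"
  shows "expanded N c = expanded N c'"
proof -
  have "p \<in> expanded N c \<longleftrightarrow> p \<in> expanded N c'" if "length (snd p) = l" for p l
    using that
  proof (induction l arbitrary: p)
    case 0
    then show ?case by (cases p) auto
  next
    case (Suc l)
    then obtain q j where q: "p = child q j" by (cases p rule: position_cases) auto
    then have "q \<in> expanded N c \<longleftrightarrow> q \<in> expanded N c'"
      using Suc.prems by (intro Suc.IH) (simp add: child_def)
    then show ?case unfolding q using assms[of q] by auto
  qed
  then show ?thesis by blast
qed

lemma nchild_code: "p \<in> expanded N c \<Longrightarrow> nchild (code N c) p = nchild c p"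
  by (simp add: nchild_def code_def)

lemma expanded_code [simp]: "expanded N (code N c) = expanded N c"
  by (rule expanded_cong[symmetric]) (simp add: nchild_code)

lemma code_code [simp]: "code N (code N c) = code N c"
  using expanded_code[of N c] by (subst code_def) (auto simp: code_def fun_eq_iff)

lemma code_eqI:
  assumes "expanded N c = expanded N c'" "\<And>p. p \<in> expanded N c \<Longrightarrow> nchild c p = nchild c' p"
  shows "code N c = code N c'"
  using assms by (auto simp: code_def fun_eq_iff nchild_def)

text \<open>To have a given code is a condition on finitely many offspring numbers, whose index set
  depends on the target \<open>c\<close> and not on \<open>x\<close>; this makes independence
  applicable.\<close>

lemma code_eq_iff:
  assumes "code N c = c"
  shows "code N x = c \<longleftrightarrow> (\<forall>p\<in>expanded N c. nchild x p = nchild c p)"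
proof
  assume *: "code N x = c"
  then have "expanded N c = expanded N x" by auto
  with * show "\<forall>p\<in>expanded N c. nchild x p = nchild c p" using nchild_code[of _ N x] by auto
next
  assume *: "\<forall>p\<in>expanded N c. nchild x p = nchild c p"
  have "expanded N c = expanded N x" by (rule expanded_cong) (use * in simp)
  then have "code N x = code N c" using * by (intro code_eqI) auto
  then show "code N x = c" using assms by simp
qed

text \<open>The identity labels the truncated tree inside the full one, and all neighbourhoods up to
  depth floor r agree.\<close>

lemma rooted_ball_iso_code:
  assumes "0 \<le> r" "nat \<lfloor>r\<rfloor> < N"
  shows "(rooted_ball (with_proj (spine_tree (code N c))) (0, []) r, (0, [])) \<simeq>\<^sub>r (with_proj H, u) \<longleftrightarrow>
    (rooted_ball (with_proj (spine_tree c)) (0, []) r, (0, [])) \<simeq>\<^sub>r (with_proj H, u)"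
proof -
  have v: "p \<in> pverts (spine_tree c)" if "p \<in> expanded N (code N c)" for p
    using that expanded_subset_verts[of N c] by auto
  show ?thesis
    using rooted_ball_iso_of_code[of "spine_tree c" "\<lambda>p. p" N "code N c" r H u] assms
      pair_wf_spine_tree[of c] spine_tree_out_neighbours[OF v] spine_tree_in_neighbours[OF v]
    by (simp add: nchild_code)
qed

text \<open>Finite sets that exhaust the codes as \<open>M\<close> grows; they give measurability
  and reduce the limit law to finitely many codes.\<close>

definition bounded_codes :: "nat \<Rightarrow> nat \<Rightarrow> (nat \<Rightarrow> nat list \<Rightarrow> nat) set" where
  "bounded_codes N M = {c. code N c = c \<and> (\<forall>i xs. c i xs \<le> M)}"

lemma finite_bounded_codes: "finite (bounded_codes N M)"
proof -
  define B where "B = {..<N} \<times> {xs. set xs \<subseteq> {..<M} \<and> length xs \<le> N}"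
  have finB: "finite B" unfolding B_def by (intro finite_cartesian_product finite_lists_length_le) auto
  have "bounded_codes N M \<subseteq> (\<lambda>f i xs. if (i, xs) \<in> B then f (i, xs) else 0) ` (B \<rightarrow>\<^sub>E {..M})"
  proof
    fix c assume c: "c \<in> bounded_codes N M"
    have "(i, xs) \<in> B" if "(i, xs) \<in> expanded N c" for i xs
    proof -
      have "x < M" if x: "x \<in> set xs" for x
      proof -
        obtain ys zs where "xs = ys @ x # zs" using x by (auto simp: in_set_conv_decomp)
        then have "x < c i ys" using \<open>(i, xs) \<in> expanded N c\<close> by (auto simp: expanded_def gw_tree_def)
        also have "\<dots> \<le> M" using c by (simp add: bounded_codes_def)
        finally show ?thesis .
      qed
      then show ?thesis using that by (auto simp: B_def expanded_def)
    qed
    moreover have "c = code N c" using c by (simp add: bounded_codes_def)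
    then have z: "c i xs = 0" if "(i, xs) \<notin> expanded N c" for i xs
      using that fun_cong[OF fun_cong[OF \<open>c = code N c\<close>], of i xs] unfolding code_def
      by presburger
    ultimately have "c = (\<lambda>i xs. if (i, xs) \<in> B then (\<lambda>p\<in>B. c (fst p) (snd p)) (i, xs) else 0)"
      by (fastforce simp: fun_eq_iff)
    moreover have "(\<lambda>p\<in>B. c (fst p) (snd p)) \<in> B \<rightarrow>\<^sub>E {..M}" using c by (auto simp: bounded_codes_def)
    ultimately show "c \<in> (\<lambda>f i xs. if (i, xs) \<in> B then f (i, xs) else 0) ` (B \<rightarrow>\<^sub>E {..M})" by blast
  qed
  moreover have "finite (B \<rightarrow>\<^sub>E {..M})" by (intro finite_PiE finB) simp
  ultimately show ?thesis by (meson finite_imageI finite_subset)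
qed

lemma code_in_bounded_codes: "\<exists>M. code N c \<in> bounded_codes N M"
proof -
  define M where "M = (\<Sum>p\<in>expanded N c. nchild c p)"
  have "code N c i xs \<le> M" for i xs
  proof (cases "(i, xs) \<in> expanded N c")
    case True
    then have "nchild c (i, xs) \<le> M" unfolding M_def by (intro member_le_sum) auto
    then show ?thesis by (simp add: code_def nchild_def)
  qed (simp add: code_def)
  then show ?thesis unfolding bounded_codes_def by auto
qed

lemma bounded_codes_mono: "M \<le> M' \<Longrightarrow> bounded_codes N M \<subseteq> bounded_codes N M'"
  by (auto simp: bounded_codes_def intro: le_trans)

text \<open>The product of the Poisson weights exp (-1) / c! over the expanded vertices, which is
  also the limit of the lower bound in \<open>prob_code_ge\<close>.\<close>

definition code_prob :: "nat \<Rightarrow> (nat \<Rightarrow> nat list \<Rightarrow> nat) \<Rightarrow> real" where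
  "code_prob N c = exp (- real (card (expanded N c))) / (\<Prod>p\<in>expanded N c. fact (nchild c p))"

locale poisson_tree = prob_space Q for Q :: "'q measure" +
  fixes X :: "nat \<Rightarrow> nat list \<Rightarrow> 'q \<Rightarrow> nat"
  assumes indep: "indep_vars (\<lambda>_. count_space UNIV) (\<lambda>(i, xs). X i xs) UNIV"
    and poisson: "\<And>i xs. distr Q (count_space UNIV) (X i xs) = measure_pmf (poisson_pmf 1)"
begin

abbreviation tree_code :: "nat \<Rightarrow> 'q \<Rightarrow> nat \<Rightarrow> nat list \<Rightarrow> nat" where
  "tree_code N \<omega> \<equiv> code N (\<lambda>i xs. X i xs \<omega>)"

lemma measurable_offspring [measurable]: "X i xs \<in> measurable Q (count_space UNIV)"
  using indep unfolding indep_vars_def by (elim conjE ballE[of _ _ "(i, xs)"]) auto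

lemma prob_offspring: "prob {\<omega> \<in> space Q. X i xs \<omega> = v} = exp (- 1) / fact v"
proof -
  have "prob {\<omega> \<in> space Q. X i xs \<omega> = v} = measure (distr Q (count_space UNIV) (X i xs)) {v}"
    by (subst measure_distr) (auto simp: vimage_def Int_def conj_commute)
  also have "\<dots> = pmf (poisson_pmf 1) v" by (simp add: poisson pmf.rep_eq)
  finally show ?thesis by simp
qed

lemma tree_code_eq_sets:
  assumes "code N c = c"
  shows "{\<omega> \<in> space Q. tree_code N \<omega> = c} \<in> sets Q"
  unfolding code_eq_iff[OF assms]
proof (rule sets.sets_Collect_finite_All)
  fix p assume "p \<in> expanded N c"
  have "{\<omega> \<in> space Q. X (fst p) (snd p) \<omega> = nchild c p} = X (fst p) (snd p) -` {nchild c p} \<inter> space Q"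
    by auto
  then show "{\<omega> \<in> space Q. nchild (\<lambda>i xs. X i xs \<omega>) p = nchild c p} \<in> sets Q"
    using measurable_sets[OF measurable_offspring[of "fst p" "snd p"], of "{nchild c p}"]
    by (simp add: nchild_def)
qed simp

lemma prob_tree_code:
  assumes "code N c = c" "0 < N"
  shows "prob {\<omega> \<in> space Q. tree_code N \<omega> = c} = code_prob N c"
proof -
  have ne: "expanded N c \<noteq> {}" using assms(2) spine_in_expanded[of 0 N c] by blast
  have pre: "(case p of (i, xs) \<Rightarrow> X i xs) -` {nchild c p} \<inter> space Q
      = {\<omega> \<in> space Q. X (fst p) (snd p) \<omega> = nchild c p}" for p
    by (auto simp: split_beta)
  have "{\<omega> \<in> space Q. tree_code N \<omega> = c}
      = (\<Inter>p\<in>expanded N c. (case p of (i, xs) \<Rightarrow> X i xs) -` {nchild c p} \<inter> space Q)"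
    unfolding pre code_eq_iff[OF assms(1)] using ne by (auto simp: nchild_def)
  also have "prob \<dots> = (\<Prod>p\<in>expanded N c. prob ((case p of (i, xs) \<Rightarrow> X i xs) -` {nchild c p} \<inter> space Q))"
    by (rule indep_varsD[OF indep ne]) auto
  also have "\<dots> = (\<Prod>p\<in>expanded N c. exp (- 1) / fact (nchild c p))"
    unfolding pre prob_offspring ..
  also have "\<dots> = code_prob N c"
    by (simp add: code_prob_def prod_dividef exp_of_nat_mult[symmetric])
  finally show ?thesis .
qed

lemma tree_code_sets: "{\<omega> \<in> space Q. B (tree_code N \<omega>)} \<in> sets Q"
proof -
  have "{\<omega> \<in> space Q. B (tree_code N \<omega>)} =
      (\<Union>M. \<Union>c\<in>{c \<in> bounded_codes N M. B c}. {\<omega> \<in> space Q. tree_code N \<omega> = c})"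
    using code_in_bounded_codes[of N] by auto
  also have "\<dots> \<in> sets Q"
  proof -
    have "(\<Union>c\<in>{c \<in> bounded_codes N M. B c}. {\<omega> \<in> space Q. tree_code N \<omega> = c}) \<in> sets Q" for M
    proof (rule sets.finite_UN)
      show "finite {c \<in> bounded_codes N M. B c}" using finite_bounded_codes by (rule rev_finite_subset) auto
    qed (auto intro!: tree_code_eq_sets simp: bounded_codes_def)
    then show ?thesis by blast
  qed
  finally show ?thesis .
qed

text \<open>Every outcome has a code bounded by some \<open>M\<close>, so by continuity of measure
  all but \<epsilon> of the mass sits on finitely many codes.\<close>

lemma prob_tree_code_le:
  assumes "0 < \<epsilon>" "0 < N"
  shows "\<exists>M. prob {\<omega> \<in> space Q. B (tree_code N \<omega>)} \<le> (\<Sum>c\<in>{c \<in> bounded_codes N M. B c}. code_prob N c) + \<epsilon>"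
proof -
  define S where "S M = {\<omega> \<in> space Q. tree_code N \<omega> \<in> bounded_codes N M}" for M
  have Sm: "S M \<in> sets Q" for M unfolding S_def by (rule tree_code_sets)
  have "incseq S" using bounded_codes_mono by (fastforce simp: incseq_def S_def)
  then have "(\<lambda>M. prob (S M)) \<longlonglongrightarrow> prob (\<Union>M. S M)"
    using Sm by (intro finite_Lim_measure_incseq) auto
  also have "(\<Union>M. S M) = space Q" using code_in_bounded_codes[of N] by (auto simp: S_def)
  finally have "(\<lambda>M. prob (S M)) \<longlonglongrightarrow> 1" by (simp add: prob_space)
  then have "\<forall>\<^sub>F M in sequentially. 1 - \<epsilon> < prob (S M)"
    using assms(1) by (intro order_tendstoD(1)) auto
  then obtain M where M: "1 - \<epsilon> < prob (S M)" by (auto simp: eventually_sequentially)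
  define F where "F = {c \<in> bounded_codes N M. B c}"
  have finF: "finite F" unfolding F_def using finite_bounded_codes by (rule rev_finite_subset) auto
  have canon: "code N c = c" if "c \<in> F" for c using that by (simp add: F_def bounded_codes_def)
  have "prob {\<omega> \<in> space Q. B (tree_code N \<omega>)} \<le>
      prob ((\<Union>c\<in>F. {\<omega> \<in> space Q. tree_code N \<omega> = c}) \<union> (space Q - S M))"
    using Sm finF tree_code_eq_sets[OF canon]
    by (intro finite_measure_mono sets.Un sets.finite_UN) (auto simp: F_def S_def)
  also have "\<dots> \<le> prob (\<Union>c\<in>F. {\<omega> \<in> space Q. tree_code N \<omega> = c}) + prob (space Q - S M)"
    using Sm finF tree_code_eq_sets[OF canon]
    by (intro measure_subadditive sets.finite_UN) auto
  also have "prob (\<Union>c\<in>F. {\<omega> \<in> space Q. tree_code N \<omega> = c}) = (\<Sum>c\<in>F. prob {\<omega> \<in> space Q. tree_code N \<omega> = c})"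
    using finF tree_code_eq_sets[OF canon]
    by (intro finite_measure_finite_Union) (auto simp: disjoint_family_on_def)
  also have "\<dots> = (\<Sum>c\<in>F. code_prob N c)"
    using assms(2) canon by (intro sum.cong refl prob_tree_code)
  also have "prob (space Q - S M) \<le> \<epsilon>" using prob_compl[OF Sm[of M]] M by simp
  finally show ?thesis unfolding F_def by (intro exI[of _ M]) simp
qed

end

section \<open>Local convergence\<close>

context rooted_complete
begin

text \<open>The code events are disjoint, and on each of them the ball has the type dictated by the
  code unless 1 is bad. Summing the sizes over \<open>F\<close> gives one size bound valid for all
  codes in \<open>F\<close>.\<close>

lemma prob_target_ge:
  assumes r: "0 \<le> r" and N: "N = 2 * nat \<lfloor>r\<rfloor> + 1"
    and fin: "finite F" and canon: "\<And>c. c \<in> F \<Longrightarrow> code N c = c"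
    and iso: "\<And>c. c \<in> F \<Longrightarrow>
      ((rooted_ball (with_proj (spine_tree c)) (0, []) r, (0, [])) \<simeq>\<^sub>r (with_proj H, u)) = b"
  shows "(\<Sum>c\<in>F. Pr.prob {w \<in> space P. \<exists>\<phi>. encodes N c V (rowmin w) \<phi>})
      - Pr.prob {w \<in> space P. bad (\<Sum>c\<in>F. card (positions N c)) (nat \<lfloor>r\<rfloor>) 1 (rmin w) (mina w)}
    \<le> Pr.prob {w \<in> space P.
      ((rooted_ball (with_proj (min_arborescence n d w)) 1 r, 1) \<simeq>\<^sub>r (with_proj H, u)) = b}"
    (is "?C - Pr.prob ?B \<le> Pr.prob ?T")
proof -
  define A where "A c = {w \<in> space P. \<exists>\<phi>. encodes N c V (rowmin w) \<phi>}" for c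
  have A: "A c \<in> sets P" for c
    unfolding A_def
  proof (rule pat_measurable)
    fix w w' assume "pat w = pat w'"
    then have "rowmin w = rowmin w'" by (rule rowmin_cong)
    then show "(\<exists>\<phi>. encodes N c V (rowmin w) \<phi>) = (\<exists>\<phi>. encodes N c V (rowmin w') \<phi>)" by simp
  qed
  have T: "?T \<in> sets P"
  proof (rule pat_measurable)
    fix w w' assume "pat w = pat w'"
    from mina_cong[OF this] have "min_arborescence n d w = min_arborescence n d w'"
      by (simp add: mina_def min_arborescence_def)
    then show "(((rooted_ball (with_proj (min_arborescence n d w)) 1 r, 1) \<simeq>\<^sub>r (with_proj H, u)) = b)
        = (((rooted_ball (with_proj (min_arborescence n d w')) 1 r, 1) \<simeq>\<^sub>r (with_proj H, u)) = b)" by simp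
  qed
  have "disjoint_family_on A F"
    unfolding disjoint_family_on_def
  proof (intro ballI impI)
    fix c c' assume c: "c \<in> F" "c' \<in> F" "c \<noteq> c'"
    show "A c \<inter> A c' = {}"
    proof (rule ccontr)
      assume "A c \<inter> A c' \<noteq> {}"
      then obtain w \<phi> \<phi>' where "encodes N c V (rowmin w) \<phi>" "encodes N c' V (rowmin w) \<phi>'"
        by (auto simp: A_def)
      from encodes_unique(1,2)[OF this] have "code N c = code N c'" by (rule code_eqI)
      then show False using c canon by simp
    qed
  qed
  then have "?C = Pr.prob (\<Union>c\<in>F. A c)"
    using Pr.finite_measure_finite_Union[OF fin _ \<open>disjoint_family_on A F\<close>] A
    by (simp add: A_def image_subset_iff)
  also have "\<dots> \<le> Pr.prob (?T \<union> ?B)"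
  proof (rule Pr.finite_measure_mono)
    show "(\<Union>c\<in>F. A c) \<subseteq> ?T \<union> ?B"
    proof
      fix w assume "w \<in> (\<Union>c\<in>F. A c)"
      then obtain c \<phi> where c: "c \<in> F" "w \<in> space P" and enc: "encodes N c V (rowmin w) \<phi>"
        by (auto simp: A_def)
      have "card (positions N c) \<le> (\<Sum>c\<in>F. card (positions N c))"
        using fin c(1) by (intro member_le_sum) auto
      from rooted_ball_iso_min_arborescence[OF enc r N this, of H u] iso[OF c(1)]
      show "w \<in> ?T \<union> ?B" using c(2) by blast
    qed
    show "?T \<union> ?B \<in> sets P" using T bad_sets by (intro sets.Un)
  qed
  also have "\<dots> \<le> Pr.prob ?T + Pr.prob ?B"
    by (rule measure_subadditive) (use T bad_sets in auto)
  finally show ?thesis by simp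
qed

text \<open>The joint law of independent Exponential(1) weights is the product measure
  \<open>P\<close>, and \<open>Q\<close> does not see values outside \<open>E\<close>.\<close>

lemma prob_transfer:
  assumes M: "prob_space M" and indep: "prob_space.indep_vars M (\<lambda>_. borel) Y E"
    and dist: "\<And>e. e \<in> E \<Longrightarrow> distributed M lborel (Y e) (exponential_density 1)"
    and Q: "\<And>w w'. pat w = pat w' \<Longrightarrow> Q w = Q w'"
  shows "measure M {\<omega> \<in> space M. Q (\<lambda>e. Y e \<omega>)} = Pr.prob {w \<in> space P. Q w}"
proof -
  interpret MM: prob_space M by fact
  have ne: "E \<noteq> {}" using edge_in_E[OF one_in_V, of d] d_mem by auto
  have rv: "Y e \<in> borel_measurable M" if "e \<in> E" for e
    using distributed_measurable[OF dist[OF that]] by simp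
  have "distr M borel (Y e) = exp_measure" if "e \<in> E" for e
  proof -
    have "distr M borel (Y e) = distr M lborel (Y e)" by (intro distr_cong) auto
    also have "\<dots> = exp_measure" by (rule distributed_distr_eq_density[OF dist[OF that]])
    finally show ?thesis .
  qed
  then have eqP: "distr M (PiM E (\<lambda>_. borel)) (\<lambda>\<omega>. \<lambda>e\<in>E. Y e \<omega>) = P"
    using MM.indep_vars_iff_distr_eq_PiM'[OF ne, of Y "\<lambda>_. borel"] rv indep
    unfolding P_def by (simp cong: PiM_cong)
  have sets: "{w \<in> space P. Q w} \<in> sets (PiM E (\<lambda>_. borel))"
  proof -
    have "sets P = sets (PiM E (\<lambda>_. borel :: real measure))"
      unfolding P_def by (intro sets_PiM_cong) simp_all
    then show ?thesis using pat_measurable[of Q, OF Q] by simp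
  qed
  have meas: "(\<lambda>\<omega>. \<lambda>e\<in>E. Y e \<omega>) \<in> measurable M (PiM E (\<lambda>_. borel))"
    using rv by (rule measurable_restrict)
  have "Pr.prob {w \<in> space P. Q w} = measure M ((\<lambda>\<omega>. \<lambda>e\<in>E. Y e \<omega>) -` {w \<in> space P. Q w} \<inter> space M)"
    unfolding eqP[symmetric] using sets by (intro measure_distr meas) (simp add: eqP)
  also have "(\<lambda>\<omega>. \<lambda>e\<in>E. Y e \<omega>) -` {w \<in> space P. Q w} \<inter> space M = {\<omega> \<in> space M. Q (\<lambda>e. Y e \<omega>)}"
  proof -
    have "Q (\<lambda>e\<in>E. Y e \<omega>) = Q (\<lambda>e. Y e \<omega>)" for \<omega>
      by (rule Q[OF pat_restrict])
    moreover have "(\<lambda>e\<in>E. Y e \<omega>) \<in> space P" for \<omega> by (simp add: space_P)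
    ultimately show ?thesis by auto
  qed
  finally show ?thesis ..
qed

end

lemma min_arborescence_pat_cong:
  assumes "rooted_complete n d" "rooted_complete.pat n w = rooted_complete.pat n w'"
  shows "min_arborescence n d w = min_arborescence n d w'"
  using rooted_complete.mina_cong[OF assms] rooted_complete.mina_def[OF assms(1)]
  by (simp add: min_arborescence_def)

text \<open>It suffices to bound the limit inferior from below, both for the event and for its
  complement; hence the parameter \<open>b\<close>.\<close>

lemma eventually_prob_target_ge:
  fixes d :: "nat \<Rightarrow> nat" and H :: "'h pair_pre_digraph"
  assumes d: "\<And>n. 2 \<le> n \<Longrightarrow> d n \<in> {1..n} - {1}" and r: "0 \<le> r"
    and "poisson_tree Q X" and \<epsilon>: "0 < \<epsilon>"
  shows "\<forall>\<^sub>F n in sequentially. measure Q {\<omega> \<in> space Q.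
      ((rooted_ball (with_proj (spine_tree (\<lambda>i xs. X i xs \<omega>))) (0, []) r, (0, [])) \<simeq>\<^sub>r (with_proj H, u)) = b} - \<epsilon>
    \<le> measure (rooted_complete.P n) {w \<in> space (rooted_complete.P n).
      ((rooted_ball (with_proj (min_arborescence n (d n) w)) 1 r, 1) \<simeq>\<^sub>r (with_proj H, u)) = b}"
proof -
  interpret poisson_tree Q X by fact
  define N where "N = 2 * nat \<lfloor>r\<rfloor> + 1"
  have N: "0 < N" "nat \<lfloor>r\<rfloor> < N" by (simp_all add: N_def)
  define B where "B c \<longleftrightarrow> ((rooted_ball (with_proj (spine_tree c)) (0, []) r, (0, [])) \<simeq>\<^sub>r (with_proj H, u)) = b" for c
  have Bcode: "B (tree_code N \<omega>) = B (\<lambda>i xs. X i xs \<omega>)" for \<omega>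
    unfolding B_def rooted_ball_iso_code[OF r N(2)] ..
  \<comment> \<open>Half of \<epsilon> pays for the truncation to finitely many codes, the other
    half for the convergence of the bounds below.\<close>
  obtain M where M: "prob {\<omega> \<in> space Q. B (tree_code N \<omega>)} \<le>
      (\<Sum>c\<in>{c \<in> bounded_codes N M. B c}. code_prob N c) + \<epsilon> / 2"
    using prob_tree_code_le[of "\<epsilon> / 2" N B] \<epsilon> N by auto
  define F where "F = {c \<in> bounded_codes N M. B c}"
  have finF: "finite F" unfolding F_def using finite_bounded_codes by (rule rev_finite_subset) auto
  define m where "m = (\<Sum>c\<in>F. card (positions N c))"
  define lb where "lb c n = (\<Prod>i<card (positions N c) - 1. real (n - 2 - i) / real (n - 1)) *
      (real (n - 1 - card (expanded N c)) / real (n - 1)) ^ (n - 1) / (\<Prod>p\<in>expanded N c. fact (nchild c p))"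
    for c and n :: nat
  define bd where "bd n = measure (rooted_complete.P n) {w \<in> space (rooted_complete.P n).
      bad m (nat \<lfloor>r\<rfloor>) 1 (rooted_complete.rmin n (d n) w) (rooted_complete.mina n (d n) w)}" for n
  have "(\<lambda>n. (\<Sum>c\<in>F. lb c n) - bd n) \<longlonglongrightarrow> (\<Sum>c\<in>F. code_prob N c) - 0"
    unfolding lb_def code_prob_def bd_def
    by (intro tendsto_diff tendsto_sum code_prob_lower_bound_tendsto prob_bad_tendsto_0 d)
  then have ev: "\<forall>\<^sub>F n in sequentially. (\<Sum>c\<in>F. code_prob N c) - \<epsilon> / 2 < (\<Sum>c\<in>F. lb c n) - bd n"
    using \<epsilon> by (intro order_tendstoD(1)[of _ "(\<Sum>c\<in>F. code_prob N c) - 0"]) auto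
  have "\<forall>\<^sub>F n in sequentially. \<forall>c\<in>F. card (positions N c) - 1 \<le> n - 1 \<and> card (expanded N c) \<le> n - 1"
  proof (rule eventually_ball_finite[OF finF], rule ballI)
    fix c
    show "\<forall>\<^sub>F n in sequentially. card (positions N c) - 1 \<le> n - 1 \<and> card (expanded N c) \<le> n - 1"
      using eventually_ge_at_top[of "card (positions N c) + card (expanded N c) + 1"]
      by eventually_elim linarith
  qed
  with ev show ?thesis
    using eventually_ge_at_top[of 2]
  proof eventually_elim
    case (elim n)
    interpret R: rooted_complete n "d n" using d[OF elim(3)] by unfold_locales
    have "prob {\<omega> \<in> space Q. B (\<lambda>i xs. X i xs \<omega>)} - \<epsilon> \<le> (\<Sum>c\<in>F. code_prob N c) - \<epsilon> / 2"
      using M unfolding Bcode F_def[symmetric] by simp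
    also have "\<dots> \<le> (\<Sum>c\<in>F. lb c n) - bd n" using elim(1) by simp
    also have "\<dots> \<le> (\<Sum>c\<in>F. R.Pr.prob {w \<in> space R.P. \<exists>\<phi>. encodes N c R.V (R.rowmin w) \<phi>}) - bd n"
      unfolding lb_def using elim(2) by (intro diff_right_mono sum_mono R.prob_code_ge) auto
    also have "\<dots> \<le> R.Pr.prob {w \<in> space R.P.
        ((rooted_ball (with_proj (min_arborescence n (d n) w)) 1 r, 1) \<simeq>\<^sub>r (with_proj H, u)) = b}"
      unfolding bd_def m_def
      by (rule R.prob_target_ge[OF r N_def finF]) (auto simp: F_def bounded_codes_def B_def)
    finally show ?case unfolding B_def .
  qed
qed

theorem theorem1p2:
  fixes \<Omega> :: "nat \<Rightarrow> 'w measure"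
    and W :: "nat \<Rightarrow> nat \<times> nat \<Rightarrow> 'w \<Rightarrow> real"
    and d :: "nat \<Rightarrow> nat"
    and Q :: "'q measure"
    and X :: "nat \<Rightarrow> nat list \<Rightarrow> 'q \<Rightarrow> nat"
    and r :: real
    and H :: "'h pair_pre_digraph"
    and u :: 'h
  assumes "\<And>n. n \<ge> 2 \<Longrightarrow> prob_space (\<Omega> n)"
    and "\<And>n. n \<ge> 2 \<Longrightarrow>
      prob_space.indep_vars (\<Omega> n) (\<lambda>_. borel) (W n) (parcs (complete_oriented n))"
    and "\<And>n e. n \<ge> 2 \<Longrightarrow> e \<in> parcs (complete_oriented n) \<Longrightarrow>
      distributed (\<Omega> n) lborel (W n e) (exponential_density 1)"
    and "\<And>n. n \<ge> 2 \<Longrightarrow> d n \<in> {1..n} - {1}"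
    and "prob_space Q"
    and "prob_space.indep_vars Q (\<lambda>_. count_space UNIV) (\<lambda>(i, xs). X i xs) UNIV"
    and "\<And>i xs. distr Q (count_space UNIV) (X i xs) = measure_pmf (poisson_pmf 1)"
    and "r \<ge> 0"
    and "pair_fin_digraph H" and "u \<in> pverts H"
  shows "(\<lambda>n. \<P>(\<omega> in \<Omega> n.
            (rooted_ball (with_proj (min_arborescence n (d n) (\<lambda>e. W n e \<omega>))) 1 r, 1)
              \<simeq>\<^sub>r (with_proj H, u)))
         \<longlonglongrightarrow>
         \<P>(\<omega> in Q.
            (rooted_ball (with_proj (spine_tree (\<lambda>i xs. X i xs \<omega>))) (0, []) r, (0, []))
              \<simeq>\<^sub>r (with_proj H, u))"
proof -
  interpret Q: prob_space Q by fact
  have tree: "poisson_tree Q X"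
    using assms(5-7) by (simp add: poisson_tree_def poisson_tree_axioms_def)
  interpret T: poisson_tree Q X by (rule tree)
  define tgt where "tgt n w \<longleftrightarrow>
    (rooted_ball (with_proj (min_arborescence n (d n) w)) 1 r, 1) \<simeq>\<^sub>r (with_proj H, u)" for n w
  define lim where "lim \<omega> \<longleftrightarrow>
    (rooted_ball (with_proj (spine_tree (\<lambda>i xs. X i xs \<omega>))) (0, []) r, (0, [])) \<simeq>\<^sub>r (with_proj H, u)" for \<omega>
  define p where "p n = measure (rooted_complete.P n) {w \<in> space (rooted_complete.P n). tgt n w}" for n
  define q where "q = measure Q {\<omega> \<in> space Q. lim \<omega>}"
  have rc: "rooted_complete n (d n)" if "2 \<le> n" for n
    using assms(4)[OF that] by unfold_locales
  have tgt_cong: "tgt n w = tgt n w'"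
    if "2 \<le> n" "rooted_complete.pat n w = rooted_complete.pat n w'" for n w w'
    using min_arborescence_pat_cong[OF rc[OF that(1)] that(2)] by (simp add: tgt_def)
  have lower: "\<forall>\<^sub>F n in sequentially. q - \<epsilon> \<le> p n" if "0 < \<epsilon>" for \<epsilon>
    using eventually_prob_target_ge[OF assms(4,8) tree that, of H u True]
    by (simp add: p_def q_def tgt_def lim_def)
  have upper: "\<forall>\<^sub>F n in sequentially. p n \<le> q + \<epsilon>" if "0 < \<epsilon>" for \<epsilon>
  proof -
    have "\<forall>\<^sub>F n in sequentially. measure Q {\<omega> \<in> space Q. \<not> lim \<omega>} - \<epsilon> \<le>
        measure (rooted_complete.P n) {w \<in> space (rooted_complete.P n). \<not> tgt n w}"
      using eventually_prob_target_ge[OF assms(4,8) tree that, of H u False]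
      by (simp add: tgt_def lim_def)
    then show ?thesis
      using eventually_ge_at_top[of 2]
    proof eventually_elim
      case (elim n)
      interpret R: rooted_complete n "d n" by (rule rc[OF elim(2)])
      have "{w \<in> space R.P. tgt n w} \<in> sets R.P"
        by (rule R.pat_measurable) (rule tgt_cong[OF elim(2)])
      then have "R.Pr.prob {w \<in> space R.P. \<not> tgt n w} = 1 - p n"
        by (simp add: R.Pr.prob_neg p_def)
      \<comment> \<open>Taking complements requires \<open>lim\<close> to be measurable; it is,
        being a function of the tree code.\<close>
      moreover have "{\<omega> \<in> space Q. lim \<omega>} \<in> sets Q"
      proof -
        have "lim \<omega> \<longleftrightarrow> (rooted_ball (with_proj (spine_tree (T.tree_code (nat \<lfloor>r\<rfloor> + 1) \<omega>))) (0, []) r, (0, []))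
            \<simeq>\<^sub>r (with_proj H, u)" for \<omega>
          using rooted_ball_iso_code[OF assms(8), of "nat \<lfloor>r\<rfloor> + 1" "\<lambda>i xs. X i xs \<omega>" H u]
          by (simp add: lim_def)
        then show ?thesis using T.tree_code_sets by simp
      qed
      then have "measure Q {\<omega> \<in> space Q. \<not> lim \<omega>} = 1 - q"
        by (simp add: Q.prob_neg q_def)
      ultimately show ?case using elim(1) by simp
    qed
  qed
  have "p \<longlonglongrightarrow> q"
  proof (rule LIMSEQ_I)
    fix \<epsilon> :: real assume "0 < \<epsilon>"
    then have "0 < \<epsilon> / 2" by simp
    from lower[OF this] upper[OF this] have "\<forall>\<^sub>F n in sequentially. norm (p n - q) < \<epsilon>"
      by eventually_elim (use \<open>0 < \<epsilon>\<close> in \<open>auto simp: abs_less_iff\<close>)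
    then show "\<exists>no. \<forall>n\<ge>no. norm (p n - q) < \<epsilon>" by (simp add: eventually_sequentially)
  qed
  then have "(\<lambda>n. measure (\<Omega> n) {\<omega> \<in> space (\<Omega> n). tgt n (\<lambda>e. W n e \<omega>)}) \<longlonglongrightarrow> q"
  proof (rule Lim_transform_eventually)
    show "\<forall>\<^sub>F n in sequentially. p n = measure (\<Omega> n) {\<omega> \<in> space (\<Omega> n). tgt n (\<lambda>e. W n e \<omega>)}"
      using eventually_ge_at_top[of 2]
    proof eventually_elim
      case (elim n)
      interpret R: rooted_complete n "d n" by (rule rc[OF elim])
      show ?case
        unfolding p_def
        by (rule R.prob_transfer[OF assms(1)[OF elim] assms(2)[OF elim] assms(3)[OF elim]
            tgt_cong[OF elim], symmetric]; assumption)
    qed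
  qed
  then show ?thesis unfolding tgt_def lim_def q_def .
qed

end
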